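(* Let $0<\alpha\le 2$, $d\ge1$, and let $\{\xi_i\}_{i\in\mathbb{Z}^d}$ be i.i.d. random variables in the domain of attraction of an $\alpha$-stable law, with $\mathbb{E}\xi_0^2=\infty$, satisfying Condition $\boldsymbol{A}$ and having characteristic function $$\varphi_\xi(t)=\exp\{-c_\alpha|t|^\alpha L(1/|t|)(1-\iota\beta\tau(\alpha,t))\}\quad\text{for } t \text{ in a neighborhood of zero.}$$ Let $S_n=\sum_{i\in\mathbb{Z}^d}b_{ni}\xi_i$, where $\{b_{ni}\}_{i\in\mathbb{Z}^d}$, $n\ge1$, are real numbers with $\sum_{i\in\mathbb{Z}^d}|b_{ni}|^{\alpha}L(1/|b_{ni}|)<\infty$ for every $n$, and let $$B_n=\inf\Big\{x\ge1:\sum_{i\in\mathbb{Z}^d}(|b_{ni}|/x)^{\alpha}L(x/|b_{ni}|)\le1\Big\}.$$ Assume $B_n\to\infty$ as $n\to\infty$. In the case $\limsup_{n\to\infty}\sup_{i\in\mathbb{Z}^d}|b_{ni}|=\infty$, assume additionally that $\Delta_n=o(B_n)$, where $\Delta_n=\sup_{i\in\mathbb{Z}^d}|\Delta b_{ni}|$. 1. If for some $0\le c\le1$, with $c_{ni}=b_{ni}/B_n$, $$\lim_{n\to\infty}\sum_{i\in\mathbb{Z}^d,\,c_{ni}>0}|c_{ni}|^{\alpha}L(1/|c_{ni}|)=c,\qquad \lim_{n\to\infty}\sum_{i\in\mathbb{Z}^d,\,c_{ni}<0}|c_{ni}|^{\alpha}L(1/|c_{ni}|)=1-c,$$ then $S_n/B_n$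 converges weakly to an $\alpha$-stable random variable of the form $c^{1/\alpha}S'-(1-c)^{1/\alpha}S''$, where $S'$ and $S''$ are independent $\alpha$-stable random variables, each with distribution function $G$ (characteristic function $\exp\{-c_\alpha|t|^\alpha(1-\iota\beta\tau(\alpha,t))\}$). 2. If either the innovations have a symmetric distribution or $b_{ni}\ge0$ for all $n$ and $i$, then $S_n/B_n$ converges weakly to an $\alpha$-stable random variable with distribution function $G$.
   Context: $\iota=\sqrt{-1}$. Innovations: $\{\xi_i\}_{i\in\mathbb{Z}^d}$ are i.i.d. real random variables with $\mathbb{E}\xi_0^2=\infty$, in the domain of attraction of a stable law with index $0<\alpha\le2$, in the following sense: $\lim_{x\to\infty}\mathbb{P}(|\xi_0|>x)/(x^{-\alpha}L_1(x))=1$ for a function $L_1$ slowly varying at infinity, and, when $0<\alpha<2$, $\mathbb{P}(\xi_0>x)/\mathbb{P}(|\xi_0|>x)\to c^+$ and $\mathbb{P}(\xi_0<-x)/\mathbb{P}(|\xi_0|>x)\to c^-$ as $x\to\infty$, where $0\le c^+\le1$, $c^++c^-=1$. Condition $\boldsymbol{A}$: $\mathbb{E}\xi_0=0$ if $1<\alpha\le2$, and $\xi_0$ has a symmetric distribution if $\alpha=1$. Function $L$: let $b=\inf\{x\ge1:\mathbb{E}(\xi_0^2I(|\xi_0|\le x))>1\}$. For $0<\alpha<2$, $L(x)=\frac{2-\alpha}{\alpha}x^{\alpha-2}\mathbb{E}(\xi_0^2I(|\xi_0|\le x))$ for $x\ge b$ and $L(x)=\frac{2-\alpha}{\alpha}b^{\alpha-2}\mathbb{E}(\xi_0^2I(|\xi_0|\le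 b))$ for $0<x<b$. For $\alpha=2$, $L(x)=\mathbb{E}(\xi_0^2I(|\xi_0|\le x))$ for $x\ge b$ and $L(x)=\mathbb{E}(\xi_0^2I(|\xi_0|\le b))$ for $0<x<b$. $L$ is slowly varying at infinity. Convention: for $x=0$ and $p>0$, $|x|^pL(1/|x|)=0$. Characteristic function: $\varphi_\xi(t)=\mathbb{E}e^{\iota t\xi_0}$. In its form near zero, $c_\alpha>0$ is a constant, $\tau(\alpha,t)=\mathrm{sgn}(t)\tan(\pi\alpha/2)$ if $\alpha\ne1$, $\tau(1,t)=0$, and $\beta=c^+-c^-$ if $0<\alpha<2$ (for $\alpha=2$, $\tau=0$ and $\beta$ is irrelevant). $G$ denotes the distribution function of the $\alpha$-stable law with characteristic function $\exp\{-c_\alpha|t|^\alpha(1-\iota\beta\tau(\alpha,t))\}$, with the same $c_\alpha,\beta,\tau$. The condition $\sum_i|b_{ni}|^\alpha L(1/|b_{ni}|)<\infty$ is the condition for the series defining $S_n$ to converge almost surely. Increments: for real numbers $\{b_i\}_{i\in\mathbb{Z}^d}$, $i=(i_1,\dots,i_d)$, put $\Delta_kb_{i_1,\dots,i_k,\dots,i_d}=b_{i_1,\dots,i_k,\dots,i_d}-b_{i_1,\dots,i_k-1,\dots,i_d}$ and $\Delta b_i=\Delta_1\circ\Delta_2\circ\cdots\circ\Delta_d\,b_i$; $\Delta b_{ni}$ is defined in the same way, for each fixed $n$, from $\{b_{ni}\}_{i\in\mathbb{Z}^d}$. *)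

theory Defs
  imports "HOL-Probability.Probability" "HOL-Library.Landau_Symbols"
begin

section \<open>The innovations\<close>

definition slowly_varying :: "(real \<Rightarrow> real) \<Rightarrow> bool" where
  "slowly_varying l \<longleftrightarrow>
     (\<exists>x\<^sub>0. (\<forall>x\<ge>x\<^sub>0. l x > 0) \<and> l \<in> borel_measurable (restrict_space borel {x\<^sub>0..})) \<and>
     (\<forall>r>0. ((\<lambda>x. l (r * x) / l x) \<longlongrightarrow> 1) at_top)"

text \<open>
  The tail form of the domain of attraction of an \<open>\<alpha>\<close>-stable law. The balance constants
  \<open>c\<^sub>p\<close> and \<open>c\<^sub>m\<close> are the right and left ones; they are not constrained when \<open>\<alpha> = 2\<close>.
\<close>
definition in_domain_of_attraction ::
  "'a measure \<Rightarrow> ('a \<Rightarrow> real) \<Rightarrow> real \<Rightarrow> real \<Rightarrow> real \<Rightarrow> bool" where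
  "in_domain_of_attraction M X \<alpha> c\<^sub>p c\<^sub>m \<longleftrightarrow>
     (\<exists>L\<^sub>1. slowly_varying L\<^sub>1 \<and>
        ((\<lambda>x. measure M {\<omega> \<in> space M. \<bar>X \<omega>\<bar> > x} / (x powr (- \<alpha>) * L\<^sub>1 x)) \<longlongrightarrow> 1) at_top) \<and>
     (\<alpha> < 2 \<longrightarrow>
        0 \<le> c\<^sub>p \<and> c\<^sub>p \<le> 1 \<and> c\<^sub>p + c\<^sub>m = 1 \<and>
        ((\<lambda>x. measure M {\<omega> \<in> space M. X \<omega> > x} / measure M {\<omega> \<in> space M. \<bar>X \<omega>\<bar> > x})
           \<longlongrightarrow> c\<^sub>p) at_top \<and>
        ((\<lambda>x. measure M {\<omega> \<in> space M. X \<omega> < - x} / measure M {\<omega> \<in> space M. \<bar>X \<omega>\<bar> > x})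
           \<longlongrightarrow> c\<^sub>m) at_top)"

definition symmetric_rv :: "'a measure \<Rightarrow> ('a \<Rightarrow> real) \<Rightarrow> bool" where
  "symmetric_rv M X \<longleftrightarrow> distr M borel (\<lambda>\<omega>. - X \<omega>) = distr M borel X"

definition condition_A :: "'a measure \<Rightarrow> ('a \<Rightarrow> real) \<Rightarrow> real \<Rightarrow> bool" where
  "condition_A M X \<alpha> \<longleftrightarrow>
     (1 < \<alpha> \<longrightarrow> integrable M X \<and> (LINT \<omega>|M. X \<omega>) = 0) \<and>
     (\<alpha> = 1 \<longrightarrow> symmetric_rv M X)"

definition truncated_second_moment :: "'a measure \<Rightarrow> ('a \<Rightarrow> real) \<Rightarrow> real \<Rightarrow> real" where
  "truncated_second_moment M X x = (LINT \<omega>|M. (X \<omega>)\<^sup>2 * indicator {\<omega>. \<bar>X \<omega>\<bar> \<le> x} \<omega>)"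

definition L_cutoff :: "'a measure \<Rightarrow> ('a \<Rightarrow> real) \<Rightarrow> real" where
  "L_cutoff M X = Inf {x. x \<ge> 1 \<and> truncated_second_moment M X x > 1}"

text \<open>
  Only the values at \<open>x > 0\<close> matter: the convention \<open>\<bar>x\<bar>\<^sup>p L(1/\<bar>x\<bar>) = 0\<close> at \<open>x = 0\<close> holds
  automatically, because \<open>0 powr p = 0\<close>.
\<close>
definition L_fun :: "'a measure \<Rightarrow> ('a \<Rightarrow> real) \<Rightarrow> real \<Rightarrow> real \<Rightarrow> real" where
  "L_fun M X \<alpha> x =
     (let y = (if x \<ge> L_cutoff M X then x else L_cutoff M X) in
      if \<alpha> < 2 then (2 - \<alpha>) / \<alpha> * y powr (\<alpha> - 2) * truncated_second_moment M X y
      else truncated_second_moment M X y)"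

section \<open>Stable laws\<close>

definition stable_tau :: "real \<Rightarrow> real \<Rightarrow> real" where
  "stable_tau \<alpha> t = (if \<alpha> = 1 then 0 else sgn t * tan (pi * \<alpha> / 2))"

definition stable_law :: "real \<Rightarrow> real \<Rightarrow> real \<Rightarrow> real measure" where
  "stable_law \<alpha> c\<^sub>\<alpha> \<beta> =
     (THE G. real_distribution G \<and>
        (\<forall>t. char G t =
           exp (- complex_of_real (c\<^sub>\<alpha> * \<bar>t\<bar> powr \<alpha>) *
                (1 - \<i> * complex_of_real (\<beta> * stable_tau \<alpha> t)))))"

text \<open>
  Nondegenerate and, for independent \<open>X\<^sub>1\<close>, \<open>X\<^sub>2\<close>, \<open>X\<close> with law \<open>\<mu>\<close> and all \<open>a, b > 0\<close>,
  \<open>a X\<^sub>1 + b X\<^sub>2\<close> has the same law as \<open>(a\<^sup>\<alpha> + b\<^sup>\<alpha>)\<^sup>1\<^sup>/\<^sup>\<alpha> X + D\<close> for some real \<open>D\<close>.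
\<close>
definition alpha_stable :: "real \<Rightarrow> real measure \<Rightarrow> bool" where
  "alpha_stable \<alpha> \<mu> \<longleftrightarrow>
     real_distribution \<mu> \<and> \<not> (\<exists>m. AE x in \<mu>. x = m) \<and>
     (\<forall>a>0. \<forall>b>0. \<exists>D.
        distr (\<mu> \<Otimes>\<^sub>M \<mu>) borel (\<lambda>(x, y). a * x + b * y) =
        distr \<mu> borel (\<lambda>x. (a powr \<alpha> + b powr \<alpha>) powr (1 / \<alpha>) * x + D))"

section \<open>Increments, linear fields and norming constants\<close>

text \<open>The lattice of dimension \<open>d\<close> is rendered as \<open>int ^ 'd\<close>, with \<open>d = CARD('d)\<close>.\<close>

definition increment_in :: "'d \<Rightarrow> (int ^ 'd \<Rightarrow> real) \<Rightarrow> int ^ 'd \<Rightarrow> real" where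
  "increment_in k b = (\<lambda>i. b i - b (i - axis k 1))"

text \<open>
  The composition of the one-coordinate increments over all coordinates. They commute, so
  \<open>Finite_Set.fold\<close> is the composition in any order; see \<open>increment_eq_foldr\<close>.
\<close>
definition increment :: "(int ^ 'd::finite \<Rightarrow> real) \<Rightarrow> int ^ 'd \<Rightarrow> real" where
  "increment b = Finite_Set.fold increment_in b UNIV"

lemma comp_fun_commute_increment_in: "comp_fun_commute (increment_in :: 'd::finite \<Rightarrow> _)"
  by standard (auto simp: increment_in_def fun_eq_iff algebra_simps)

lemma increment_eq_foldr:
  assumes "distinct ks" "set ks = (UNIV :: 'd::finite set)"
  shows "increment b = foldr increment_in ks b"
proof -
  interpret comp_fun_commute "increment_in :: 'd \<Rightarrow> _"
    by (rule comp_fun_commute_increment_in)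
  have "Finite_Set.fold increment_in b (set ks) = foldr increment_in ks b"
    using assms(1) by (induction ks) auto
  then show ?thesis
    using assms(2) by (simp add: increment_def)
qed

text \<open>
  The sum of the random series \<open>\<Sum>i. X i\<close> over a countable index set, in the sense of almost sure
  convergence, summed along finite sets \<open>F k\<close> increasing to the index set. The series need not be
  absolutely convergent, so \<open>infsum\<close> would not do. The null set on which the partial sums diverge
  is given the default value of \<open>lim\<close>.
\<close>
definition series_sum :: "(nat \<Rightarrow> 'i set) \<Rightarrow> ('i \<Rightarrow> 'a \<Rightarrow> real) \<Rightarrow> 'a \<Rightarrow> real" where
  "series_sum F X \<omega> = lim (\<lambda>k. \<Sum>i\<in>F k. X i \<omega>)"

text \<open>
  The summability clause expresses that the sum of nonnegative terms is finite; a divergent real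
  \<open>infsum\<close> would be \<open>0\<close>.
\<close>
definition norming :: "real \<Rightarrow> (real \<Rightarrow> real) \<Rightarrow> ('i \<Rightarrow> real) \<Rightarrow> real" where
  "norming \<alpha> L b =
     Inf {x. x \<ge> 1 \<and>
             (\<lambda>i. (\<bar>b i\<bar> / x) powr \<alpha> * L (x / \<bar>b i\<bar>)) summable_on UNIV \<and>
             (\<Sum>\<^sub>\<infinity>i. (\<bar>b i\<bar> / x) powr \<alpha> * L (x / \<bar>b i\<bar>)) \<le> 1}"

end

theory Submission
  imports Defs
begin

text \<open>
  Put \<open>h(u) = u\<^sup>\<alpha> L(1/u)\<close>. Karamata's argument, applied to
  \<open>E min(X\<^sup>2, x\<^sup>2) = \<integral>\<^sub>0\<^sup>x 2 y P(\<bar>X\<bar> > y) dy\<close>, makes the truncated second moment regularly varying, so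
  \<open>h(r u) / h(u) \<rightarrow> r\<^sup>\<alpha>\<close> as \<open>u\<close> decreases to \<open>0\<close>. Since the truncated second moment is monotone,
  \<open>h(r u) \<le> r\<^sup>2 h(u)\<close> for \<open>r \<ge> 1\<close>, which forces \<open>\<Sum>\<^sub>i h(\<bar>c\<^sub>n\<^sub>i\<bar>) = 1\<close> exactly once \<open>B\<^sub>n > 1\<close>. Hence the
  number of \<open>i\<close> with \<open>\<bar>c\<^sub>n\<^sub>i\<bar> \<ge> e\<close> is bounded uniformly in \<open>n\<close>, and small mixed increments then make
  \<open>sup\<^sub>i \<bar>c\<^sub>n\<^sub>i\<bar> \<rightarrow> 0\<close>: each point is the corner of a box of bounded size at all other
  corners of which \<open>\<bar>c\<^sub>n\<^sub>i\<bar> < e\<close>. The form of the characteristic function near zero therefore applies to every factor of that of \<open>S\<^sub>n / B\<^sub>n\<close>, and its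
  exponent converges. That form also bounds the truncated means of the terms by a multiple of \<open>h\<close>, which
  together with Ottaviani's inequality gives the almost sure convergence of the series defining \<open>S\<^sub>n\<close>.
  The law \<open>G\<close> exists as a limit of a tight sequence of normed sums of innovations.
\<close>

section \<open>Increments over boxes\<close>

text \<open>The exponents 0 < \<alpha> < 2 and \<alpha> = 2 run through one argument. The clipped
  moment E min(X^2, x^2) obeys an increment inequality for every scale factor, and from it the
  truncated second moment V is asymptotic to \<alpha> / 2 times the clipped one, a ratio that stays
  positive at \<alpha> = 2, where x^2 P(|X| > x) becomes negligible. As V may jump, the norming sum
  need not be continuous in x; the inequality h(r u) <= r^2 h(u), valid for all u and not just small
  ones, takes the place of continuity. Convergence of the series requires truncated means, whereas
  the absence of a drift is visible only in the characteristic function near zero; the mean of sin(u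
  X), being its imaginary part, links the two up to an error of the order of the clipped moment.
  Finally, \<open>G\<close> is given by a definite description, so a law with its characteristic
  function has to be produced before anything can be said about it.\<close>

definition box_increment_in :: "nat \<Rightarrow> 'd \<Rightarrow> (int ^ 'd \<Rightarrow> real) \<Rightarrow> int ^ 'd \<Rightarrow> real" where
  "box_increment_in h k f = (\<lambda>i. f i - f (i - axis k (int h)))"

lemma box_increment_in_apply: "box_increment_in h k f i = f i - f (i - axis k (int h))"
  by (simp add: box_increment_in_def)

text \<open>The corners of the box with side \<open>h\<close> and upper corner \<open>i\<close> are
  the points \<open>i - corner h T\<close>, one for each set \<open>T\<close> of coordinates;
  \<open>T = {}\<close> gives \<open>i\<close> itself.\<close>

definition corner :: "nat \<Rightarrow> 'd set \<Rightarrow> int ^ 'd" where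
  "corner h T = (\<chi> k. if k \<in> T then int h else 0)"

lemma corner_insert:
  "k \<notin> T \<Longrightarrow> corner h (insert k T) = axis k (int h) + corner h T"
  by (auto simp: corner_def vec_eq_iff axis_def)

text \<open>Any coordinate in \<open>T\<close> reads off the side length. Hence the corners other
  than \<open>i\<close> of boxes with different sides never coincide, which is what the count of
  large points relies on.\<close>

lemma corner_eq_iff:
  assumes "T \<noteq> {}" "h > 0" "corner h T = corner h' T'"
  shows "h = h'"
proof -
  obtain k where "k \<in> T" using assms by auto
  then have "corner h T $ k = int h" by (simp add: corner_def)
  then have "corner h' T' $ k = int h" using assms by simp
  then show ?thesis using assms by (auto simp: corner_def split: if_splits)
qed

text \<open>Carries one difference operator past all the others, so that an induction over the
  coordinates can apply it to the field itself.\<close>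

lemma foldr_comp_fun_commute:
  assumes "\<And>k l f. g k (u l f) = u l (g k f)"
  shows "g k (foldr u ks f) = foldr u ks (g k f)"
  by (induction ks) (auto simp: assms)

lemma increment_in_box_commute:
  "increment_in k (box_increment_in h l f) = box_increment_in h l (increment_in k f)"
  by (auto simp: increment_in_def box_increment_in_def fun_eq_iff algebra_simps)

lemma increment_in_commute:
  "increment_in k (increment_in l f) = increment_in l (increment_in k f)"
  by (auto simp: increment_in_def fun_eq_iff algebra_simps)

text \<open>Telescoping along one axis: increments over a box are reduced to unit increments, which
  are the ones that the growth assumption speaks of.\<close>

lemma box_increment_in_eq_sum:
  "box_increment_in h k f i = (\<Sum>j<h. increment_in k f (i - axis k (int j)))"
proof (induction h)
  case 0
  have *: "axis k 0 = (0 :: int ^ 'a)" by (simp add: vec_eq_iff axis_def)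
  show ?case unfolding box_increment_in_def of_nat_0 * by simp
next
  case (Suc h)
  have "axis k (int (Suc h)) = axis k (int h) + (axis k 1 :: int ^ 'a)"
    by (simp add: vec_eq_iff axis_def)
  then have "box_increment_in (Suc h) k f i
      = box_increment_in h k f i + increment_in k f (i - axis k (int h))"
    by (simp add: box_increment_in_def increment_in_def algebra_simps)
  with Suc show ?case by simp
qed

text \<open>A mixed increment over a box of side \<open>h\<close> in d coordinates is a sum of h^d
  unit mixed increments. The induction varies the field, because peeling off a coordinate replaces
  \<open>f\<close> by \<open>increment_in k f\<close>.\<close>

lemma abs_foldr_box_increment_le:
  assumes "\<And>i. \<bar>foldr increment_in ks f i\<bar> \<le> \<eta>"
  shows "\<bar>foldr (box_increment_in h) ks f i\<bar> \<le> real h ^ length ks * \<eta>"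
  using assms
proof (induction ks arbitrary: f i)
  case (Cons k ks)
  have inc: "\<bar>foldr (box_increment_in h) ks (increment_in k f) i\<bar> \<le> real h ^ length ks * \<eta>" for i
  proof (rule Cons.IH)
    show "\<bar>foldr increment_in ks (increment_in k f) i\<bar> \<le> \<eta>" for i
      using Cons.prems[of i] by (simp add: foldr_comp_fun_commute increment_in_commute)
  qed
  have "foldr (box_increment_in h) (k # ks) f i
      = (\<Sum>j<h. foldr (box_increment_in h) ks (increment_in k f) (i - axis k (int j)))"
    unfolding foldr.simps o_apply box_increment_in_eq_sum[of h k]
    by (simp only: foldr_comp_fun_commute[of increment_in "box_increment_in h",
          OF increment_in_box_commute])
  then have "\<bar>foldr (box_increment_in h) (k # ks) f i\<bar>
      \<le> (\<Sum>j<h. \<bar>foldr (box_increment_in h) ks (increment_in k f) (i - axis k (int j))\<bar>)"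
    by (simp only: sum_abs)
  also have "\<dots> \<le> (\<Sum>j<h. real h ^ length ks * \<eta>)"
    by (intro sum_mono inc)
  finally show ?case by (simp add: algebra_simps)
qed simp

text \<open>Expanding the differences gives an alternating sum over the 2^d corners, each term being
  at most \<open>e\<close> in size.\<close>

lemma abs_foldr_box_le_corners:
  assumes "distinct ks" "\<And>T. T \<subseteq> set ks \<Longrightarrow> \<bar>f (i - corner h T)\<bar> \<le> e"
  shows "\<bar>foldr (box_increment_in h) ks f i\<bar> \<le> 2 ^ length ks * e"
  using assms
proof (induction ks arbitrary: i)
  case Nil
  show ?case using Nil(2)[of "{}"] by (simp add: corner_def zero_vec_def[symmetric])
next
  case (Cons k ks)
  have k: "k \<notin> T" if "T \<subseteq> set ks" for T using that Cons.prems(1) by auto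
  have "\<bar>foldr (box_increment_in h) ks f i\<bar> \<le> 2 ^ length ks * e"
    using Cons.prems by (intro Cons.IH) auto
  moreover have "\<bar>foldr (box_increment_in h) ks f (i - axis k (int h))\<bar> \<le> 2 ^ length ks * e"
  proof (rule Cons.IH)
    fix T assume T: "T \<subseteq> set ks"
    have "\<bar>f (i - corner h (insert k T))\<bar> \<le> e" using T by (intro Cons.prems) auto
    then show "\<bar>f (i - axis k (int h) - corner h T)\<bar> \<le> e"
      using k[OF T] by (simp add: corner_insert algebra_simps)
  qed (use Cons.prems in auto)
  moreover have "foldr (box_increment_in h) (k # ks) f i
      = foldr (box_increment_in h) ks f i - foldr (box_increment_in h) ks f (i - axis k (int h))"
    by (simp only: foldr.simps o_apply box_increment_in_apply)
  ultimately show ?case by simp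
qed

text \<open>In the alternating sum over the corners \<open>f i\<close> has coefficient 1, so the
  difference involves only the 2^d - 1 corners with nonempty \<open>T\<close>.\<close>

lemma abs_foldr_box_diff_le_corners:
  assumes "distinct ks" "\<And>T. T \<subseteq> set ks \<Longrightarrow> T \<noteq> {} \<Longrightarrow> \<bar>f (i - corner h T)\<bar> \<le> e" "e \<ge> 0"
  shows "\<bar>foldr (box_increment_in h) ks f i - f i\<bar> \<le> 2 ^ length ks * e"
  using assms
proof (induction ks)
  case (Cons k ks)
  have k: "k \<notin> T" if "T \<subseteq> set ks" for T using that Cons.prems(1) by auto
  have "\<bar>foldr (box_increment_in h) ks f i - f i\<bar> \<le> 2 ^ length ks * e"
    using Cons.prems by (intro Cons.IH) auto
  moreover have "\<bar>foldr (box_increment_in h) ks f (i - axis k (int h))\<bar> \<le> 2 ^ length ks * e"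
  proof (rule abs_foldr_box_le_corners)
    fix T assume T: "T \<subseteq> set ks"
    have "\<bar>f (i - corner h (insert k T))\<bar> \<le> e" using T by (intro Cons.prems) auto
    then show "\<bar>f (i - axis k (int h) - corner h T)\<bar> \<le> e"
      using k[OF T] by (simp add: corner_insert algebra_simps)
  qed (use Cons.prems in auto)
  moreover have "foldr (box_increment_in h) (k # ks) f i
      = foldr (box_increment_in h) ks f i - foldr (box_increment_in h) ks f (i - axis k (int h))"
    by (simp only: foldr.simps o_apply box_increment_in_apply)
  ultimately show ?case by simp
qed simp

text \<open>
  The boxes with corner \<open>i\<close> and side lengths \<open>1, \<dots>, K + 1\<close> have pairwise disjoint sets of other
  corners, so one of them meets no point where \<open>\<bar>c\<bar> \<ge> e\<close> except possibly \<open>i\<close>.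
\<close>
lemma abs_le_of_increment:
  fixes c :: "int ^ 'd::finite \<Rightarrow> real"
  assumes fin: "finite {i. \<bar>c i\<bar> \<ge> e}" and K: "card {i. \<bar>c i\<bar> \<ge> e} \<le> K"
    and \<eta>: "\<And>i. \<bar>increment c i\<bar> \<le> \<eta>" and "e > 0"
  shows "\<bar>c i\<bar> \<le> 2 ^ CARD('d) * e + real (K + 1) ^ CARD('d) * \<eta>"
proof -
  obtain ks :: "'d list" where ks: "distinct ks" "set ks = UNIV"
    using finite_distinct_list[of "UNIV :: 'd set"] by auto
  have len: "length ks = CARD('d)" using ks distinct_card by metis
  have "\<eta> \<ge> 0" using \<eta>[of i] by linarith
  have "\<exists>h\<in>{1..K + 1}. \<forall>T. T \<noteq> {} \<longrightarrow> \<bar>c (i - corner h T)\<bar> < e"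
  proof (rule ccontr)
    assume "\<not> ?thesis"
    then have "\<forall>h\<in>{1..K + 1}. \<exists>T. T \<noteq> {} \<and> \<bar>c (i - corner h T)\<bar> \<ge> e"
      by (meson not_less)
    then obtain T where T: "\<And>h. h \<in> {1..K + 1} \<Longrightarrow> T h \<noteq> {} \<and> \<bar>c (i - corner h (T h))\<bar> \<ge> e"
      by metis
    have "inj_on (\<lambda>h. i - corner h (T h)) {1..K + 1}"
    proof (rule inj_onI)
      fix x y assume *: "x \<in> {1..K+1}" "y \<in> {1..K+1}" "i - corner x (T x) = i - corner y (T y)"
      show "x = y" using T[OF *(1)] * by (intro corner_eq_iff[of "T x" x y "T y"]) auto
    qed
    moreover have "(\<lambda>h. i - corner h (T h)) ` {1..K + 1} \<subseteq> {i. \<bar>c i\<bar> \<ge> e}" using T by auto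
    ultimately have "card {1..K + 1} \<le> card {i. \<bar>c i\<bar> \<ge> e}" using fin by (meson card_inj_on_le)
    with K show False by simp
  qed
  then obtain h where h: "h \<in> {1..K + 1}" "\<And>T. T \<noteq> {} \<Longrightarrow> \<bar>c (i - corner h T)\<bar> < e" by blast
  \<comment> \<open>For this \<open>h\<close> the box increment is close to \<open>c i\<close>;
    being also a sum of at most (K + 1)^d unit increments, it is small, and so is
    \<open>c i\<close>.\<close>
  have "\<bar>foldr (box_increment_in h) ks c i - c i\<bar> \<le> 2 ^ length ks * e"
    using h(2) \<open>e > 0\<close> ks by (intro abs_foldr_box_diff_le_corners) (auto intro: less_imp_le)
  moreover have "\<bar>foldr (box_increment_in h) ks c i\<bar> \<le> real h ^ length ks * \<eta>"
    using \<eta> by (intro abs_foldr_box_increment_le) (simp add: increment_eq_foldr[OF ks])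
  moreover have "real h ^ length ks * \<eta> \<le> real (K + 1) ^ length ks * \<eta>"
    using h(1) \<open>\<eta> \<ge> 0\<close> by (intro mult_right_mono power_mono) (auto simp del: of_nat_add)
  ultimately show ?thesis unfolding len by linarith
qed

section \<open>Regular variation of truncated moments\<close>

context prob_space
begin

text \<open>Clipping instead of cutting off makes the moment a primitive of 2 y P(|X| > y): it
  depends on the law through the tail alone and is monotone in it.\<close>

definition clipped_moment :: "('a \<Rightarrow> real) \<Rightarrow> real \<Rightarrow> real" where
  "clipped_moment X x = expectation (\<lambda>\<omega>. min ((X \<omega>)\<^sup>2) (x\<^sup>2))"

abbreviation tail :: "('a \<Rightarrow> real) \<Rightarrow> real \<Rightarrow> real" where
  "tail X x \<equiv> prob {\<omega> \<in> space M. \<bar>X \<omega>\<bar> > x}"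

lemma integrable_clipped [simp]:
  "random_variable borel X \<Longrightarrow> integrable M (\<lambda>\<omega>. min ((X \<omega>)\<^sup>2) ((x::real)\<^sup>2))"
  by (rule integrable_const_bound[where B="x\<^sup>2"]) auto

lemma clipped_moment_nonneg: "clipped_moment X x \<ge> 0"
  unfolding clipped_moment_def by (rule Bochner_Integration.integral_nonneg) auto

lemma clipped_moment_mono:
  assumes [measurable]: "random_variable borel X" and "0 \<le> x" "x \<le> y"
  shows "clipped_moment X x \<le> clipped_moment X y"
proof -
  have "x\<^sup>2 \<le> y\<^sup>2" using assms by (intro power_mono) auto
  then show ?thesis
    unfolding clipped_moment_def by (intro integral_mono) (auto intro: min.coboundedI2)
qed

lemma clipped_moment_divide:
  assumes "c > 0"
  shows "clipped_moment (\<lambda>\<omega>. X \<omega> / c) x = clipped_moment X (c * x) / c\<^sup>2"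
proof -
  have "min ((X \<omega> / c)\<^sup>2) (x\<^sup>2) = min ((X \<omega>)\<^sup>2) ((c * x)\<^sup>2) / c\<^sup>2" for \<omega>
    using assms by (simp add: power_divide power_mult_distrib min_divide_distrib_right)
  then show ?thesis by (simp add: clipped_moment_def)
qed

lemma nn_integral_clipped:
  fixes x w :: real
  assumes "x \<ge> 0"
  shows "(\<integral>\<^sup>+y. ennreal (2 * y) * indicator {0..x} y * indicator {..<\<bar>w\<bar>} y \<partial>lborel)
      = ennreal (min (w\<^sup>2) (x\<^sup>2))"
proof -
  \<comment> \<open>The half-open and the closed interval differ at most in the endpoint |w|, a null
    set.\<close>
  have "AE y in lborel. y \<noteq> \<bar>w\<bar>" by (rule AE_lborel_singleton)
  then have "(\<integral>\<^sup>+y. ennreal (2 * y) * indicator {0..x} y * indicator {..<\<bar>w\<bar>} y \<partial>lborel)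
      = (\<integral>\<^sup>+y. ennreal (2 * y) * indicator {0..min x \<bar>w\<bar>} y \<partial>lborel)"
    by (intro nn_integral_cong_AE) (auto simp: indicator_def)
  also have "\<dots> = ennreal ((min x \<bar>w\<bar>)\<^sup>2 - 0\<^sup>2)"
    using assms by (intro nn_integral_FTC_Icc) (auto intro!: derivative_eq_intros)
  also have "(min x \<bar>w\<bar>)\<^sup>2 - 0\<^sup>2 = min (w\<^sup>2) (x\<^sup>2)"
    using assms abs_le_square_iff[of x w] by (auto simp: min_def)
  finally show ?thesis .
qed

lemma clipped_moment_eq_nn_integral_tail:
  assumes [measurable]: "random_variable borel X" and "x \<ge> 0"
  shows "ennreal (clipped_moment X x)
      = (\<integral>\<^sup>+y. ennreal (2 * y * tail X y) * indicator {0..x} y \<partial>lborel)"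
proof -
  interpret pair_sigma_finite M lborel ..
  have "ennreal (clipped_moment X x) = (\<integral>\<^sup>+\<omega>. ennreal (min ((X \<omega>)\<^sup>2) (x\<^sup>2)) \<partial>M)"
    unfolding clipped_moment_def by (subst nn_integral_eq_integral) auto
  also have "\<dots> = (\<integral>\<^sup>+\<omega>. \<integral>\<^sup>+y. ennreal (2 * y) * indicator {0..x} y
      * indicator {..<\<bar>X \<omega>\<bar>} y \<partial>lborel \<partial>M)"
    using assms by (simp add: nn_integral_clipped)
  also have "\<dots> = (\<integral>\<^sup>+y. \<integral>\<^sup>+\<omega>. ennreal (2 * y) * indicator {0..x} y
      * indicator {..<\<bar>X \<omega>\<bar>} y \<partial>M \<partial>lborel)"
    unfolding lessThan_def by (intro Fubini'[symmetric]) measurable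
  also have "\<dots> = (\<integral>\<^sup>+y. ennreal (2 * y * tail X y) * indicator {0..x} y \<partial>lborel)"
  proof (intro nn_integral_cong)
    fix y :: real
    have "(\<integral>\<^sup>+\<omega>. ennreal (2 * y) * indicator {0..x} y * indicator {..<\<bar>X \<omega>\<bar>} y \<partial>M)
        = (\<integral>\<^sup>+\<omega>. ennreal (2 * y) * indicator {0..x} y
            * indicator {\<omega> \<in> space M. \<bar>X \<omega>\<bar> > y} \<omega> \<partial>M)"
      by (intro nn_integral_cong) (auto simp: indicator_def)
    also have "\<dots> = ennreal (2 * y) * indicator {0..x} y * ennreal (tail X y)"
      by (subst nn_integral_cmult_indicator) (auto simp: emeasure_eq_measure)
    also have "\<dots> = ennreal (2 * y * tail X y) * indicator {0..x} y"
      by (auto simp: indicator_def ennreal_mult)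
    finally show "(\<integral>\<^sup>+\<omega>. ennreal (2 * y) * indicator {0..x} y * indicator {..<\<bar>X \<omega>\<bar>} y \<partial>M)
        = ennreal (2 * y * tail X y) * indicator {0..x} y" .
  qed
  finally show ?thesis .
qed

text \<open>Below \<open>y\<^sub>0\<close> the tail is at most 1 and contributes at most the
  integral of 2 y; above it the comparison of the tails is integrated. Asymptotic knowledge of the
  tail thus suffices, at the price of an additive constant.\<close>

lemma clipped_moment_le_of_tail:
  assumes X [measurable]: "random_variable borel X" and Y [measurable]: "random_variable borel Y"
    and le: "\<And>y. y \<ge> y\<^sub>0 \<Longrightarrow> tail Y y \<le> k * tail X y" and "k \<ge> 0" "y\<^sub>0 \<ge> 0" "x \<ge> 0"
  shows "clipped_moment Y x \<le> y\<^sub>0\<^sup>2 + k * clipped_moment X x"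
proof -
  have [measurable]: "(\<lambda>y. tail X y) \<in> borel_measurable borel"
  proof -
    have "antimono (\<lambda>y. tail X y)"
      by (intro antimonoI finite_measure_mono) auto
    then have "mono (\<lambda>y. - tail X y)" by (auto simp: mono_def antimono_def)
    then have "(\<lambda>y. - (- tail X y)) \<in> borel_measurable borel"
      by (intro borel_measurable_uminus borel_measurable_mono)
    then show ?thesis by simp
  qed
  have "ennreal (clipped_moment Y x)
      = (\<integral>\<^sup>+y. ennreal (2 * y * tail Y y) * indicator {0..x} y \<partial>lborel)"
    using assms by (intro clipped_moment_eq_nn_integral_tail)
  also have "\<dots> \<le> (\<integral>\<^sup>+y. ennreal (2 * y) * indicator {0..y\<^sub>0} y
      + ennreal k * (ennreal (2 * y * tail X y) * indicator {0..x} y) \<partial>lborel)"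
  proof (intro nn_integral_mono)
    fix y :: real
    consider "y \<in> {0..x}" "y < y\<^sub>0" | "y \<in> {0..x}" "y \<ge> y\<^sub>0" | "y \<notin> {0..x}" by linarith
    then show "ennreal (2 * y * tail Y y) * indicator {0..x} y
        \<le> ennreal (2 * y) * indicator {0..y\<^sub>0} y
          + ennreal k * (ennreal (2 * y * tail X y) * indicator {0..x} y)"
    proof cases
      case 1
      then have "ennreal (2 * y * tail Y y) \<le> ennreal (2 * y)"
        by (intro ennreal_leI) (simp add: mult_left_le)
      then show ?thesis using 1 by (auto intro: add_increasing2)
    next
      case 2
      then have "2 * y * tail Y y \<le> k * (2 * y * tail X y)"
        using mult_left_mono[OF le[of y], of "2 * y"] by (simp add: mult_ac)
      then have "ennreal (2 * y * tail Y y) \<le> ennreal k * ennreal (2 * y * tail X y)"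
        using \<open>k \<ge> 0\<close> 2 by (subst ennreal_mult[symmetric]) (auto intro: ennreal_leI)
      then show ?thesis using 2 by (auto intro: add_increasing)
    qed auto
  qed
  also have "\<dots> = (\<integral>\<^sup>+y. ennreal (2 * y) * indicator {0..y\<^sub>0} y \<partial>lborel)
      + ennreal k * (\<integral>\<^sup>+y. ennreal (2 * y * tail X y) * indicator {0..x} y \<partial>lborel)"
    by (subst nn_integral_add, measurable, subst nn_integral_cmult, measurable)
  also have "(\<integral>\<^sup>+y. ennreal (2 * y) * indicator {0..y\<^sub>0} y \<partial>lborel) = ennreal (y\<^sub>0\<^sup>2 - 0\<^sup>2)"
    using assms by (intro nn_integral_FTC_Icc) (auto intro!: derivative_eq_intros)
  also have "(\<integral>\<^sup>+y. ennreal (2 * y * tail X y) * indicator {0..x} y \<partial>lborel)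
      = ennreal (clipped_moment X x)"
    using assms by (intro clipped_moment_eq_nn_integral_tail[symmetric])
  also have "ennreal (y\<^sub>0\<^sup>2 - 0\<^sup>2) + ennreal k * ennreal (clipped_moment X x)
      = ennreal (y\<^sub>0\<^sup>2 + k * clipped_moment X x)"
    using assms clipped_moment_nonneg by (simp add: ennreal_mult ennreal_plus)
  finally show ?thesis
    using assms clipped_moment_nonneg by (subst (asm) ennreal_le_iff) auto
qed

text \<open>Monotone convergence along the integers gives an infinite supremum, and monotonicity in
  x fills the gaps.\<close>

lemma clipped_moment_at_top:
  assumes [measurable]: "random_variable borel X"
    and "(\<integral>\<^sup>+\<omega>. ennreal ((X \<omega>)\<^sup>2) \<partial>M) = \<infinity>"
  shows "filterlim (clipped_moment X) at_top at_top"
proof -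
  have "(\<integral>\<^sup>+\<omega>. (SUP n::nat. ennreal (min ((X \<omega>)\<^sup>2) ((real n)\<^sup>2))) \<partial>M)
      = (SUP n::nat. \<integral>\<^sup>+\<omega>. ennreal (min ((X \<omega>)\<^sup>2) ((real n)\<^sup>2)) \<partial>M)"
    by (intro nn_integral_monotone_convergence_SUP)
       (auto simp: incseq_def le_fun_def intro!: ennreal_leI min.coboundedI2 power_mono)
  also have "(\<lambda>\<omega>. SUP n::nat. ennreal (min ((X \<omega>)\<^sup>2) ((real n)\<^sup>2))) = (\<lambda>\<omega>. ennreal ((X \<omega>)\<^sup>2))"
  proof
    fix \<omega>
    obtain n :: nat where n: "\<bar>X \<omega>\<bar> \<le> real n" using real_arch_simple by blast
    then have "(X \<omega>)\<^sup>2 \<le> (real n)\<^sup>2" by (simp add: abs_le_square_iff[symmetric])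
    then have "ennreal ((X \<omega>)\<^sup>2) \<le> ennreal (min ((X \<omega>)\<^sup>2) ((real n)\<^sup>2))" by simp
    also have "\<dots> \<le> (SUP n::nat. ennreal (min ((X \<omega>)\<^sup>2) ((real n)\<^sup>2)))" by (rule SUP_upper) auto
    finally show "(SUP n::nat. ennreal (min ((X \<omega>)\<^sup>2) ((real n)\<^sup>2))) = ennreal ((X \<omega>)\<^sup>2)"
      by (intro antisym SUP_least ennreal_leI) auto
  qed
  also have "(\<lambda>n::nat. \<integral>\<^sup>+\<omega>. ennreal (min ((X \<omega>)\<^sup>2) ((real n)\<^sup>2)) \<partial>M)
      = (\<lambda>n. ennreal (clipped_moment X (real n)))"
    unfolding clipped_moment_def by (rule ext, subst nn_integral_eq_integral) auto
  finally have sup: "(SUP n::nat. ennreal (clipped_moment X (real n))) = \<infinity>" using assms by simp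
  show ?thesis
  proof (rule filterlim_at_top[THEN iffD2], intro allI)
    fix Z :: real
    have "ennreal (max 0 Z) < (SUP n::nat. ennreal (clipped_moment X (real n)))"
      unfolding sup by (simp add: ennreal_less_top)
    then obtain n :: nat where "ennreal (max 0 Z) < ennreal (clipped_moment X (real n))"
      unfolding less_SUP_iff by blast
    then have n: "Z \<le> clipped_moment X (real n)"
      by (subst (asm) ennreal_less_iff) auto
    show "eventually (\<lambda>x. Z \<le> clipped_moment X x) at_top"
      using eventually_ge_at_top[of "real n"]
    proof eventually_elim
      case (elim x)
      then show ?case using clipped_moment_mono[of X "real n" x] n by simp
    qed
  qed
qed

end

section \<open>Karamata's argument for the clipped and the truncated second moment\<close>

lemma powr_quotient_at_1: "((\<lambda>r::real. (r powr a - 1) / (r\<^sup>2 - 1)) \<longlongrightarrow> a / 2) (at 1)"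
proof -
  have "((\<lambda>r::real. r powr a) has_real_derivative a * 1 powr (a - 1)) (at 1)"
    by (rule has_real_derivative_powr) simp
  then have "((\<lambda>r. (r powr a - 1 powr a) / (r - 1)) \<longlongrightarrow> a) (at (1::real))"
    by (simp add: has_field_derivative_iff)
  then have "((\<lambda>r. (r powr a - 1) / (r - 1) / (r + 1)) \<longlongrightarrow> a / (1 + 1)) (at (1::real))"
    by (intro tendsto_intros) auto
  moreover have "(r powr a - 1) / (r - 1) / (r + 1) = (r powr a - 1) / (r\<^sup>2 - 1)" for r :: real
    unfolding divide_divide_eq_left by (simp add: power2_eq_square algebra_simps)
  ultimately show ?thesis by (simp only: one_add_one)
qed

text \<open>The domain of attraction enters as a ratio limit of the two-sided tail; taking ratios
  eliminates the auxiliary slowly varying function.\<close>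

locale heavy_tail = prob_space +
  fixes X :: "'a \<Rightarrow> real" and \<alpha> :: real
  assumes rv [measurable]: "random_variable borel X"
    and \<alpha>: "0 < \<alpha>" "\<alpha> \<le> 2"
    and infinite_variance: "(\<integral>\<^sup>+\<omega>. ennreal ((X \<omega>)\<^sup>2) \<partial>M) = \<infinity>"
    and tail_rv: "\<And>r. r > 0 \<Longrightarrow> ((\<lambda>x. tail X (r * x) / tail X x) \<longlongrightarrow> r powr (- \<alpha>)) at_top"
begin

abbreviation "U \<equiv> clipped_moment X"
abbreviation "V \<equiv> truncated_second_moment M X"

lemma U_at_top: "filterlim U at_top at_top"
  by (rule clipped_moment_at_top[OF rv infinite_variance])

lemma U_pos: "eventually (\<lambda>x. U x > 0) at_top"
  using U_at_top by (simp add: filterlim_at_top_dense)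

lemma tail_pos: "tail X x > 0"
proof (rule ccontr)
  assume "\<not> ?thesis"
  then have "tail X x = 0" using measure_nonneg[of M] by (metis less_eq_real_def)
  then have zero: "tail X y = 0" if "y \<ge> x" for y
    using finite_measure_mono[of "{\<omega> \<in> space M. \<bar>X \<omega>\<bar> > y}" "{\<omega> \<in> space M. \<bar>X \<omega>\<bar> > x}"]
      measure_nonneg[of M "{\<omega> \<in> space M. \<bar>X \<omega>\<bar> > y}"] that
    by (auto simp: subset_eq)
  \<comment> \<open>With both tails 0 the quotient is 0 / 0 = 0, whereas at r = 1 its limit has to
    be 1.\<close>
  have "eventually (\<lambda>y. tail X (1 * y) / tail X y = 0) at_top"
    using eventually_ge_at_top[of x] by eventually_elim (simp add: zero)
  then have "((\<lambda>y. tail X (1 * y) / tail X y) \<longlongrightarrow> 0) at_top"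
    by (rule tendsto_eventually)
  from tendsto_unique[OF _ this tail_rv[of 1]] show False by simp
qed

text \<open>The tail of X / r at y is P(|X| > r y), eventually at most k P(|X| > y) with k slightly
  above r^(-\<alpha>). Rescaling the resulting comparison of clipped moments by r^2 gives
  r^(2-\<alpha>), and the additive constant is swallowed because \<open>U\<close> tends to
  infinity.\<close>

lemma U_ratio_le:
  assumes r: "r > 0" and "\<epsilon> > 0"
  shows "eventually (\<lambda>x. U (r * x) / U x \<le> r powr (2 - \<alpha>) + \<epsilon>) at_top"
proof -
  \<comment> \<open>Chosen with r^2 e = \<open>\<epsilon> / 2\<close>; the other half of
    \<open>\<epsilon>\<close> pays for the additive constant.\<close>
  define e where "e = \<epsilon> / 2 / r\<^sup>2"
  have "e > 0" using assms by (simp add: e_def)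
  define k where "k = r powr (- \<alpha>) + e"
  have "k > 0" using \<open>e > 0\<close> by (simp add: k_def add_nonneg_pos)
  have "eventually (\<lambda>y. tail X (r * y) / tail X y < k) at_top"
    using \<open>e > 0\<close> by (intro order_tendstoD(2)[OF tail_rv[OF r]]) (simp add: k_def)
  then obtain y\<^sub>1 where y1: "\<And>y. y \<ge> y\<^sub>1 \<Longrightarrow> tail X (r * y) / tail X y < k"
    by (auto simp: eventually_at_top_linorder)
  define y\<^sub>0 where "y\<^sub>0 = max 0 y\<^sub>1"
  have le: "tail (\<lambda>\<omega>. X \<omega> / r) y \<le> k * tail X y" if "y \<ge> y\<^sub>0" for y
  proof -
    have "{\<omega> \<in> space M. \<bar>X \<omega> / r\<bar> > y} = {\<omega> \<in> space M. \<bar>X \<omega>\<bar> > r * y}"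
      using r by (auto simp: field_simps)
    then show ?thesis using y1[of y] that tail_pos[of y] by (simp add: y\<^sub>0_def field_simps)
  qed
  have "eventually (\<lambda>x. r\<^sup>2 * y\<^sub>0\<^sup>2 * 2 / \<epsilon> < U x) at_top"
    using U_at_top by (simp add: filterlim_at_top_dense)
  then show ?thesis
    using U_pos eventually_ge_at_top[of 0]
  proof eventually_elim
    case (elim x)
    have "U (r * x) / r\<^sup>2 \<le> y\<^sub>0\<^sup>2 + k * U x"
      unfolding clipped_moment_divide[OF r, symmetric]
      using le \<open>k > 0\<close> elim by (intro clipped_moment_le_of_tail) (auto simp: y\<^sub>0_def)
    then have "U (r * x) \<le> r\<^sup>2 * y\<^sub>0\<^sup>2 + r\<^sup>2 * k * U x" using r by (simp add: field_simps)
    also have "r\<^sup>2 * k = r powr (2 - \<alpha>) + \<epsilon> / 2"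
      using r by (simp add: k_def e_def algebra_simps powr_diff powr_minus field_simps)
    also have "r\<^sup>2 * y\<^sub>0\<^sup>2 \<le> \<epsilon> / 2 * U x" using elim \<open>\<epsilon> > 0\<close> by (simp add: field_simps)
    finally show ?case using elim by (simp add: field_simps)
  qed
qed

lemma U_ratio:
  assumes r: "r > 0"
  shows "((\<lambda>x. U (r * x) / U x) \<longlongrightarrow> r powr (2 - \<alpha>)) at_top"
proof (rule order_tendstoI)
  fix a assume "r powr (2 - \<alpha>) < a"
  then have "eventually (\<lambda>x. U (r * x) / U x \<le> r powr (2 - \<alpha>) + (a - r powr (2 - \<alpha>)) / 2) at_top"
    by (intro U_ratio_le r) auto
  then show "eventually (\<lambda>x. U (r * x) / U x < a) at_top"
    by eventually_elim (use \<open>r powr (2 - \<alpha>) < a\<close> in \<open>simp add: field_simps\<close>)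
next
  fix a assume a: "a < r powr (2 - \<alpha>)"
  \<comment> \<open>A positive bound in place of \<open>a\<close> allows reciprocals: the lower
    estimate for \<open>r\<close> is the upper estimate for \<open>1 / r\<close>, taken at
    \<open>r * x\<close>.\<close>
  define a' where "a' = max a (r powr (2 - \<alpha>) / 2)"
  have a': "0 < a'" "a' < r powr (2 - \<alpha>)" "a \<le> a'" using a r by (auto simp: a'_def less_max_iff_disj)
  have top: "filterlim (\<lambda>x. r * x) at_top at_top"
    using r by (intro filterlim_tendsto_pos_mult_at_top[OF tendsto_const]) (auto simp: filterlim_ident)
  have inv: "(1 / r) powr (2 - \<alpha>) = 1 / r powr (2 - \<alpha>)" using r by (simp add: powr_divide)
  have "1 / r powr (2 - \<alpha>) < 1 / a'" using a' r by (intro divide_strict_left_mono mult_pos_pos) auto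
  then have "eventually (\<lambda>x. U (1 / r * x) / U x
      \<le> (1 / r) powr (2 - \<alpha>) + (1 / a' - (1 / r) powr (2 - \<alpha>)) / 2) at_top"
    using r inv by (intro U_ratio_le) auto
  then have "eventually (\<lambda>x. U (1 / r * x) / U x < 1 / a') at_top"
    by eventually_elim (use \<open>1 / r powr (2 - \<alpha>) < 1 / a'\<close> inv in \<open>simp add: field_simps\<close>)
  then have "eventually (\<lambda>x. U (1 / r * (r * x)) / U (r * x) < 1 / a') at_top"
    using top by (rule eventually_compose_filterlim)
  then show "eventually (\<lambda>x. a < U (r * x) / U x) at_top"
    using U_pos eventually_compose_filterlim[OF U_pos top]
  proof eventually_elim
    case (elim x)
    then have "U x / U (r * x) < 1 / a'" using r by simp
    then have "a' < U (r * x) / U x" using elim a' by (simp add: field_simps)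
    then show ?case using a' by linarith
  qed
qed

lemma V_eq: "V x = U x - x\<^sup>2 * tail X x" if "x \<ge> 0"
proof -
  have "V x = expectation (\<lambda>\<omega>. min ((X \<omega>)\<^sup>2) (x\<^sup>2) - x\<^sup>2 * indicator {\<omega> \<in> space M. \<bar>X \<omega>\<bar> > x} \<omega>)"
    unfolding truncated_second_moment_def
  proof (intro Bochner_Integration.integral_cong refl)
    fix \<omega> assume "\<omega> \<in> space M"
    then show "(X \<omega>)\<^sup>2 * indicator {\<omega>. \<bar>X \<omega>\<bar> \<le> x} \<omega>
        = min ((X \<omega>)\<^sup>2) (x\<^sup>2) - x\<^sup>2 * indicator {\<omega> \<in> space M. \<bar>X \<omega>\<bar> > x} \<omega>"
      using that abs_le_square_iff[of "X \<omega>" x] by (auto simp: indicator_def min_def)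
  qed
  also have "\<dots> = U x - expectation (\<lambda>\<omega>. x\<^sup>2 * indicator {\<omega> \<in> space M. \<bar>X \<omega>\<bar> > x} \<omega>)"
    unfolding clipped_moment_def
    by (intro Bochner_Integration.integral_diff integrable_clipped rv integrable_mult_right
        integrable_real_indicator) (auto simp: emeasure_eq_measure)
  finally show ?thesis by simp
qed

text \<open>Where |X| <= x the clipped square does not grow, and where |X| > x it changes by at most
  (r^2 - 1) x^2. The case \<open>r < 1\<close>, in which this factor is negative, matters as much as
  \<open>r > 1\<close>.\<close>

lemma U_increment:
  assumes "r > 0" "x > 0"
  shows "U (r * x) - U x \<le> (r\<^sup>2 - 1) * (x\<^sup>2 * tail X x)"
proof -
  have "U (r * x) \<le> expectation (\<lambda>\<omega>. min ((X \<omega>)\<^sup>2) (x\<^sup>2)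
      + (r\<^sup>2 - 1) * x\<^sup>2 * indicator {\<omega> \<in> space M. \<bar>X \<omega>\<bar> > x} \<omega>)"
    unfolding clipped_moment_def
  proof (intro integral_mono)
    fix \<omega> assume \<omega>: "\<omega> \<in> space M"
    show "min ((X \<omega>)\<^sup>2) ((r * x)\<^sup>2) \<le> min ((X \<omega>)\<^sup>2) (x\<^sup>2)
        + (r\<^sup>2 - 1) * x\<^sup>2 * indicator {\<omega> \<in> space M. \<bar>X \<omega>\<bar> > x} \<omega>"
    proof (cases "\<bar>X \<omega>\<bar> > x")
      case True
      then have "min ((X \<omega>)\<^sup>2) (x\<^sup>2) = x\<^sup>2"
        using assms abs_le_square_iff[of x "X \<omega>"] by auto
      with True \<omega> show ?thesis by (simp add: algebra_simps power_mult_distrib)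
    next
      case False
      then have "min ((X \<omega>)\<^sup>2) (x\<^sup>2) = (X \<omega>)\<^sup>2"
        using assms abs_le_square_iff[of "X \<omega>" x] by auto
      with False \<omega> show ?thesis by simp
    qed
  qed (auto intro!: Bochner_Integration.integrable_add integrable_mult_right
      integrable_real_indicator simp: emeasure_eq_measure)
  also have "\<dots> = U x + expectation (\<lambda>\<omega>. (r\<^sup>2 - 1) * x\<^sup>2
      * indicator {\<omega> \<in> space M. \<bar>X \<omega>\<bar> > x} \<omega>)"
    unfolding clipped_moment_def
    by (intro Bochner_Integration.integral_add integrable_clipped rv integrable_mult_right
        integrable_real_indicator) (auto simp: emeasure_eq_measure)
  finally show ?thesis by simp
qed

text \<open>Dividing the increment inequality by r^2 - 1 bounds the ratio from below if r > 1 and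
  from above if r < 1. As x grows the bound tends to (r^(2-\<alpha>) - 1) / (r^2 - 1), and as r
  tends to 1 from either side this tends to (2-\<alpha>) / 2, by the derivative of r^(2-\<alpha>) at
  1.\<close>

lemma tail_ratio: "((\<lambda>x. x\<^sup>2 * tail X x / U x) \<longlongrightarrow> (2 - \<alpha>) / 2) at_top"
proof -
  let ?q = "\<lambda>r::real. (r powr (2 - \<alpha>) - 1) / (r\<^sup>2 - 1)"
  have lim: "((\<lambda>x. (U (r * x) / U x - 1) / (r\<^sup>2 - 1)) \<longlongrightarrow> ?q r) at_top"
    if "r > 0" "r \<noteq> 1" for r
    using that by (intro tendsto_intros U_ratio) (auto simp: power2_eq_1_iff)
  have inc: "U (r * x) / U x - 1 \<le> (r\<^sup>2 - 1) * (x\<^sup>2 * tail X x / U x)"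
    if "r > 0" "x > 0" "U x > 0" for r x
  proof -
    have "(U (r * x) - U x) / U x \<le> (r\<^sup>2 - 1) * (x\<^sup>2 * tail X x) / U x"
      using that by (intro divide_right_mono U_increment) auto
    then show ?thesis using that(3) by (simp add: diff_divide_distrib)
  qed
  show ?thesis
  proof (rule order_tendstoI)
    fix a assume "a < (2 - \<alpha>) / 2"
    then have "eventually (\<lambda>r. a < ?q r) (at 1)"
      using powr_quotient_at_1 order_tendstoD(1) by blast
    then have "eventually (\<lambda>r. a < ?q r) (at_right 1)"
      by (simp add: eventually_at_split)
    then have "eventually (\<lambda>r. a < ?q r \<and> r > 1) (at_right 1)"
      by (intro eventually_conj) (auto simp: eventually_at_right_less)
    then obtain r where r: "a < ?q r" "r > 1"
      using eventually_happens[of _ "at_right (1::real)"] by auto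
    have "r\<^sup>2 - 1 > 0" using r by (simp add: power2_eq_square less_1_mult)
    have "eventually (\<lambda>x. a < (U (r * x) / U x - 1) / (r\<^sup>2 - 1)) at_top"
      using r by (intro order_tendstoD(1)[OF lim]) auto
    then show "eventually (\<lambda>x. a < x\<^sup>2 * tail X x / U x) at_top"
      using U_pos eventually_gt_at_top[of 0]
    proof eventually_elim
      case (elim x)
      have "(U (r * x) / U x - 1) / (r\<^sup>2 - 1) \<le> x\<^sup>2 * tail X x / U x"
        using inc[of r x] elim r \<open>r\<^sup>2 - 1 > 0\<close>
        by (subst pos_divide_le_eq) (auto simp: mult.commute)
      then show ?case using elim by linarith
    qed
  next
    fix a assume "(2 - \<alpha>) / 2 < a"
    then have "eventually (\<lambda>r. ?q r < a) (at 1)"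
      using powr_quotient_at_1 order_tendstoD(2) by blast
    then have "eventually (\<lambda>r. ?q r < a) (at_left 1)"
      by (simp add: eventually_at_split)
    then have "eventually (\<lambda>r. ?q r < a \<and> r \<in> {0<..<1}) (at_left 1)"
      by (intro eventually_conj eventually_at_left_real) auto
    then obtain r where r: "?q r < a" "0 < r" "r < 1"
      using eventually_happens[of _ "at_left (1::real)"] by auto
    have "r\<^sup>2 - 1 < 0" using r by (simp add: power_less_one_iff)
    have "eventually (\<lambda>x. (U (r * x) / U x - 1) / (r\<^sup>2 - 1) < a) at_top"
      using r by (intro order_tendstoD(2)[OF lim]) auto
    then show "eventually (\<lambda>x. x\<^sup>2 * tail X x / U x < a) at_top"
      using U_pos eventually_gt_at_top[of 0]
    proof eventually_elim
      case (elim x)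
      have "x\<^sup>2 * tail X x / U x \<le> (U (r * x) / U x - 1) / (r\<^sup>2 - 1)"
        using inc[of r x] elim r \<open>r\<^sup>2 - 1 < 0\<close>
        by (subst neg_le_divide_eq) (auto simp: mult.commute)
      then show ?case using elim by linarith
    qed
  qed
qed

text \<open>The limit is positive throughout 0 < \<alpha> <= 2, so \<open>V\<close> inherits
  divergence and regular variation from \<open>U\<close>, also at \<alpha> = 2 where the tail term
  disappears.\<close>

lemma V_ratio_U: "((\<lambda>x. V x / U x) \<longlongrightarrow> \<alpha> / 2) at_top"
proof -
  have "((\<lambda>x. 1 - x\<^sup>2 * tail X x / U x) \<longlongrightarrow> 1 - (2 - \<alpha>) / 2) at_top"
    by (intro tendsto_intros tail_ratio)
  moreover have "eventually (\<lambda>x. 1 - x\<^sup>2 * tail X x / U x = V x / U x) at_top"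
    using U_pos eventually_ge_at_top[of 0]
    by eventually_elim (simp add: V_eq diff_divide_distrib)
  ultimately have "((\<lambda>x. V x / U x) \<longlongrightarrow> 1 - (2 - \<alpha>) / 2) at_top"
    by (rule Lim_transform_eventually)
  then show ?thesis by (simp add: diff_divide_distrib)
qed

lemma V_ratio:
  assumes r: "r > 0"
  shows "((\<lambda>x. V (r * x) / V x) \<longlongrightarrow> r powr (2 - \<alpha>)) at_top"
proof -
  have top: "filterlim (\<lambda>x. r * x) at_top at_top"
    using r by (intro filterlim_tendsto_pos_mult_at_top[OF tendsto_const]) (auto simp: filterlim_ident)
  have "((\<lambda>x. V (r * x) / U (r * x) * (U (r * x) / U x) / (V x / U x))
      \<longlongrightarrow> \<alpha> / 2 * r powr (2 - \<alpha>) / (\<alpha> / 2)) at_top"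
    using \<alpha> by (intro tendsto_intros U_ratio[OF r] V_ratio_U filterlim_compose[OF V_ratio_U top]) auto
  moreover have "eventually (\<lambda>x. V (r * x) / U (r * x) * (U (r * x) / U x) / (V x / U x)
      = V (r * x) / V x) at_top"
    using U_pos eventually_compose_filterlim[OF U_pos top]
    by eventually_elim (simp add: field_simps)
  ultimately have "((\<lambda>x. V (r * x) / V x) \<longlongrightarrow> \<alpha> / 2 * r powr (2 - \<alpha>) / (\<alpha> / 2)) at_top"
    by (rule Lim_transform_eventually)
  then show ?thesis using \<alpha> by simp
qed

end

section \<open>The function \<open>u\<^sup>\<alpha> L(1/u)\<close>\<close>

context heavy_tail
begin

abbreviation "L \<equiv> L_fun M X \<alpha>"
abbreviation "b\<^sub>L \<equiv> L_cutoff M X"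

text \<open>For \<alpha> < 2 this constant makes L(x) asymptotic to x^\<alpha> P(|X| > x), because
  by Karamata the tail is about (2-\<alpha>) / \<alpha> times V(x) / x^2. At \<alpha> = 2 that
  factor would vanish, and 1 replaces it.\<close>

definition \<kappa>\<^sub>L :: real where "\<kappa>\<^sub>L = (if \<alpha> < 2 then (2 - \<alpha>) / \<alpha> else 1)"

text \<open>The function h of the overview. It vanishes at 0, in agreement with the convention for
  zero coefficients.\<close>

definition weight :: "real \<Rightarrow> real" where "weight u = u powr \<alpha> * L (1 / u)"

lemma \<kappa>\<^sub>L_pos: "\<kappa>\<^sub>L > 0"
  using \<alpha> by (simp add: \<kappa>\<^sub>L_def)

lemma integrable_truncated: "integrable M (\<lambda>\<omega>. (X \<omega>)\<^sup>2 * indicator {\<omega>. \<bar>X \<omega>\<bar> \<le> x} \<omega>)"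
proof (rule integrable_const_bound[where B="x\<^sup>2"])
  show "AE \<omega> in M. norm ((X \<omega>)\<^sup>2 * indicator {\<omega>. \<bar>X \<omega>\<bar> \<le> x} \<omega>) \<le> x\<^sup>2"
  proof (intro AE_I2)
    fix \<omega>
    show "norm ((X \<omega>)\<^sup>2 * indicator {\<omega>. \<bar>X \<omega>\<bar> \<le> x} \<omega>) \<le> x\<^sup>2"
      using abs_le_square_iff[of "X \<omega>" x] by (auto simp: indicator_def)
  qed
  have "(\<lambda>\<omega>. (X \<omega>)\<^sup>2 * indicator {..x} \<bar>X \<omega>\<bar>) \<in> borel_measurable M" by measurable
  also have "(\<lambda>\<omega>. (X \<omega>)\<^sup>2 * indicator {..x} \<bar>X \<omega>\<bar>)
      = (\<lambda>\<omega>. (X \<omega>)\<^sup>2 * indicator {\<omega>. \<bar>X \<omega>\<bar> \<le> x} \<omega>)"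
    by (auto simp: indicator_def)
  finally show "(\<lambda>\<omega>. (X \<omega>)\<^sup>2 * indicator {\<omega>. \<bar>X \<omega>\<bar> \<le> x} \<omega>) \<in> borel_measurable M" .
qed

lemma V_nonneg: "V x \<ge> 0"
  unfolding truncated_second_moment_def by (rule Bochner_Integration.integral_nonneg) auto

lemma V_mono: "x \<le> y \<Longrightarrow> V x \<le> V y"
  unfolding truncated_second_moment_def
  by (intro integral_mono integrable_truncated mult_left_mono) (auto simp: indicator_def)

lemma V_at_top: "filterlim V at_top at_top"
proof -
  have "filterlim (\<lambda>x. V x / U x * U x) at_top at_top"
    using \<alpha> by (intro filterlim_tendsto_pos_mult_at_top[OF V_ratio_U] U_at_top) auto
  moreover have "eventually (\<lambda>x. V x / U x * U x = V x) at_top"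
    using U_pos by eventually_elim simp
  ultimately show ?thesis by (simp add: filterlim_cong)
qed

text \<open>Carries the bound V > 1 from the set defining the cutoff to its infimum, where it
  becomes V >= 1.\<close>

lemma V_right_continuous: "(\<lambda>n. V (x + 1 / real (Suc n))) \<longlonglongrightarrow> V x"
  unfolding truncated_second_moment_def
proof (rule integral_dominated_convergence)
  have x1: "(\<lambda>n. x + 1 / real (Suc n)) \<longlonglongrightarrow> x + 0"
    by (intro tendsto_intros LIMSEQ_Suc lim_1_over_n)
  show "AE \<omega> in M. (\<lambda>n. (X \<omega>)\<^sup>2 * indicator {\<omega>. \<bar>X \<omega>\<bar> \<le> x + 1 / real (Suc n)} \<omega>)
      \<longlonglongrightarrow> (X \<omega>)\<^sup>2 * indicator {\<omega>. \<bar>X \<omega>\<bar> \<le> x} \<omega>"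
  proof (intro AE_I2)
    fix \<omega>
    show "(\<lambda>n. (X \<omega>)\<^sup>2 * indicator {\<omega>. \<bar>X \<omega>\<bar> \<le> x + 1 / real (Suc n)} \<omega>)
        \<longlonglongrightarrow> (X \<omega>)\<^sup>2 * indicator {\<omega>. \<bar>X \<omega>\<bar> \<le> x} \<omega>"
    proof (cases "\<bar>X \<omega>\<bar> \<le> x")
      case True
      then have "\<bar>X \<omega>\<bar> \<le> x + 1 / real (Suc n)" for n by (simp add: add_increasing2)
      with True show ?thesis by (simp add: indicator_def)
    next
      case False
      then have "eventually (\<lambda>n. x + 1 / real (Suc n) < \<bar>X \<omega>\<bar>) sequentially"
        using order_tendstoD(2)[OF x1] by simp
      then have "eventually (\<lambda>n. (X \<omega>)\<^sup>2 * indicator {\<omega>. \<bar>X \<omega>\<bar> \<le> x + 1 / real (Suc n)} \<omega>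
          = (X \<omega>)\<^sup>2 * indicator {\<omega>. \<bar>X \<omega>\<bar> \<le> x} \<omega>) sequentially"
        by eventually_elim (use False in \<open>simp add: indicator_def\<close>)
      then show ?thesis by (rule tendsto_eventually)
    qed
  qed
  show "AE \<omega> in M. norm ((X \<omega>)\<^sup>2 * indicator {\<omega>. \<bar>X \<omega>\<bar> \<le> x + 1 / real (Suc n)} \<omega>)
      \<le> (X \<omega>)\<^sup>2 * indicator {\<omega>. \<bar>X \<omega>\<bar> \<le> x + 1} \<omega>" for n
  proof (intro AE_I2)
    fix \<omega>
    have "1 / real (Suc n) \<le> 1" by simp
    then have "x + 1 / real (Suc n) \<le> x + 1" by linarith
    then have "\<bar>X \<omega>\<bar> \<le> x + 1" if "\<bar>X \<omega>\<bar> \<le> x + 1 / real (Suc n)"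
      using that by linarith
    then show "norm ((X \<omega>)\<^sup>2 * indicator {\<omega>. \<bar>X \<omega>\<bar> \<le> x + 1 / real (Suc n)} \<omega>)
        \<le> (X \<omega>)\<^sup>2 * indicator {\<omega>. \<bar>X \<omega>\<bar> \<le> x + 1} \<omega>"
      by (auto simp: indicator_def simp del: of_nat_Suc)
  qed
qed (auto intro: integrable_truncated borel_measurable_integrable[OF integrable_truncated])

lemma cutoff_set_nonempty: "{x. x \<ge> 1 \<and> V x > 1} \<noteq> {}"
proof -
  have "eventually (\<lambda>x. V x > 1) at_top" using V_at_top by (simp add: filterlim_at_top_dense)
  then have "eventually (\<lambda>x. x \<ge> 1 \<and> V x > 1) at_top"
    by (intro eventually_conj eventually_ge_at_top)
  then show ?thesis using eventually_happens[of _ "at_top :: real filter"] by auto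
qed

lemma cutoff_ge_1: "b\<^sub>L \<ge> 1"
  unfolding L_cutoff_def by (rule cInf_greatest[OF cutoff_set_nonempty]) auto

lemma V_cutoff: "V b\<^sub>L \<ge> 1"
proof (rule LIMSEQ_le_const[OF V_right_continuous], intro exI allI impI)
  fix n :: nat
  have "b\<^sub>L < b\<^sub>L + 1 / real (Suc n)" by simp
  then obtain y where "y \<ge> 1" "V y > 1" "y < b\<^sub>L + 1 / real (Suc n)"
    using cInf_lessD[OF cutoff_set_nonempty, of "b\<^sub>L + 1 / real (Suc n)"]
    by (auto simp: L_cutoff_def[symmetric])
  then show "1 \<le> V (b\<^sub>L + 1 / real (Suc n))"
    using V_mono[of y "b\<^sub>L + 1 / real (Suc n)"] by linarith
qed

text \<open>Both case distinctions in \<open>L_fun\<close> are absorbed: arguments below the cutoff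
  by \<open>max\<close>, and the exponent 2 by \<open>\<kappa>\<^sub>L\<close> together with y powr
  0 = 1 for y > 0.\<close>

lemma L_eq: "L x = \<kappa>\<^sub>L * max x b\<^sub>L powr (\<alpha> - 2) * V (max x b\<^sub>L)"
proof -
  have "max x b\<^sub>L > 0" using cutoff_ge_1 by linarith
  then show ?thesis
    using \<alpha> by (auto simp: L_fun_def \<kappa>\<^sub>L_def Let_def max_def not_less)
qed

lemma weight_eq:
  "weight u = \<kappa>\<^sub>L * u powr \<alpha> * max (1 / u) b\<^sub>L powr (\<alpha> - 2) * V (max (1 / u) b\<^sub>L)"
  by (simp add: weight_def L_eq)

lemma weight_0 [simp]: "weight 0 = 0"
  by (simp add: weight_def)

lemma weight_nonneg: "weight u \<ge> 0"
  using \<kappa>\<^sub>L_pos V_nonneg by (simp add: weight_eq)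

text \<open>Let y and z be the arguments of \<open>V\<close> for u and r u, so that z <= y <= r z.
  Then V z <= V y, and since \<alpha> - 2 <= 0 also r^\<alpha> z^(\<alpha>-2) = r^2 (r
  z)^(\<alpha>-2) <= r^2 y^(\<alpha>-2).\<close>

lemma weight_mult_le:
  assumes "r \<ge> 1" "u \<ge> 0"
  shows "weight (r * u) \<le> r\<^sup>2 * weight u"
proof (cases "u = 0")
  case False
  define y where "y = max (1 / u) b\<^sub>L"
  define z where "z = max (1 / (r * u)) b\<^sub>L"
  have pos: "z > 0" "y > 0" "u > 0" using cutoff_ge_1 assms False by (auto simp: y_def z_def)
  have "1 / (r * u) \<le> 1 / u" using assms pos by (simp add: field_simps mult_le_cancel_right1)
  then have "z \<le> y" by (auto simp: y_def z_def)
  have "1 / u = r * (1 / (r * u))" using assms by simp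
  also have "\<dots> \<le> r * z" using assms by (intro mult_left_mono) (auto simp: z_def)
  finally have "1 / u \<le> r * z" .
  moreover have "b\<^sub>L \<le> z" by (simp add: z_def)
  moreover have "1 * z \<le> r * z" using assms pos by (intro mult_right_mono) auto
  ultimately have "y \<le> r * z" by (simp add: y_def)
  have "r powr \<alpha> * z powr (\<alpha> - 2) = r\<^sup>2 * (r * z) powr (\<alpha> - 2)"
    using assms pos by (simp add: powr_mult powr_diff field_simps)
  also have "\<dots> \<le> r\<^sup>2 * y powr (\<alpha> - 2)"
    using \<alpha> pos \<open>y \<le> r * z\<close> by (intro mult_left_mono powr_mono2') auto
  finally have "r powr \<alpha> * z powr (\<alpha> - 2) * V z \<le> r\<^sup>2 * y powr (\<alpha> - 2) * V y"
    by (rule mult_mono[OF _ V_mono[OF \<open>z \<le> y\<close>]]) (auto simp: V_nonneg)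
  then have "\<kappa>\<^sub>L * u powr \<alpha> * (r powr \<alpha> * z powr (\<alpha> - 2) * V z)
      \<le> \<kappa>\<^sub>L * u powr \<alpha> * (r\<^sup>2 * y powr (\<alpha> - 2) * V y)"
    using \<kappa>\<^sub>L_pos by (intro mult_left_mono) auto
  then show ?thesis
    using assms pos by (simp add: weight_eq y_def[symmetric] z_def[symmetric] powr_mult mult_ac)
qed simp

text \<open>Turns a bound on a sum of weights into a bound on the number of terms with u >= e. All
  factors can be estimated at \<open>e\<close>: max(1 / u, \<open>b\<^sub>L\<close>) only decreases
  in u, while \<open>V\<close> is at least 1 from the cutoff on.\<close>

lemma weight_lower:
  assumes "e > 0"
  shows "\<exists>m>0. \<forall>u\<ge>e. weight u \<ge> m"
proof (intro exI conjI allI impI)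
  define y where "y = max (1 / e) b\<^sub>L"
  have "y > 0" using cutoff_ge_1 by (auto simp: y_def)
  show "\<kappa>\<^sub>L * e powr \<alpha> * y powr (\<alpha> - 2) * 1 > 0" using \<kappa>\<^sub>L_pos assms \<open>y > 0\<close> by simp
  fix u assume u: "u \<ge> e"
  have "1 / u \<le> 1 / e" using u assms by (intro divide_left_mono) auto
  then have le: "max (1 / u) b\<^sub>L \<le> y" by (auto simp: y_def)
  have "1 \<le> V (max (1 / u) b\<^sub>L)" using V_cutoff V_mono[of b\<^sub>L "max (1 / u) b\<^sub>L"] by simp
  then show "\<kappa>\<^sub>L * e powr \<alpha> * y powr (\<alpha> - 2) * 1 \<le> weight u"
    unfolding weight_eq using \<kappa>\<^sub>L_pos \<alpha> u assms le cutoff_ge_1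
    by (intro mult_mono powr_mono2 powr_mono2') auto
qed

text \<open>Near 0 the powers with exponent \<alpha> cancel; up to the constant, \<alpha> survives
  only through the regular variation of \<open>V\<close>.\<close>

lemma eventually_weight_eq:
  "eventually (\<lambda>u. weight u = \<kappa>\<^sub>L * (u\<^sup>2 * V (1 / u))) (at_right 0)"
proof -
  have "eventually (\<lambda>u. u \<in> {0<..<1 / b\<^sub>L}) (at_right 0)"
    using cutoff_ge_1 by (intro eventually_at_right_real) auto
  then show ?thesis
  proof eventually_elim
    case (elim u)
    then have "max (1 / u) b\<^sub>L = 1 / u" using cutoff_ge_1 by (auto simp: max_def field_simps)
    moreover have "u powr \<alpha> * (1 / u) powr (\<alpha> - 2) = u\<^sup>2"
      using elim by (simp add: powr_divide powr_diff field_simps)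
    ultimately show ?case by (simp add: weight_eq mult_ac)
  qed
qed

lemma inverse_at_top: "filterlim (\<lambda>u::real. 1 / u) at_top (at_right 0)"
  using filterlim_inverse_at_top_right by (simp add: inverse_eq_divide)

lemma weight_pos: "u > 0 \<Longrightarrow> weight u > 0"
  using weight_lower[of u] by fastforce

text \<open>\<open>V\<close> is evaluated at 1 / (r u), so its index 2 - \<alpha> acts on 1 / r, and
  r^2 (1 / r)^(2-\<alpha>) = r^\<alpha>.\<close>

lemma weight_ratio:
  assumes r: "r > 0"
  shows "((\<lambda>u. weight (r * u) / weight u) \<longlongrightarrow> r powr \<alpha>) (at_right 0)"
proof -
  have scale: "filterlim (\<lambda>u. r * u) (at_right 0) (at_right 0)"
    using r by (auto simp: filterlim_at intro!: tendsto_eq_intros eventually_at_right_less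
        eventually_mono[OF eventually_at_right_less])
  have "((\<lambda>u. r\<^sup>2 * (V ((1 / r) * (1 / u)) / V (1 / u))) \<longlongrightarrow> r\<^sup>2 * (1 / r) powr (2 - \<alpha>)) (at_right 0)"
    using r by (intro tendsto_intros filterlim_compose[OF V_ratio inverse_at_top]) auto
  also have "r\<^sup>2 * (1 / r) powr (2 - \<alpha>) = r powr \<alpha>"
    using r by (simp add: powr_divide powr_diff field_simps)
  finally have lim: "((\<lambda>u. r\<^sup>2 * (V ((1 / r) * (1 / u)) / V (1 / u))) \<longlongrightarrow> r powr \<alpha>) (at_right 0)" .
  have "eventually (\<lambda>u. r\<^sup>2 * (V ((1 / r) * (1 / u)) / V (1 / u)) = weight (r * u) / weight u)
      (at_right 0)"
    using eventually_weight_eq eventually_compose_filterlim[OF eventually_weight_eq scale]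
      eventually_at_right_less[of 0]
  proof eventually_elim
    case (elim u)
    then show ?case using \<kappa>\<^sub>L_pos r by (simp add: power_mult_distrib)
  qed
  with lim show ?thesis by (rule Lim_transform_eventually)
qed

lemma clipped_scaled:
  assumes "u \<noteq> 0"
  shows "expectation (\<lambda>\<omega>. min ((u * X \<omega>)\<^sup>2) 1) = u\<^sup>2 * U (1 / \<bar>u\<bar>)"
proof -
  have "min ((u * X \<omega>)\<^sup>2) 1 = u\<^sup>2 * min ((X \<omega>)\<^sup>2) ((1 / \<bar>u\<bar>)\<^sup>2)" for \<omega>
    using assms by (simp add: mult_min_right power_mult_distrib power_divide)
  then show ?thesis by (simp add: clipped_moment_def)
qed

lemma clipped_le_weight:
  "\<exists>C>0. \<exists>u\<^sub>0>0. \<forall>u. \<bar>u\<bar> < u\<^sub>0 \<longrightarrow> expectation (\<lambda>\<omega>. min ((u * X \<omega>)\<^sup>2) 1) \<le> C * weight \<bar>u\<bar>"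
proof -
  \<comment> \<open>\<alpha> / 4 is half the limit of V / U, so U <= (4 / \<alpha>) V eventually;
    dividing by \<open>\<kappa>\<^sub>L\<close> undoes the constant in
    \<open>weight\<close>.\<close>
  define C where "C = 4 / (\<kappa>\<^sub>L * \<alpha>)"
  have "C > 0" using \<kappa>\<^sub>L_pos \<alpha> by (simp add: C_def)
  have "eventually (\<lambda>x. \<alpha> / 4 < V x / U x) at_top"
    using \<alpha> by (intro order_tendstoD(1)[OF V_ratio_U]) auto
  then have "eventually (\<lambda>x. \<alpha> / 4 * U x \<le> V x) at_top"
    using U_pos by eventually_elim (simp add: field_simps)
  then have "eventually (\<lambda>u. \<alpha> / 4 * U (1 / u) \<le> V (1 / u)) (at_right 0)"
    using inverse_at_top by (rule eventually_compose_filterlim)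
  then have "eventually (\<lambda>u. u\<^sup>2 * U (1 / u) \<le> C * weight u) (at_right 0)"
    using eventually_weight_eq
  proof eventually_elim
    case (elim u)
    then have "4 / \<alpha> * u\<^sup>2 * (\<alpha> / 4 * U (1 / u)) \<le> 4 / \<alpha> * u\<^sup>2 * V (1 / u)"
      using \<alpha> by (intro mult_left_mono) auto
    then show ?case using elim \<alpha> \<kappa>\<^sub>L_pos by (simp add: C_def)
  qed
  then obtain u\<^sub>0 where u0: "u\<^sub>0 > 0" "\<And>u. 0 < u \<Longrightarrow> u < u\<^sub>0 \<Longrightarrow> u\<^sup>2 * U (1 / u) \<le> C * weight u"
    by (auto simp: eventually_at_right_field)
  have "expectation (\<lambda>\<omega>. min ((u * X \<omega>)\<^sup>2) 1) \<le> C * weight \<bar>u\<bar>" if "\<bar>u\<bar> < u\<^sub>0" for u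
    using u0(2)[of "\<bar>u\<bar>"] that by (cases "u = 0") (auto simp: clipped_scaled)
  then show ?thesis using \<open>C > 0\<close> u0(1) by blast
qed

text \<open>Near 0 the weight is at most \<open>\<kappa>\<^sub>L\<close> times E min((u X)^2, 1),
  which tends to 0 by dominated convergence.\<close>

lemma weight_tendsto_0: "(weight \<longlongrightarrow> 0) (at_right 0)"
proof -
  have "((\<lambda>x. expectation (\<lambda>\<omega>. min ((X \<omega> / x)\<^sup>2) 1)) \<longlongrightarrow> expectation (\<lambda>\<omega>. 0)) at_top"
  proof (rule integral_dominated_convergence_at_top[where w="\<lambda>_. 1"])
    show "AE \<omega> in M. ((\<lambda>x. min ((X \<omega> / x)\<^sup>2) 1) \<longlongrightarrow> 0) at_top"
    proof (intro AE_I2)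
      fix \<omega>
      have "((\<lambda>x. min ((X \<omega> / x)\<^sup>2) 1) \<longlongrightarrow> min (0\<^sup>2) 1) at_top"
        by (intro tendsto_intros tendsto_divide_0[OF tendsto_const] filterlim_at_top_imp_at_infinity
            filterlim_ident)
      then show "((\<lambda>x. min ((X \<omega> / x)\<^sup>2) 1) \<longlongrightarrow> 0) at_top" by simp
    qed
  qed auto
  then have "((\<lambda>u. expectation (\<lambda>\<omega>. min ((X \<omega> / (1 / u))\<^sup>2) 1)) \<longlongrightarrow> 0) (at_right 0)"
    using inverse_at_top unfolding Bochner_Integration.integral_zero by (rule filterlim_compose)
  then have "((\<lambda>u. \<kappa>\<^sub>L * expectation (\<lambda>\<omega>. min ((u * X \<omega>)\<^sup>2) 1)) \<longlongrightarrow> \<kappa>\<^sub>L * 0) (at_right 0)"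
    by (intro tendsto_mult_left) (simp add: mult.commute)
  then have lim: "((\<lambda>u. \<kappa>\<^sub>L * expectation (\<lambda>\<omega>. min ((u * X \<omega>)\<^sup>2) 1)) \<longlongrightarrow> 0) (at_right 0)" by simp
  show ?thesis
  proof (rule tendsto_sandwich[OF _ _ tendsto_const lim])
    show "eventually (\<lambda>u. weight u \<le> \<kappa>\<^sub>L * expectation (\<lambda>\<omega>. min ((u * X \<omega>)\<^sup>2) 1)) (at_right 0)"
      using eventually_weight_eq eventually_at_right_less[of 0]
    proof eventually_elim
      case (elim u)
      have "V (1 / u) \<le> U (1 / u)" using elim by (simp add: V_eq)
      then show ?case using elim \<kappa>\<^sub>L_pos by (simp add: clipped_scaled mult_left_mono)
    qed
  qed (simp add: weight_nonneg)
qed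

end

text \<open>The mean of sin(u X) can be read off the characteristic function, that of the clamped
  variable cannot; the two differ by at most twice the clipped second moment.\<close>

lemma abs_clamp_minus_sin_le:
  fixes x :: real
  shows "\<bar>max (-1) (min 1 x) - sin x\<bar> \<le> 2 * min (x\<^sup>2) 1"
proof (cases "\<bar>x\<bar> \<le> 1")
  case True
  have "\<bar>sin x - (\<Sum>m<2. sin_coeff m * x ^ m)\<bar> \<le> inverse (fact 2) * \<bar>x\<bar> ^ 2"
    by (rule Maclaurin_sin_bound)
  then have "\<bar>sin x - x\<bar> \<le> x\<^sup>2 / 2"
    by (simp add: numeral_2_eq_2 sin_coeff_def)
  moreover have "max (-1) (min 1 x) = x" "min (x\<^sup>2) 1 = x\<^sup>2"
    using True by (auto simp: abs_square_le_1 min_def max_def)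
  ultimately show ?thesis using zero_le_power2[of x] abs_minus_commute[of x "sin x"]
    by linarith
next
  case False
  then have "min (x\<^sup>2) 1 = 1" by (auto simp: abs_square_le_1 min_def)
  moreover have "\<bar>max (-1) (min 1 x)\<bar> \<le> 1" by (auto simp: max_def min_def)
  ultimately show ?thesis using abs_sin_le_one[of x] by linarith
qed

section \<open>Convergence of series of independent random variables\<close>

text \<open>Clamping to [-1, 1], rather than setting large values to 0, makes the square equal to
  the clipped square, so that one moment controls both large values and variances.\<close>

abbreviation unit_clamp :: "real \<Rightarrow> real" where
  "unit_clamp x \<equiv> max (-1) (min 1 x)"

lemma unit_clamp_squared: "(unit_clamp x)\<^sup>2 = min (x\<^sup>2) 1"
  using abs_le_square_iff[of x 1] abs_le_square_iff[of 1 x]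
  by (auto simp: max_def min_def abs_if split: if_splits)

lemma abs_unit_clamp_le: "\<bar>unit_clamp x\<bar> \<le> 1"
  by (auto simp: max_def min_def)

context prob_space
begin

text \<open>The second moment is the variance, at most the sum of the E Y^2, plus the squared mean,
  at most the square of the sum of the |E Y|.\<close>

lemma expectation_sum_squared_le:
  fixes Y :: "'i \<Rightarrow> 'a \<Rightarrow> real"
  assumes ind: "indep_vars (\<lambda>_. borel) Y UNIV" and bd: "\<And>i \<omega>. \<bar>Y i \<omega>\<bar> \<le> 1" and "finite J"
  shows "expectation (\<lambda>\<omega>. (\<Sum>i\<in>J. Y i \<omega>)\<^sup>2)
    \<le> (\<Sum>i\<in>J. expectation (\<lambda>\<omega>. (Y i \<omega>)\<^sup>2)) + (\<Sum>i\<in>J. \<bar>expectation (Y i)\<bar>)\<^sup>2"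
  using \<open>finite J\<close>
proof induction
  case (insert i J)
  have rv [measurable]: "random_variable borel (Y i)" for i
    using ind by (simp add: indep_vars_def)
  let ?S = "\<lambda>\<omega>. \<Sum>j\<in>J. Y j \<omega>"
  have intY [simp]: "integrable M (Y j)" for j
    using bd by (intro integrable_const_bound[where B=1]) auto
  have bS: "\<bar>?S \<omega>\<bar> \<le> real (card J)" for \<omega>
    using sum_bounded_above[of J "\<lambda>j. \<bar>Y j \<omega>\<bar>" 1, OF bd] sum_abs[of "\<lambda>j. Y j \<omega>" J]
    by linarith
  have intS [simp]: "integrable M ?S" by simp
  have indep: "indep_var borel (Y i) borel ?S"
    using insert by (intro indep_vars_sum indep_vars_subset[OF ind]) auto
  have int2: "integrable M (\<lambda>\<omega>. (Y i \<omega>)\<^sup>2)"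
    using bd by (intro integrable_const_bound[where B=1]) (auto simp: abs_square_le_1)
  have intS2: "integrable M (\<lambda>\<omega>. (?S \<omega>)\<^sup>2)"
    by (intro integrable_const_bound[where B="(real (card J))\<^sup>2"])
       (auto simp: power2_le_iff_abs_le bS)
  have intYS: "integrable M (\<lambda>\<omega>. Y i \<omega> * ?S \<omega>)"
    using indep by (intro indep_var_integrable) auto
  have "expectation (\<lambda>\<omega>. (\<Sum>j\<in>insert i J. Y j \<omega>)\<^sup>2)
      = expectation (\<lambda>\<omega>. (Y i \<omega>)\<^sup>2 + (2 * (Y i \<omega> * ?S \<omega>) + (?S \<omega>)\<^sup>2))"
    using insert by (simp add: power2_sum algebra_simps)
  also have "\<dots> = expectation (\<lambda>\<omega>. (Y i \<omega>)\<^sup>2)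
      + (2 * expectation (\<lambda>\<omega>. Y i \<omega> * ?S \<omega>) + expectation (\<lambda>\<omega>. (?S \<omega>)\<^sup>2))"
    using int2 intS2 intYS by simp
  also have "expectation (\<lambda>\<omega>. Y i \<omega> * ?S \<omega>) = expectation (Y i) * expectation ?S"
    using indep by (intro indep_var_lebesgue_integral) auto
  also have "expectation ?S = (\<Sum>j\<in>J. expectation (Y j))" by simp
  finally have eq: "expectation (\<lambda>\<omega>. (\<Sum>j\<in>insert i J. Y j \<omega>)\<^sup>2) = expectation (\<lambda>\<omega>. (Y i \<omega>)\<^sup>2)
      + (2 * (expectation (Y i) * (\<Sum>j\<in>J. expectation (Y j))) + expectation (\<lambda>\<omega>. (?S \<omega>)\<^sup>2))" .
  have "expectation (Y i) * (\<Sum>j\<in>J. expectation (Y j))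
      \<le> \<bar>expectation (Y i)\<bar> * \<bar>\<Sum>j\<in>J. expectation (Y j)\<bar>"
    unfolding abs_mult[symmetric] by (rule abs_ge_self)
  also have "\<dots> \<le> \<bar>expectation (Y i)\<bar> * (\<Sum>j\<in>J. \<bar>expectation (Y j)\<bar>)"
    by (intro mult_left_mono sum_abs abs_ge_zero)
  finally have le: "expectation (Y i) * (\<Sum>j\<in>J. expectation (Y j))
      \<le> \<bar>expectation (Y i)\<bar> * (\<Sum>j\<in>J. \<bar>expectation (Y j)\<bar>)" .
  have "(\<Sum>j\<in>insert i J. \<bar>expectation (Y j)\<bar>)\<^sup>2 = (expectation (Y i))\<^sup>2
      + (\<Sum>j\<in>J. \<bar>expectation (Y j)\<bar>)\<^sup>2
      + 2 * (\<bar>expectation (Y i)\<bar> * (\<Sum>j\<in>J. \<bar>expectation (Y j)\<bar>))"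
    using insert.hyps by (simp add: power2_sum)
  moreover have "(\<Sum>j\<in>insert i J. expectation (\<lambda>\<omega>. (Y j \<omega>)\<^sup>2))
      = expectation (\<lambda>\<omega>. (Y i \<omega>)\<^sup>2) + (\<Sum>j\<in>J. expectation (\<lambda>\<omega>. (Y j \<omega>)\<^sup>2))"
    using insert.hyps by simp
  ultimately show ?case
    unfolding eq using le insert.IH zero_le_power2[of "expectation (Y i)"] by linarith
qed simp

text \<open>Either some term reaches size 1, an event controlled by Markov's inequality for the
  clipped squares, or clamping alters no term and Chebyshev's inequality applies to the clamped
  sum.\<close>

lemma prob_abs_sum_ge_le:
  fixes X :: "'i \<Rightarrow> 'a \<Rightarrow> real"
  assumes ind: "indep_vars (\<lambda>_. borel) X UNIV" and J: "finite J" and "a > 0"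
  shows "prob {\<omega> \<in> space M. \<bar>\<Sum>i\<in>J. X i \<omega>\<bar> \<ge> a}
    \<le> (\<Sum>i\<in>J. expectation (\<lambda>\<omega>. min ((X i \<omega>)\<^sup>2) 1))
      + ((\<Sum>i\<in>J. expectation (\<lambda>\<omega>. min ((X i \<omega>)\<^sup>2) 1))
         + (\<Sum>i\<in>J. \<bar>expectation (\<lambda>\<omega>. unit_clamp (X i \<omega>))\<bar>)\<^sup>2) / a\<^sup>2"
proof -
  have rv [measurable]: "random_variable borel (X i)" for i
    using ind by (simp add: indep_vars_def)
  let ?Z = "\<lambda>\<omega>. \<Sum>i\<in>J. unit_clamp (X i \<omega>)"
  let ?B = "\<Union>i\<in>J. {\<omega> \<in> space M. 1 \<le> min ((X i \<omega>)\<^sup>2) 1}"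
  have bZ: "\<bar>?Z \<omega>\<bar> \<le> real (card J)" for \<omega>
    using sum_bounded_above[of J "\<lambda>i. \<bar>unit_clamp (X i \<omega>)\<bar>" 1, OF abs_unit_clamp_le]
      sum_abs[of "\<lambda>i. unit_clamp (X i \<omega>)" J] by linarith
  have intZ: "integrable M (\<lambda>\<omega>. (?Z \<omega>)\<^sup>2)"
    by (intro integrable_const_bound[where B="(real (card J))\<^sup>2"])
       (auto simp: power2_le_iff_abs_le bZ)
  have sub: "{\<omega> \<in> space M. \<bar>\<Sum>i\<in>J. X i \<omega>\<bar> \<ge> a} \<subseteq> ?B \<union> {\<omega> \<in> space M. a\<^sup>2 \<le> (?Z \<omega>)\<^sup>2}"
  proof (intro subsetI, rule ccontr)
    fix \<omega> assume "\<omega> \<in> {\<omega> \<in> space M. \<bar>\<Sum>i\<in>J. X i \<omega>\<bar> \<ge> a}"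
      and n: "\<omega> \<notin> ?B \<union> {\<omega> \<in> space M. a\<^sup>2 \<le> (?Z \<omega>)\<^sup>2}"
    then have \<omega>: "\<omega> \<in> space M" "\<bar>\<Sum>i\<in>J. X i \<omega>\<bar> \<ge> a" "\<not> a\<^sup>2 \<le> (?Z \<omega>)\<^sup>2" by auto
    show False
    proof -
      from n have "\<omega> \<notin> ?B" by blast
      then have "\<bar>X i \<omega>\<bar> \<le> 1" if "i \<in> J" for i
        using that \<omega>(1) abs_square_le_1[of "X i \<omega>"] by auto
      then have "unit_clamp (X i \<omega>) = X i \<omega>" if "i \<in> J" for i
        using that by (fastforce simp: max_def min_def abs_le_iff)
      then have "?Z \<omega> = (\<Sum>i\<in>J. X i \<omega>)" by simp
      then show False using \<omega> \<open>a > 0\<close> abs_le_square_iff[of a "?Z \<omega>"] by simp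
    qed
  qed
  have B: "?B \<in> events" using J by (intro sets.finite_UN) measurable
  have C: "{\<omega> \<in> space M. a\<^sup>2 \<le> (?Z \<omega>)\<^sup>2} \<in> events" by measurable
  have "prob {\<omega> \<in> space M. \<bar>\<Sum>i\<in>J. X i \<omega>\<bar> \<ge> a} \<le> prob (?B \<union> {\<omega> \<in> space M. a\<^sup>2 \<le> (?Z \<omega>)\<^sup>2})"
    by (intro finite_measure_mono sub sets.Un B C)
  also have "\<dots> \<le> prob ?B + prob {\<omega> \<in> space M. a\<^sup>2 \<le> (?Z \<omega>)\<^sup>2}"
    by (intro measure_Un_le B C)
  finally have 1: "prob {\<omega> \<in> space M. \<bar>\<Sum>i\<in>J. X i \<omega>\<bar> \<ge> a}
    \<le> prob ?B + prob {\<omega> \<in> space M. a\<^sup>2 \<le> (?Z \<omega>)\<^sup>2}" .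
  have "prob ?B \<le> (\<Sum>i\<in>J. prob {\<omega> \<in> space M. 1 \<le> min ((X i \<omega>)\<^sup>2) 1})"
    using J by (intro finite_measure_subadditive_finite) auto
  also have "\<dots> \<le> (\<Sum>i\<in>J. expectation (\<lambda>\<omega>. min ((X i \<omega>)\<^sup>2) 1) / 1)"
    using integrable_clipped[OF rv, of _ 1]
    by (intro sum_mono integral_Markov_inequality_measure[where A="{}"]) auto
  finally have 2: "prob ?B \<le> (\<Sum>i\<in>J. expectation (\<lambda>\<omega>. min ((X i \<omega>)\<^sup>2) 1))" by simp
  have "prob {\<omega> \<in> space M. a\<^sup>2 \<le> (?Z \<omega>)\<^sup>2} \<le> expectation (\<lambda>\<omega>. (?Z \<omega>)\<^sup>2) / a\<^sup>2"
    using \<open>a > 0\<close> intZ by (intro integral_Markov_inequality_measure[where A="{}"]) auto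
  also have "\<dots> \<le> ((\<Sum>i\<in>J. expectation (\<lambda>\<omega>. min ((X i \<omega>)\<^sup>2) 1))
         + (\<Sum>i\<in>J. \<bar>expectation (\<lambda>\<omega>. unit_clamp (X i \<omega>))\<bar>)\<^sup>2) / a\<^sup>2"
  proof (intro divide_right_mono)
    have "indep_vars (\<lambda>_. borel) (\<lambda>i \<omega>. unit_clamp (X i \<omega>)) UNIV"
      by (intro indep_vars_compose2[OF ind]) auto
    from expectation_sum_squared_le[OF this abs_unit_clamp_le J]
    show "expectation (\<lambda>\<omega>. (?Z \<omega>)\<^sup>2) \<le> (\<Sum>i\<in>J. expectation (\<lambda>\<omega>. min ((X i \<omega>)\<^sup>2) 1))
         + (\<Sum>i\<in>J. \<bar>expectation (\<lambda>\<omega>. unit_clamp (X i \<omega>))\<bar>)\<^sup>2"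
      by (simp only: unit_clamp_squared)
  qed simp
  finally show ?thesis using 1 2 by linarith
qed

text \<open>Ottaviani's inequality, by decomposing according to the first passage of level \<open>2 a\<close>.\<close>

lemma maximal_inequality:
  fixes Y :: "nat \<Rightarrow> 'a \<Rightarrow> real"
  assumes ind: "indep_vars (\<lambda>_. borel) Y UNIV" and "a > 0"
    and half: "\<And>j. m \<le> j \<Longrightarrow> j \<le> N \<Longrightarrow> prob {\<omega> \<in> space M. \<bar>\<Sum>l\<in>{j..<N}. Y l \<omega>\<bar> \<ge> a} \<le> 1 / 2"
  shows "prob {\<omega> \<in> space M. \<exists>j\<in>{m..N}. \<bar>\<Sum>l\<in>{m..<j}. Y l \<omega>\<bar> \<ge> 2 * a}
    \<le> 2 * prob {\<omega> \<in> space M. \<bar>\<Sum>l\<in>{m..<N}. Y l \<omega>\<bar> \<ge> a}"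
proof -
  have rv [measurable]: "random_variable borel (Y i)" for i
    using ind by (simp add: indep_vars_def)
  define A where "A j = {\<omega> \<in> space M. \<bar>\<Sum>l\<in>{m..<j}. Y l \<omega>\<bar> \<ge> 2 * a
    \<and> (\<forall>i\<in>{m..<j}. \<bar>\<Sum>l\<in>{m..<i}. Y l \<omega>\<bar> < 2 * a)}" for j
  define B where "B j = {\<omega> \<in> space M. \<bar>\<Sum>l\<in>{j..<N}. Y l \<omega>\<bar> < a}" for j
  have [measurable]: "A j \<in> events" "B j \<in> events" for j unfolding A_def B_def by measurable
  have AB: "prob (A j) \<le> 2 * prob (A j \<inter> B j)" if j: "j \<in> {m..N}" for j
  proof -
    let ?P = "\<lambda>I. Pi\<^sub>M I (\<lambda>_. borel :: real measure)"
    let ?A = "{f \<in> space (?P {m..<j}). \<bar>\<Sum>l\<in>{m..<j}. f l\<bar> \<ge> 2 * a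
      \<and> (\<forall>i\<in>{m..<j}. \<bar>\<Sum>l\<in>{m..<i}. f l\<bar> < 2 * a)}"
    let ?B = "{f \<in> space (?P {j..<N}). \<bar>\<Sum>l\<in>{j..<N}. f l\<bar> < a}"
    have "(\<lambda>f. \<Sum>l\<in>{m..<i}. f l) \<in> borel_measurable (?P {m..<j})" if "i \<le> j" for i
      using that by (intro borel_measurable_sum measurable_component_singleton) auto
    then have [measurable]: "Measurable.pred (?P {m..<j}) (\<lambda>f. \<forall>i\<in>{m..<j}. \<bar>\<Sum>l\<in>{m..<i}. f l\<bar> < 2 * a)"
      by (intro pred_intros_finite) (auto intro!: borel_measurable_less borel_measurable_abs)
    have A: "?A \<in> sets (?P {m..<j})" by measurable
    have B: "?B \<in> sets (?P {j..<N})" by measurable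
    \<comment> \<open>\<open>A j\<close> is a preimage under the block of terms before j,
      \<open>B j\<close> under the block from j on; disjoint blocks are independent.\<close>
    let ?X = "\<lambda>I \<omega>. restrict (\<lambda>i. Y i \<omega>) I"
    have "indep_var (?P {m..<j}) (?X {m..<j}) (?P {j..<N}) (?X {j..<N})"
      by (intro indep_var_restrict[OF ind]) auto
    from indep_varD[OF this A B]
    have "prob ((\<lambda>x. (?X {m..<j} x, ?X {j..<N} x)) -` (?A \<times> ?B) \<inter> space M)
        = prob (?X {m..<j} -` ?A \<inter> space M) * prob (?X {j..<N} -` ?B \<inter> space M)" .
    also have "?X {m..<j} -` ?A \<inter> space M = A j"
      by (auto simp: A_def space_PiM)
    also have "?X {j..<N} -` ?B \<inter> space M = B j"
      by (auto simp: B_def space_PiM)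
    also have "(\<lambda>x. (?X {m..<j} x, ?X {j..<N} x)) -` (?A \<times> ?B) \<inter> space M = A j \<inter> B j"
      by (auto simp: A_def B_def space_PiM)
    finally have "prob (A j \<inter> B j) = prob (A j) * prob (B j)" .
    moreover have "prob (B j) \<ge> 1 / 2"
    proof -
      have "B j = space M - {\<omega> \<in> space M. \<bar>\<Sum>l\<in>{j..<N}. Y l \<omega>\<bar> \<ge> a}" by (auto simp: B_def)
      then show ?thesis using half[of j] j by (simp add: prob_compl)
    qed
    then have "prob (A j) * (1 / 2) \<le> prob (A j) * prob (B j)" by (intro mult_left_mono) auto
    ultimately show ?thesis by simp
  qed
  have disj: "disjoint_family_on A {m..N}"
    unfolding disjoint_family_on_def
  proof (intro ballI impI)
    have lt: "A i \<inter> A j = {}" if "m \<le> i" "i < j" for i j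
    proof (rule ccontr)
      assume "A i \<inter> A j \<noteq> {}"
      then obtain \<omega> where "\<omega> \<in> A i" "\<omega> \<in> A j" by blast
      moreover have "i \<in> {m..<j}" using that by simp
      ultimately have "2 * a \<le> \<bar>\<Sum>l\<in>{m..<i}. Y l \<omega>\<bar>" "\<bar>\<Sum>l\<in>{m..<i}. Y l \<omega>\<bar> < 2 * a"
        unfolding A_def by blast+
      then show False by simp
    qed
    fix i j assume ij: "i \<in> {m..N}" "j \<in> {m..N}" "i \<noteq> j"
    then show "A i \<inter> A j = {}" using lt[of i j] lt[of j i] by (cases "i < j") auto
  qed
  have "{\<omega> \<in> space M. \<exists>j\<in>{m..N}. \<bar>\<Sum>l\<in>{m..<j}. Y l \<omega>\<bar> \<ge> 2 * a} \<subseteq> (\<Union>j\<in>{m..N}. A j)"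
  proof (intro subsetI)
    fix \<omega> assume "\<omega> \<in> {\<omega> \<in> space M. \<exists>j\<in>{m..N}. \<bar>\<Sum>l\<in>{m..<j}. Y l \<omega>\<bar> \<ge> 2 * a}"
    then obtain k where \<omega>: "\<omega> \<in> space M" "k \<in> {m..N}" "\<bar>\<Sum>l\<in>{m..<k}. Y l \<omega>\<bar> \<ge> 2 * a"
      by blast
    define Q where "Q j \<longleftrightarrow> j \<ge> m \<and> \<bar>\<Sum>l\<in>{m..<j}. Y l \<omega>\<bar> \<ge> 2 * a" for j
    define j where "j = (LEAST j. Q j)"
    have "Q k" using \<omega> by (simp add: Q_def)
    then have "Q j" unfolding j_def by (rule LeastI)
    then have j: "j \<ge> m \<and> \<bar>\<Sum>l\<in>{m..<j}. Y l \<omega>\<bar> \<ge> 2 * a" by (simp add: Q_def)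
    have jk: "j \<le> k" unfolding j_def using \<open>Q k\<close> by (rule Least_le)
    have least: "\<not> Q i" if "i < j" for i
      using that not_less_Least unfolding j_def by blast
    have "\<bar>\<Sum>l\<in>{m..<i}. Y l \<omega>\<bar> < 2 * a" if "i \<in> {m..<j}" for i
      using least[of i] that by (simp add: Q_def)
    then have "\<omega> \<in> A j" "j \<in> {m..N}" using jk j \<omega>(1,2) by (simp_all add: A_def)
    then show "\<omega> \<in> (\<Union>j\<in>{m..N}. A j)" by blast
  qed
  then have "prob {\<omega> \<in> space M. \<exists>j\<in>{m..N}. \<bar>\<Sum>l\<in>{m..<j}. Y l \<omega>\<bar> \<ge> 2 * a}
      \<le> prob (\<Union>j\<in>{m..N}. A j)"
    by (intro finite_measure_mono) auto
  also have "\<dots> = (\<Sum>j\<in>{m..N}. prob (A j))"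
    by (intro finite_measure_finite_Union disj) auto
  also have "\<dots> \<le> (\<Sum>j\<in>{m..N}. 2 * prob (A j \<inter> B j))" by (intro sum_mono AB)
  also have "\<dots> = 2 * prob (\<Union>j\<in>{m..N}. A j \<inter> B j)"
    using disj
    by (subst finite_measure_finite_Union) (auto simp: sum_distrib_left disjoint_family_on_def)
  \<comment> \<open>Having reached 2 a at time j, the sum cannot return below a by a remainder
    smaller than a.\<close>
  also have "prob (\<Union>j\<in>{m..N}. A j \<inter> B j) \<le> prob {\<omega> \<in> space M. \<bar>\<Sum>l\<in>{m..<N}. Y l \<omega>\<bar> \<ge> a}"
  proof (intro finite_measure_mono, safe)
    fix \<omega> j assume *: "j \<in> {m..N}" "\<omega> \<in> A j" "\<omega> \<in> B j"
    have "(\<Sum>l\<in>{m..<N}. Y l \<omega>) = (\<Sum>l\<in>{m..<j}. Y l \<omega>) + (\<Sum>l\<in>{j..<N}. Y l \<omega>)"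
      using * by (intro sum.atLeastLessThan_concat[symmetric]) auto
    then show "a \<le> \<bar>\<Sum>l\<in>{m..<N}. Y l \<omega>\<bar>" using * by (auto simp: A_def B_def)
  qed (auto simp: A_def)
  finally show ?thesis by simp
qed

text \<open>For independent terms, being Cauchy in probability is enough: the maximal inequality
  upgrades the bound on single block sums to one on the supremum over all later partial
  sums.\<close>

lemma AE_convergent_sum_nat:
  fixes Y :: "nat \<Rightarrow> 'a \<Rightarrow> real"
  assumes ind: "indep_vars (\<lambda>_. borel) Y UNIV"
    and cauchy: "\<And>a \<eta>. a > 0 \<Longrightarrow> \<eta> > 0 \<Longrightarrow> \<exists>m. \<forall>j k. m \<le> j \<longrightarrow> j \<le> k \<longrightarrow>
      prob {\<omega> \<in> space M. \<bar>\<Sum>l\<in>{j..<k}. Y l \<omega>\<bar> \<ge> a} \<le> \<eta>"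
  shows "AE \<omega> in M. convergent (\<lambda>k. \<Sum>l<k. Y l \<omega>)"
proof -
  have rv [measurable]: "random_variable borel (Y i)" for i
    using ind by (simp add: indep_vars_def)
  have small: "AE \<omega> in M. \<exists>m. \<forall>j\<ge>m. \<bar>\<Sum>l\<in>{m..<j}. Y l \<omega>\<bar> < 2 * a" if "a > 0" for a
  proof -
    define D where "D m = {\<omega> \<in> space M. \<exists>j\<ge>m. \<bar>\<Sum>l\<in>{m..<j}. Y l \<omega>\<bar> \<ge> 2 * a}" for m
    let ?N = "{\<omega> \<in> space M. \<not> (\<exists>m. \<forall>j\<ge>m. \<bar>\<Sum>l\<in>{m..<j}. Y l \<omega>\<bar> < 2 * a)}"
    have [measurable]: "D m \<in> events" for m unfolding D_def by measurable
    have [measurable]: "?N \<in> events" by measurable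
    have "prob ?N \<le> 0 + e" if "e > 0" for e
    proof -
      \<comment> \<open>The bound 1 / 2 is what the maximal inequality asks of the remaining sums,
        and e / 2 compensates its factor 2.\<close>
      obtain m where m: "\<And>j k. m \<le> j \<Longrightarrow> j \<le> k \<Longrightarrow>
          prob {\<omega> \<in> space M. \<bar>\<Sum>l\<in>{j..<k}. Y l \<omega>\<bar> \<ge> a} \<le> min (1 / 2) (e / 2)"
        using cauchy[of a "min (1 / 2) (e / 2)"] \<open>a > 0\<close> \<open>e > 0\<close> by auto
      let ?E = "\<lambda>N. {\<omega> \<in> space M. \<exists>j\<in>{m..N}. \<bar>\<Sum>l\<in>{m..<j}. Y l \<omega>\<bar> \<ge> 2 * a}"
      have "prob (?E N) \<le> e" for N
      proof (cases "m \<le> N")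
        case True
        have "prob (?E N) \<le> 2 * prob {\<omega> \<in> space M. \<bar>\<Sum>l\<in>{m..<N}. Y l \<omega>\<bar> \<ge> a}"
          using m \<open>a > 0\<close> by (intro maximal_inequality[OF ind]) auto
        also have "\<dots> \<le> e" using m[of m N] True by simp
        finally show ?thesis .
      next
        case False
        then show ?thesis using \<open>e > 0\<close> by simp
      qed
      moreover have "(\<lambda>N. prob (?E N)) \<longlonglongrightarrow> prob (\<Union>N. ?E N)"
      proof (intro finite_Lim_measure_incseq)
        show "incseq ?E" by (rule incseq_SucI) (auto simp: atLeastAtMost_iff intro: le_SucI)
      qed auto
      ultimately have "prob (\<Union>N. ?E N) \<le> e" by (intro LIMSEQ_le_const2) auto
      moreover have "?N \<subseteq> (\<Union>N. ?E N)"
      proof safe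
        fix \<omega> assume \<omega>: "\<omega> \<in> space M" "\<not> (\<exists>m. \<forall>j\<ge>m. \<bar>\<Sum>l\<in>{m..<j}. Y l \<omega>\<bar> < 2 * a)"
        then obtain j where "j \<ge> m" "\<bar>\<Sum>l\<in>{m..<j}. Y l \<omega>\<bar> \<ge> 2 * a" by (meson not_less)
        then show "\<omega> \<in> (\<Union>N. ?E N)" using \<omega> by (auto intro!: exI[of _ j] bexI[of _ j])
      qed
      then have "prob ?N \<le> prob (\<Union>N. ?E N)" by (intro finite_measure_mono) auto
      ultimately show ?thesis by simp
    qed
    then have "prob ?N \<le> 0" by (rule field_le_epsilon)
    then have "prob ?N = 0" using measure_nonneg[of M ?N] by linarith
    then have "?N \<in> null_sets M" by (auto simp: null_sets_def emeasure_eq_measure)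
    then show ?thesis by (rule AE_I') auto
  qed
  \<comment> \<open>Restricting to the levels 1 / (n + 1) keeps the union of the exceptional sets
    null.\<close>
  have "AE \<omega> in M. \<forall>n::nat. \<exists>m. \<forall>j\<ge>m. \<bar>\<Sum>l\<in>{m..<j}. Y l \<omega>\<bar> < 2 * (1 / real (Suc n))"
    unfolding AE_all_countable by (intro allI small) simp
  then show ?thesis
  proof eventually_elim
    case (elim \<omega>)
    have "Cauchy (\<lambda>k. \<Sum>l<k. Y l \<omega>)"
    proof (rule CauchyI')
      fix e :: real assume "e > 0"
      then obtain n where "1 / real (Suc n) < e / 4"
        using nat_approx_posE[of "e / 4"] by auto
      then have n: "4 * (1 / real (Suc n)) < e" by simp
      from elim obtain m where m: "\<And>j. j \<ge> m \<Longrightarrow> \<bar>\<Sum>l\<in>{m..<j}. Y l \<omega>\<bar> < 2 * (1 / real (Suc n))"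
        by blast
      have split: "(\<Sum>l<j. Y l \<omega>) = (\<Sum>l<m. Y l \<omega>) + (\<Sum>l\<in>{m..<j}. Y l \<omega>)" if "j \<ge> m" for j
        using that sum.atLeastLessThan_concat[of 0 m j "\<lambda>l. Y l \<omega>"] by (simp add: atLeast0LessThan)
      show "\<exists>M. \<forall>m\<ge>M. \<forall>n>m. dist (\<Sum>l<m. Y l \<omega>) (\<Sum>l<n. Y l \<omega>) < e"
      proof (intro exI allI impI)
        fix i j assume "m \<le> i" "i < j"
        then show "dist (\<Sum>l<i. Y l \<omega>) (\<Sum>l<j. Y l \<omega>) < e"
          unfolding dist_real_def using m[of i] m[of j] n split[of i] split[of j] by linarith
      qed
    qed
    then show ?case by (simp add: Cauchy_convergent_iff)
  qed
qed

text \<open>Grouping the terms by the first \<open>F k\<close> that contains them produces an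
  independent sequence whose partial sums are the sums over the \<open>F k\<close>, and the
  criterion for sequences applies.\<close>

lemma AE_convergent_sum:
  fixes X :: "'i \<Rightarrow> 'a \<Rightarrow> real" and F :: "nat \<Rightarrow> 'i set"
  assumes ind: "indep_vars (\<lambda>_. borel) X UNIV"
    and F: "incseq F" "\<And>k. finite (F k)" "(\<Union>k. F k) = UNIV"
    and cauchy: "\<And>a \<eta>. a > 0 \<Longrightarrow> \<eta> > 0 \<Longrightarrow> \<exists>K. finite K \<and> (\<forall>J. finite J \<longrightarrow> J \<inter> K = {} \<longrightarrow>
      prob {\<omega> \<in> space M. \<bar>\<Sum>i\<in>J. X i \<omega>\<bar> \<ge> a} \<le> \<eta>)"
  shows "AE \<omega> in M. convergent (\<lambda>k. \<Sum>i\<in>F k. X i \<omega>)"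
proof -
  let ?D = "disjointed F"
  have finD: "finite (?D l)" for l using F(2)[of l] by (simp add: disjointed_def)
  have disj: "disjoint_family ?D" by (rule disjoint_family_disjointed)
  define Y where "Y l \<omega> = (\<Sum>i\<in>?D l. X i \<omega>)" for l \<omega>
  have "indep_vars (\<lambda>_. borel) (\<lambda>l \<omega>. \<Sum>i\<in>?D l. restrict (\<lambda>i. X i \<omega>) (?D l) i) UNIV"
    using disj
    by (intro indep_vars_compose2[where Y="\<lambda>l f. \<Sum>i\<in>?D l. f i", OF indep_vars_restrict[OF ind]])
       (auto intro!: borel_measurable_sum measurable_component_singleton)
  then have indY: "indep_vars (\<lambda>_. borel) Y UNIV"
    by (simp add: Y_def[abs_def] cong: sum.cong)
  have sumY: "(\<Sum>l\<in>I. Y l \<omega>) = (\<Sum>i\<in>(\<Union>l\<in>I. ?D l). X i \<omega>)" if "finite I" for I \<omega>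
    unfolding Y_def using disj finD that
    by (intro sum.UNION_disjoint[symmetric]) (auto simp: disjoint_family_on_def)
  have "AE \<omega> in M. convergent (\<lambda>k. \<Sum>l<k. Y l \<omega>)"
  proof (rule AE_convergent_sum_nat[OF indY])
    fix a \<eta> :: real assume "a > 0" "\<eta> > 0"
    from cauchy[OF this] obtain K where K: "finite K"
      "\<And>J. finite J \<Longrightarrow> J \<inter> K = {} \<Longrightarrow> prob {\<omega> \<in> space M. \<bar>\<Sum>i\<in>J. X i \<omega>\<bar> \<ge> a} \<le> \<eta>"
      by auto
    have "\<exists>m. K \<subseteq> F m"
    proof -
      have "\<forall>i\<in>K. \<exists>m. i \<in> F m" using F(3) by auto
      then obtain f where f: "\<And>i. i \<in> K \<Longrightarrow> i \<in> F (f i)" by metis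
      have "K \<subseteq> F (Max (insert 0 (f ` K)))"
      proof
        fix i assume "i \<in> K"
        then have "f i \<le> Max (insert 0 (f ` K))" using K(1) by (intro Max_ge) auto
        then show "i \<in> F (Max (insert 0 (f ` K)))"
          using f[OF \<open>i \<in> K\<close>] F(1) by (auto simp: incseq_def)
      qed
      then show ?thesis ..
    qed
    then obtain m where m: "K \<subseteq> F m" ..
    show "\<exists>m. \<forall>j k. m \<le> j \<longrightarrow> j \<le> k \<longrightarrow> prob {\<omega> \<in> space M. \<bar>\<Sum>l\<in>{j..<k}. Y l \<omega>\<bar> \<ge> a} \<le> \<eta>"
    proof (intro exI allI impI)
      \<comment> \<open>Blocks with index above m avoid \<open>F m\<close> and hence
        \<open>K\<close>; the block with index m itself may still meet it.\<close>
      fix j k assume "Suc m \<le> j"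
      then have "(\<Union>l\<in>{j..<k}. ?D l) \<inter> K = {}" using m by (fastforce simp: disjointed_def)
      then show "prob {\<omega> \<in> space M. \<bar>\<Sum>l\<in>{j..<k}. Y l \<omega>\<bar> \<ge> a} \<le> \<eta>"
        using K(2)[of "\<Union>l\<in>{j..<k}. ?D l"] finD by (simp add: sumY)
    qed
  qed
  then show ?thesis
  proof eventually_elim
    case (elim \<omega>)
    \<comment> \<open>The blocks 0, ..., k together make up \<open>F k\<close>, hence the shift by
      one.\<close>
    have "(\<Sum>l<Suc k. Y l \<omega>) = (\<Sum>i\<in>F k. X i \<omega>)" for k
    proof -
      have "(\<Union>l\<in>{0..<Suc k}. ?D l) = (\<Union>l\<in>{0..<Suc k}. F l)" by (rule finite_UN_disjointed_eq)
      also have "\<dots> = F k" using F(1) by (fastforce simp: incseq_def less_Suc_eq_le)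
      finally show ?thesis by (simp add: sumY atLeast0LessThan del: sum.lessThan_Suc)
    qed
    then show ?case using elim convergent_Suc_iff[of "\<lambda>k. \<Sum>l<k. Y l \<omega>"] by simp
  qed
qed

end

section \<open>Weighted series of innovations\<close>

text \<open>Here \<open>\<theta>\<close> replaces beta times tau without its sign factor. This
  merged skewness also covers the limit laws that arise from coefficients of both signs.\<close>

definition stable_char :: "real \<Rightarrow> real \<Rightarrow> real \<Rightarrow> real \<Rightarrow> complex" where
  "stable_char c \<alpha> \<theta> t
    = exp (- complex_of_real (c * \<bar>t\<bar> powr \<alpha>) * (1 - \<i> * complex_of_real (\<theta> * sgn t)))"

lemma summable_on_real_comparison:
  fixes f g :: "'b \<Rightarrow> real"
  assumes "g summable_on A" "\<And>x. x \<in> A \<Longrightarrow> \<bar>f x\<bar> \<le> g x"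
  shows "f summable_on A"
proof -
  have "(\<lambda>x. norm (f x)) summable_on A"
    by (rule Infinite_Sum.abs_summable_on_comparison_test'[OF assms(1)]) (simp add: assms(2))
  then show ?thesis using summable_on_iff_abs_summable_on_real by blast
qed

lemma abs_infsum_le:
  fixes f g :: "'b \<Rightarrow> real"
  assumes "g summable_on A" "\<And>x. x \<in> A \<Longrightarrow> \<bar>f x\<bar> \<le> g x"
  shows "\<bar>infsum f A\<bar> \<le> infsum g A"
proof -
  have abs: "(\<lambda>x. norm (f x)) summable_on A"
    by (rule Infinite_Sum.abs_summable_on_comparison_test'[OF assms(1)]) (simp add: assms(2))
  then have "norm (infsum f A) \<le> infsum (\<lambda>x. norm (f x)) A" by (rule norm_infsum_bound)
  also have "\<dots> \<le> infsum g A" using assms abs by (intro infsum_mono) auto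
  finally show ?thesis by simp
qed

lemma small_outside_finite:
  fixes f :: "'b \<Rightarrow> real"
  assumes "f summable_on UNIV" "\<And>i. f i \<ge> 0" "e > 0"
  obtains K where "finite K" "\<And>J. finite J \<Longrightarrow> J \<inter> K = {} \<Longrightarrow> sum f J < e"
proof -
  have "(f has_sum infsum f UNIV) UNIV" using assms(1) by simp
  then have "eventually (\<lambda>K. dist (sum f K) (infsum f UNIV) < e) (finite_subsets_at_top UNIV)"
    unfolding has_sum_def using \<open>e > 0\<close> by (rule tendstoD)
  then obtain K where K: "finite K" "dist (sum f K) (infsum f UNIV) < e"
    unfolding eventually_finite_subsets_at_top by auto
  show ?thesis
  proof (rule that[OF K(1)])
    fix J :: "'b set" assume J: "finite J" "J \<inter> K = {}"
    have "sum f J + sum f K = sum f (J \<union> K)" using J K by (simp add: sum.union_disjoint)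
    also have "\<dots> \<le> infsum f UNIV" using assms J K by (intro finite_sum_le_infsum) auto
    finally show "sum f J < e" using K(2) by (simp add: dist_real_def)
  qed
qed

text \<open>The index type is arbitrary, exhausted by the finite sets \<open>F k\<close>; the
  lattice matters only for the increments. \<open>\<kappa>\<close> will be (c_p - c_m) tan(\<pi>
  \<alpha> / 2), or 0 if \<alpha> = 1.\<close>

locale innovations = heavy_tail +
  fixes c \<kappa> :: real and \<xi> :: "'i \<Rightarrow> 'a \<Rightarrow> real" and F :: "nat \<Rightarrow> 'i set"
  assumes c_pos: "c > 0"
    and char_near_0: "eventually (\<lambda>t. char (distr M borel X) t
      = exp (- complex_of_real (c * weight \<bar>t\<bar>) * (1 - \<i> * complex_of_real (\<kappa> * sgn t)))) (nhds 0)"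
    and indep: "indep_vars (\<lambda>_. borel) \<xi> UNIV"
    and ident: "\<And>i. distr M borel (\<xi> i) = distr M borel X"
    and F: "incseq F" "\<And>k. finite (F k)" "(\<Union>k. F k) = UNIV"
begin

lemma xi_rv [measurable]: "random_variable borel (\<xi> i)"
  using indep by (simp add: indep_vars_def)

text \<open>The expectation is the imaginary part of the characteristic function, exp(-A) sin(A
  \<kappa> sgn u) with A = c h(|u|), and |sin x| <= |x|.\<close>

lemma abs_expectation_sin_le:
  assumes "char (distr M borel X) u
      = exp (- complex_of_real (c * weight \<bar>u\<bar>) * (1 - \<i> * complex_of_real (\<kappa> * sgn u)))"
  shows "\<bar>expectation (\<lambda>\<omega>. sin (u * X \<omega>))\<bar> \<le> c * \<bar>\<kappa>\<bar> * weight \<bar>u\<bar>"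
proof -
  define A where "A = c * weight \<bar>u\<bar>"
  have "A \<ge> 0" using c_pos weight_nonneg by (simp add: A_def)
  have "expectation (\<lambda>\<omega>. sin (u * X \<omega>)) = expectation (\<lambda>\<omega>. Im (iexp (u * X \<omega>)))"
    by (simp add: Im_exp)
  also have "\<dots> = Im (CLINT \<omega>|M. iexp (u * X \<omega>))"
    by (intro integral_Im integrable_iexp) auto
  also have "(CLINT \<omega>|M. iexp (u * X \<omega>)) = char (distr M borel X) u"
    unfolding char_def by (subst integral_distr) auto
  also have "Im (char (distr M borel X) u) = exp (- A) * sin (A * (\<kappa> * sgn u))"
    unfolding assms by (simp add: Im_exp A_def)
  finally have "\<bar>expectation (\<lambda>\<omega>. sin (u * X \<omega>))\<bar> = exp (- A) * \<bar>sin (A * (\<kappa> * sgn u))\<bar>"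
    by (simp add: abs_mult)
  also have "\<dots> \<le> 1 * \<bar>A * (\<kappa> * sgn u)\<bar>"
    using \<open>A \<ge> 0\<close> by (intro mult_mono abs_sin_x_le_abs_x) auto
  also have "\<dots> \<le> A * \<bar>\<kappa>\<bar>" using \<open>A \<ge> 0\<close> by (auto simp: abs_mult sgn_if)
  finally show ?thesis by (simp add: A_def mult_ac)
qed

text \<open>The form of the characteristic function near zero has no drift term, which is why the
  truncated mean is of order h(|u|), like the clipped second moment.\<close>

lemma truncated_moments_le_weight:
  obtains C u\<^sub>0 where "C > 0" "u\<^sub>0 > 0"
    "\<And>u. \<bar>u\<bar> < u\<^sub>0 \<Longrightarrow> expectation (\<lambda>\<omega>. min ((u * X \<omega>)\<^sup>2) 1) \<le> C * weight \<bar>u\<bar>"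
    "\<And>u. \<bar>u\<bar> < u\<^sub>0 \<Longrightarrow> \<bar>expectation (\<lambda>\<omega>. unit_clamp (u * X \<omega>))\<bar> \<le> C * weight \<bar>u\<bar>"
proof -
  obtain C u\<^sub>1 where C: "C > 0" "u\<^sub>1 > 0"
    "\<And>u. \<bar>u\<bar> < u\<^sub>1 \<Longrightarrow> expectation (\<lambda>\<omega>. min ((u * X \<omega>)\<^sup>2) 1) \<le> C * weight \<bar>u\<bar>"
    using clipped_le_weight by blast
  obtain u\<^sub>2 where u2: "u\<^sub>2 > 0" "\<And>t. \<bar>t\<bar> < u\<^sub>2 \<Longrightarrow> char (distr M borel X) t
      = exp (- complex_of_real (c * weight \<bar>t\<bar>) * (1 - \<i> * complex_of_real (\<kappa> * sgn t)))"
    using char_near_0 by (auto simp: eventually_nhds_metric dist_real_def)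
  \<comment> \<open>2 C comes from comparing the clamp with the sine, c |\<kappa>| from the mean of
    the sine.\<close>
  define D where "D = 2 * C + c * \<bar>\<kappa>\<bar>"
  have D: "D > 0" "C \<le> D" using C c_pos by (auto simp: D_def add_pos_nonneg add_increasing2)
  show ?thesis
  proof (rule that[of D "min u\<^sub>1 u\<^sub>2"])
    fix u assume u: "\<bar>u\<bar> < min u\<^sub>1 u\<^sub>2"
    show "expectation (\<lambda>\<omega>. min ((u * X \<omega>)\<^sup>2) 1) \<le> D * weight \<bar>u\<bar>"
      using C(3)[of u] u D(2) weight_nonneg[of "\<bar>u\<bar>"] by (auto intro: order_trans mult_right_mono)
    have int: "integrable M (\<lambda>\<omega>. unit_clamp (u * X \<omega>))" "integrable M (\<lambda>\<omega>. sin (u * X \<omega>))"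
      "integrable M (\<lambda>\<omega>. min ((u * X \<omega>)\<^sup>2) 1)"
      using abs_unit_clamp_le by (auto intro!: integrable_const_bound[where B=1])
    have "expectation (\<lambda>\<omega>. unit_clamp (u * X \<omega>)) - expectation (\<lambda>\<omega>. sin (u * X \<omega>))
        = expectation (\<lambda>\<omega>. unit_clamp (u * X \<omega>) - sin (u * X \<omega>))"
      using int by (intro Bochner_Integration.integral_diff[symmetric])
    also have "\<bar>\<dots>\<bar> \<le> expectation (\<lambda>\<omega>. \<bar>unit_clamp (u * X \<omega>) - sin (u * X \<omega>)\<bar>)"
      by (rule integral_abs_bound)
    also have "\<dots> \<le> expectation (\<lambda>\<omega>. 2 * min ((u * X \<omega>)\<^sup>2) 1)"
      using int by (intro integral_mono abs_clamp_minus_sin_le) auto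
    also have "\<dots> \<le> 2 * (C * weight \<bar>u\<bar>)" using C(3)[of u] u by simp
    finally show "\<bar>expectation (\<lambda>\<omega>. unit_clamp (u * X \<omega>))\<bar> \<le> D * weight \<bar>u\<bar>"
      using abs_expectation_sin_le[of u] u2(2)[of u] u by (simp add: D_def algebra_simps)
  qed (use C u2 D in auto)
qed

lemma expectation_xi:
  assumes "g \<in> borel_measurable borel"
  shows "expectation (\<lambda>\<omega>. g (\<xi> i \<omega>)) = expectation (\<lambda>\<omega>. g (X \<omega>) :: real)"
proof -
  have "expectation (\<lambda>\<omega>. g (\<xi> i \<omega>)) = (LINT x|distr M borel (\<xi> i). g x)"
    using assms by (subst integral_distr) auto
  also have "\<dots> = expectation (\<lambda>\<omega>. g (X \<omega>))"
    unfolding ident using assms by (subst integral_distr) auto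
  finally show ?thesis .
qed

lemma indep_scaled: "indep_vars (\<lambda>_. borel) (\<lambda>i \<omega>. a i * \<xi> i \<omega>) UNIV"
  by (intro indep_vars_compose2[OF indep]) auto

text \<open>The constants depend on the law of the innovations only, neither on the coefficients nor
  on the number of terms. The bound serves twice: for the convergence of the series and for the
  tightness behind the existence of the stable law.\<close>

lemma prob_abs_weighted_sum_ge:
  obtains C u\<^sub>0 where "C > 0" "u\<^sub>0 > 0"
    "\<And>a J r. finite J \<Longrightarrow> (\<And>i. i \<in> J \<Longrightarrow> \<bar>a i\<bar> < u\<^sub>0) \<Longrightarrow> r > 0 \<Longrightarrow>
      prob {\<omega> \<in> space M. \<bar>\<Sum>i\<in>J. a i * \<xi> i \<omega>\<bar> \<ge> r}
        \<le> C * (\<Sum>i\<in>J. weight \<bar>a i\<bar>)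
          + (C * (\<Sum>i\<in>J. weight \<bar>a i\<bar>) + (C * (\<Sum>i\<in>J. weight \<bar>a i\<bar>))\<^sup>2) / r\<^sup>2"
proof -
  obtain C u\<^sub>0 where C: "C > 0" "u\<^sub>0 > 0"
    and le: "\<And>u. \<bar>u\<bar> < u\<^sub>0 \<Longrightarrow> expectation (\<lambda>\<omega>. min ((u * X \<omega>)\<^sup>2) 1) \<le> C * weight \<bar>u\<bar>"
    "\<And>u. \<bar>u\<bar> < u\<^sub>0 \<Longrightarrow> \<bar>expectation (\<lambda>\<omega>. unit_clamp (u * X \<omega>))\<bar> \<le> C * weight \<bar>u\<bar>"
    using truncated_moments_le_weight by blast
  show ?thesis
  proof (rule that[OF C])
    fix a :: "'i \<Rightarrow> real" and J and r :: real
    assume J: "finite J" "\<And>i. i \<in> J \<Longrightarrow> \<bar>a i\<bar> < u\<^sub>0" and r: "r > 0"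
    let ?s = "\<Sum>i\<in>J. weight \<bar>a i\<bar>"
    have "(\<Sum>i\<in>J. expectation (\<lambda>\<omega>. min ((a i * \<xi> i \<omega>)\<^sup>2) 1)) \<le> (\<Sum>i\<in>J. C * weight \<bar>a i\<bar>)"
      using J le(1) by (intro sum_mono) (subst expectation_xi[of "\<lambda>x. min ((_ * x)\<^sup>2) 1"], auto)
    then have 1: "(\<Sum>i\<in>J. expectation (\<lambda>\<omega>. min ((a i * \<xi> i \<omega>)\<^sup>2) 1)) \<le> C * ?s"
      by (simp add: sum_distrib_left)
    have "(\<Sum>i\<in>J. \<bar>expectation (\<lambda>\<omega>. unit_clamp (a i * \<xi> i \<omega>))\<bar>) \<le> (\<Sum>i\<in>J. C * weight \<bar>a i\<bar>)"
      using J le(2) by (intro sum_mono) (subst expectation_xi[of "\<lambda>x. unit_clamp (_ * x)"], auto)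
    then have 2: "(\<Sum>i\<in>J. \<bar>expectation (\<lambda>\<omega>. unit_clamp (a i * \<xi> i \<omega>))\<bar>)\<^sup>2 \<le> (C * ?s)\<^sup>2"
      by (intro power_mono) (auto simp: sum_distrib_left intro: sum_nonneg)
    have "prob {\<omega> \<in> space M. \<bar>\<Sum>i\<in>J. a i * \<xi> i \<omega>\<bar> \<ge> r}
      \<le> (\<Sum>i\<in>J. expectation (\<lambda>\<omega>. min ((a i * \<xi> i \<omega>)\<^sup>2) 1))
      + ((\<Sum>i\<in>J. expectation (\<lambda>\<omega>. min ((a i * \<xi> i \<omega>)\<^sup>2) 1))
         + (\<Sum>i\<in>J. \<bar>expectation (\<lambda>\<omega>. unit_clamp (a i * \<xi> i \<omega>))\<bar>)\<^sup>2) / r\<^sup>2"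
      by (rule prob_abs_sum_ge_le[OF indep_scaled J(1) r])
    also have "\<dots> \<le> C * ?s + (C * ?s + (C * ?s)\<^sup>2) / r\<^sup>2"
      using 1 2 by (intro add_mono divide_right_mono) auto
    finally show "prob {\<omega> \<in> space M. \<bar>\<Sum>i\<in>J. a i * \<xi> i \<omega>\<bar> \<ge> r}
      \<le> C * ?s + (C * ?s + (C * ?s)\<^sup>2) / r\<^sup>2" .
  qed
qed

lemma AE_convergent_series:
  assumes "(\<lambda>i. weight \<bar>a i\<bar>) summable_on UNIV"
  shows "AE \<omega> in M. convergent (\<lambda>k. \<Sum>i\<in>F k. a i * \<xi> i \<omega>)"
proof (rule AE_convergent_sum[OF indep_scaled F])
  fix r \<eta> :: real assume r: "r > 0" and \<eta>: "\<eta> > 0"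
  obtain C u\<^sub>0 where C: "C > 0" "u\<^sub>0 > 0"
    and le: "\<And>a J r. finite J \<Longrightarrow> (\<And>i. i \<in> J \<Longrightarrow> \<bar>a i\<bar> < u\<^sub>0) \<Longrightarrow> r > 0 \<Longrightarrow>
      prob {\<omega> \<in> space M. \<bar>\<Sum>i\<in>J. a i * \<xi> i \<omega>\<bar> \<ge> r}
        \<le> C * (\<Sum>i\<in>J. weight \<bar>a i\<bar>)
          + (C * (\<Sum>i\<in>J. weight \<bar>a i\<bar>) + (C * (\<Sum>i\<in>J. weight \<bar>a i\<bar>))\<^sup>2) / r\<^sup>2"
    using prob_abs_weighted_sum_ge by blast
  obtain m where m: "m > 0" "\<And>u. u \<ge> u\<^sub>0 \<Longrightarrow> weight u \<ge> m"
    using weight_lower[OF C(2)] by blast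
  have "((\<lambda>s. C * s + (C * s + (C * s)\<^sup>2) / r\<^sup>2) \<longlongrightarrow> C * 0 + (C * 0 + (C * 0)\<^sup>2) / r\<^sup>2) (at_right 0)"
    using r by (intro tendsto_intros) auto
  then have "eventually (\<lambda>s. C * s + (C * s + (C * s)\<^sup>2) / r\<^sup>2 < \<eta>) (at_right 0)"
    using \<eta> by (intro order_tendstoD) auto
  then have "eventually (\<lambda>s. C * s + (C * s + (C * s)\<^sup>2) / r\<^sup>2 < \<eta> \<and> 0 < s) (at_right 0)"
    by (intro eventually_conj eventually_at_right_less)
  then obtain s where s: "C * s + (C * s + (C * s)\<^sup>2) / r\<^sup>2 < \<eta>" "0 < s"
    using eventually_happens[of _ "at_right (0::real)"] by auto
  \<comment> \<open>Below s the probability bound stays under \<open>\<eta>\<close>; below m no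
    single weight can belong to a coefficient of size \<open>u\<^sub>0\<close> or more.\<close>
  obtain K where K: "finite K"
    "\<And>J. finite J \<Longrightarrow> J \<inter> K = {} \<Longrightarrow> (\<Sum>i\<in>J. weight \<bar>a i\<bar>) < min s m"
    using small_outside_finite[OF assms, of "min s m"] weight_nonneg m s by auto
  show "\<exists>K. finite K \<and> (\<forall>J. finite J \<longrightarrow> J \<inter> K = {} \<longrightarrow>
      prob {\<omega> \<in> space M. r \<le> \<bar>\<Sum>i\<in>J. a i * \<xi> i \<omega>\<bar>} \<le> \<eta>)"
  proof (intro exI conjI allI impI)
    fix J assume J: "finite J" "J \<inter> K = {}"
    let ?s = "\<Sum>i\<in>J. weight \<bar>a i\<bar>"
    have "0 \<le> ?s" "?s \<le> s" using K(2)[OF J] weight_nonneg by (auto intro: sum_nonneg)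
    have "\<bar>a i\<bar> < u\<^sub>0" if "i \<in> J" for i
    proof (rule ccontr)
      assume "\<not> \<bar>a i\<bar> < u\<^sub>0"
      then have "m \<le> weight \<bar>a i\<bar>" using m by simp
      moreover have "weight \<bar>a i\<bar> < m" using K(2)[of "{i}"] that J by auto
      ultimately show False by simp
    qed
    then have "prob {\<omega> \<in> space M. r \<le> \<bar>\<Sum>i\<in>J. a i * \<xi> i \<omega>\<bar>}
        \<le> C * ?s + (C * ?s + (C * ?s)\<^sup>2) / r\<^sup>2" using J r by (intro le) auto
    also have "\<dots> \<le> C * s + (C * s + (C * s)\<^sup>2) / r\<^sup>2"
      using \<open>0 \<le> ?s\<close> \<open>?s \<le> s\<close> C by (intro add_mono divide_right_mono mult_left_mono power_mono) auto
    finally show "prob {\<omega> \<in> space M. r \<le> \<bar>\<Sum>i\<in>J. a i * \<xi> i \<omega>\<bar>} \<le> \<eta>" using s by simp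
  qed (use K in auto)
qed

abbreviation series :: "('i \<Rightarrow> real) \<Rightarrow> 'a \<Rightarrow> real" where
  "series a \<equiv> series_sum F (\<lambda>i \<omega>. a i * \<xi> i \<omega>)"

lemma series_measurable [measurable]: "random_variable borel (series a)"
  unfolding series_sum_def[abs_def] by (rule borel_measurable_lim_metric) measurable

lemma AE_series:
  assumes "(\<lambda>i. weight \<bar>a i\<bar>) summable_on UNIV"
  shows "AE \<omega> in M. (\<lambda>k. \<Sum>i\<in>F k. a i * \<xi> i \<omega>) \<longlonglongrightarrow> series a \<omega>"
  using AE_convergent_series[OF assms] by (simp add: series_sum_def convergent_LIMSEQ_iff)

text \<open>The sets \<open>F k\<close> are cofinal among the finite sets, so unordered sums over
  all indices are limits along \<open>F\<close>.\<close>

lemma F_tendsto: "filterlim F (finite_subsets_at_top UNIV) sequentially"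
  unfolding filterlim_iff eventually_finite_subsets_at_top
proof (intro allI impI, elim exE conjE)
  fix P :: "'i set \<Rightarrow> bool" and K :: "'i set"
  assume K: "finite K" "K \<subseteq> UNIV" "\<forall>Y. finite Y \<and> K \<subseteq> Y \<and> Y \<subseteq> UNIV \<longrightarrow> P Y"
  have "\<forall>i. \<exists>m. i \<in> F m" using F(3) by auto
  then obtain f where f: "\<And>i. i \<in> F (f i)" by metis
  have "eventually (\<lambda>k. \<forall>i\<in>K. k \<ge> f i) sequentially"
    using K(1) by (simp add: eventually_ball_finite_distrib eventually_ge_at_top)
  then show "eventually (\<lambda>k. P (F k)) sequentially"
  proof eventually_elim
    case (elim k)
    then have "K \<subseteq> F k" using f F(1) by (meson incseqD subset_iff)
    then show ?case using K F(2) by auto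
  qed
qed

text \<open>Every factor is the exponential of an explicit exponent, so the exponents add without
  any choice of a logarithm. They converge absolutely, even where the random series does
  not.\<close>

lemma char_series:
  assumes "(\<lambda>i. weight \<bar>a i\<bar>) summable_on UNIV"
    and t: "(\<lambda>i. weight \<bar>t * a i\<bar>) summable_on UNIV"
    and small: "\<And>i. char (distr M borel X) (t * a i) = exp (- complex_of_real (c * weight \<bar>t * a i\<bar>)
      * (1 - \<i> * complex_of_real (\<kappa> * sgn (t * a i))))"
  shows "char (distr M borel (series a)) t
    = exp (- complex_of_real (c * (\<Sum>\<^sub>\<infinity>i. weight \<bar>t * a i\<bar>))
        + \<i> * complex_of_real (c * \<kappa> * sgn t * (\<Sum>\<^sub>\<infinity>i. weight \<bar>t * a i\<bar> * sgn (a i))))"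
proof (rule LIMSEQ_unique)
  let ?P = "\<lambda>k \<omega>. \<Sum>i\<in>F k. a i * \<xi> i \<omega>"
  have "(\<lambda>k. CLINT \<omega>|M. iexp (t * ?P k \<omega>)) \<longlonglongrightarrow> (CLINT \<omega>|M. iexp (t * series a \<omega>))"
  proof (rule integral_dominated_convergence[where w="\<lambda>_. 1"])
    show "AE \<omega> in M. (\<lambda>k. iexp (t * ?P k \<omega>)) \<longlonglongrightarrow> iexp (t * series a \<omega>)"
      using AE_series[OF assms(1)] by eventually_elim (intro tendsto_intros)
  qed auto
  then show "(\<lambda>k. char (distr M borel (?P k)) t) \<longlonglongrightarrow> char (distr M borel (series a)) t"
    unfolding char_def by (subst (1 2) integral_distr) auto
  define w where "w i = weight \<bar>t * a i\<bar>" for i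
  define g where "g i = weight \<bar>t * a i\<bar> * sgn (a i)" for i
  have w: "w summable_on UNIV" using t by (simp add: w_def[abs_def])
  have g: "g summable_on UNIV"
    by (rule summable_on_real_comparison[OF w])
       (auto simp: g_def w_def abs_mult sgn_if weight_nonneg)
  have "char (distr M borel (?P k)) t = exp (- complex_of_real (c * sum w (F k))
      + \<i> * complex_of_real (c * \<kappa> * sgn t * sum g (F k)))" for k
  proof -
    have "char (distr M borel (?P k)) t = (\<Prod>i\<in>F k. char (distr M borel (\<lambda>\<omega>. a i * \<xi> i \<omega>)) t)"
      by (intro char_distr_sum indep_vars_subset[OF indep_scaled]) auto
    also have "\<dots> = (\<Prod>i\<in>F k. char (distr M borel X) (t * a i))"
    proof (intro prod.cong refl)
      fix i
      have "char (distr M borel (\<lambda>\<omega>. a i * \<xi> i \<omega>)) t = char (distr M borel (\<xi> i)) (t * a i)"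
        unfolding char_def by (subst (1 2) integral_distr) (auto simp: mult_ac)
      then show "char (distr M borel (\<lambda>\<omega>. a i * \<xi> i \<omega>)) t = char (distr M borel X) (t * a i)"
        by (simp add: ident)
    qed
    also have "\<dots> = (\<Prod>i\<in>F k. exp (- complex_of_real (c * w i)
        + \<i> * complex_of_real (c * \<kappa> * sgn t * g i)))"
      unfolding small by (intro prod.cong refl) (simp add: w_def g_def sgn_mult algebra_simps)
    also have "\<dots> = exp (\<Sum>i\<in>F k. - complex_of_real (c * w i)
        + \<i> * complex_of_real (c * \<kappa> * sgn t * g i))"
      using F(2) by (simp add: exp_sum)
    also have "(\<Sum>i\<in>F k. - complex_of_real (c * w i) + \<i> * complex_of_real (c * \<kappa> * sgn t * g i))
        = - complex_of_real (c * sum w (F k)) + \<i> * complex_of_real (c * \<kappa> * sgn t * sum g (F k))"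
      by (simp add: sum.distrib sum_negf sum_subtractf sum_distrib_left)
    finally show ?thesis .
  qed
  then have eq: "(\<lambda>k. char (distr M borel (?P k)) t) = (\<lambda>k. exp (- complex_of_real (c * sum w (F k))
      + \<i> * complex_of_real (c * \<kappa> * sgn t * sum g (F k))))" by (rule ext)
  have lim: "(\<lambda>k. sum w (F k)) \<longlonglongrightarrow> infsum w UNIV" "(\<lambda>k. sum g (F k)) \<longlonglongrightarrow> infsum g UNIV"
    using w g F_tendsto by (auto intro: filterlim_compose[OF infsum_tendsto])
  show "(\<lambda>k. char (distr M borel (?P k)) t) \<longlonglongrightarrow>
      exp (- complex_of_real (c * (\<Sum>\<^sub>\<infinity>i. weight \<bar>t * a i\<bar>))
        + \<i> * complex_of_real (c * \<kappa> * sgn t * (\<Sum>\<^sub>\<infinity>i. weight \<bar>t * a i\<bar> * sgn (a i))))"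
    unfolding eq g_def[symmetric] unfolding w_def[symmetric] by (intro tendsto_intros lim)
qed

end

section \<open>Stable limits\<close>

lemma infsum_diff_scaled:
  fixes f g :: "'b \<Rightarrow> real"
  assumes "f summable_on A" "g summable_on A"
  shows "infsum f A - r * infsum g A = (\<Sum>\<^sub>\<infinity>x\<in>A. f x - r * g x)"
  using infsum_add[OF assms(1) summable_on_cmult_right[OF assms(2), of "- r"]]
  by (simp add: infsum_cmult_right' infsum_uminus)

lemma norm_stable_char: "norm (stable_char c \<alpha> \<theta> t) = exp (- c * \<bar>t\<bar> powr \<alpha>)"
  by (simp add: stable_char_def)

lemma char_affine_pair:
  assumes "real_distribution \<mu>" "real_distribution \<nu>"
  shows "char (distr (\<mu> \<Otimes>\<^sub>M \<nu>) borel (\<lambda>(x, y). a * x + b * y)) t = char \<mu> (a * t) * char \<nu> (b * t)"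
proof -
  interpret \<mu>: real_distribution \<mu> by fact
  interpret \<nu>: real_distribution \<nu> by fact
  interpret pair_prob_space \<mu> \<nu> ..
  have "char (distr (\<mu> \<Otimes>\<^sub>M \<nu>) borel (\<lambda>(x, y). a * x + b * y)) t
      = (CLINT z|\<mu> \<Otimes>\<^sub>M \<nu>. iexp (t * (a * fst z + b * snd z)))"
    unfolding char_def by (subst integral_distr) (auto simp: case_prod_beta)
  also have "\<dots> = (CLINT x|\<mu>. CLINT y|\<nu>. iexp (t * (a * x + b * y)))"
    by (subst integral_fst'[symmetric]) (auto intro!: P.integrable_iexp)
  also have "\<dots> = (CLINT x|\<mu>. CLINT y|\<nu>. iexp (a * t * x) * iexp (b * t * y))"
    by (simp add: exp_add[symmetric] algebra_simps)
  also have "\<dots> = char \<mu> (a * t) * char \<nu> (b * t)"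
    by (simp add: char_def)
  finally show ?thesis .
qed

text \<open>The exponent is homogeneous of degree \<alpha> under positive scaling, so the law is
  strictly stable and \<open>D = 0\<close> will do. It is not degenerate, since a point mass has a
  characteristic function of modulus 1.\<close>

lemma alpha_stable_of_char:
  assumes \<mu>: "real_distribution \<mu>" and ch: "\<And>t. char \<mu> t = stable_char c \<alpha> \<theta> t"
    and "c > 0" "\<alpha> > 0"
  shows "alpha_stable \<alpha> \<mu>"
  unfolding alpha_stable_def
proof (intro conjI allI impI)
  interpret \<mu>: real_distribution \<mu> by fact
  show "real_distribution \<mu>" by fact
  show "\<not> (\<exists>m. AE x in \<mu>. x = m)"
  proof
    assume "\<exists>m. AE x in \<mu>. x = m"
    then obtain m where m: "AE x in \<mu>. x = m" ..
    have "char \<mu> 1 = (CLINT x|\<mu>. iexp m)"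
      unfolding char_def using m by (intro integral_cong_AE) auto
    then have "norm (char \<mu> 1) = 1" using \<mu>.prob_space by simp
    then show False using \<open>c > 0\<close> by (simp add: ch norm_stable_char)
  qed
  fix a b :: real assume ab: "a > 0" "b > 0"
  define r where "r = (a powr \<alpha> + b powr \<alpha>) powr (1 / \<alpha>)"
  have r: "r > 0" "r powr \<alpha> = a powr \<alpha> + b powr \<alpha>"
  proof -
    have "a powr \<alpha> + b powr \<alpha> > 0" using ab by (intro add_pos_pos) auto
    then show "r > 0" "r powr \<alpha> = a powr \<alpha> + b powr \<alpha>"
      using \<open>\<alpha> > 0\<close> by (auto simp: r_def powr_powr)
  qed
  have eq: "distr (\<mu> \<Otimes>\<^sub>M \<mu>) borel (\<lambda>(x, y). a * x + b * y) = distr \<mu> borel (\<lambda>x. r * x)"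
  proof (rule Levy_uniqueness)
    interpret pair_prob_space \<mu> \<mu> ..
    show "real_distribution (distr (\<mu> \<Otimes>\<^sub>M \<mu>) borel (\<lambda>(x, y). a * x + b * y))"
      by (intro P.real_distribution_distr) auto
    show "real_distribution (distr \<mu> borel (\<lambda>x. r * x))"
      by (intro \<mu>.real_distribution_distr) auto
    show "char (distr (\<mu> \<Otimes>\<^sub>M \<mu>) borel (\<lambda>(x, y). a * x + b * y)) = char (distr \<mu> borel (\<lambda>x. r * x))"
    proof
      fix t
      have "char (distr \<mu> borel (\<lambda>x. r * x)) t = char \<mu> (r * t)"
        unfolding char_def by (subst integral_distr) (auto simp: mult_ac)
      also have "\<dots> = char \<mu> (a * t) * char \<mu> (b * t)"
        unfolding ch stable_char_def exp_add[symmetric] using ab r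
        by (simp add: abs_mult powr_mult sgn_mult algebra_simps)
      also have "\<dots> = char (distr (\<mu> \<Otimes>\<^sub>M \<mu>) borel (\<lambda>(x, y). a * x + b * y)) t"
        by (rule char_affine_pair[OF \<mu> \<mu>, symmetric])
      finally show "char (distr (\<mu> \<Otimes>\<^sub>M \<mu>) borel (\<lambda>(x, y). a * x + b * y)) t
        = char (distr \<mu> borel (\<lambda>x. r * x)) t" by simp
    qed
  qed
  show "\<exists>D. distr (\<mu> \<Otimes>\<^sub>M \<mu>) borel (\<lambda>(x, y). a * x + b * y) =
      distr \<mu> borel (\<lambda>x. (a powr \<alpha> + b powr \<alpha>) powr (1 / \<alpha>) * x + D)"
    by (rule exI[of _ 0]) (simp add: eq r_def)
qed

text \<open>Each single distribution is tight, so the radius valid for all large n only has to be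
  enlarged to cover finitely many exceptions.\<close>

lemma tightI_eventually:
  assumes \<mu>: "\<And>n. real_distribution (\<mu> n)"
    and ev: "\<And>e. e > 0 \<Longrightarrow> \<exists>r. eventually (\<lambda>n. measure (\<mu> n) {x. \<bar>x\<bar> \<ge> r} < e) sequentially"
  shows "tight \<mu>"
  unfolding tight_def
proof (intro conjI allI impI \<mu>)
  fix e :: real assume "e > 0"
  then obtain r N where N: "\<And>n. n \<ge> N \<Longrightarrow> measure (\<mu> n) {x. \<bar>x\<bar> \<ge> r} < e"
    using ev[of e] by (auto simp: eventually_sequentially)
  have ex: "\<exists>s. measure (\<mu> n) {x. \<bar>x\<bar> \<ge> s} < e" for n
  proof -
    interpret real_distribution "\<mu> n" by fact
    have "(\<lambda>k. prob {x. \<bar>x\<bar> \<ge> real k}) \<longlonglongrightarrow> prob (\<Inter>k. {x. \<bar>x\<bar> \<ge> real k})"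
      by (intro finite_Lim_measure_decseq) (auto simp: decseq_def)
    also have "(\<Inter>k. {x. \<bar>x\<bar> \<ge> real k}) = ({} :: real set)"
    proof -
      have "\<exists>k. \<not> \<bar>x\<bar> \<ge> real k" for x :: real
        using reals_Archimedean2[of "\<bar>x\<bar>"] by (auto simp: not_le)
      then show ?thesis by auto
    qed
    finally have "eventually (\<lambda>k. prob {x. \<bar>x\<bar> \<ge> real k} < e) sequentially"
      using \<open>e > 0\<close> by (intro order_tendstoD(2)) auto
    then show ?thesis by (auto simp: eventually_sequentially)
  qed
  then obtain s where s: "\<And>n. measure (\<mu> n) {x. \<bar>x\<bar> \<ge> s n} < e" by metis
  define R where "R = Max (insert 1 (insert r (s ` {..<N})))"
  have R: "R \<ge> x" if "x \<in> insert 1 (insert r (s ` {..<N}))" for x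
    unfolding R_def using that by (intro Max_ge) auto
  have "R \<ge> 1" "R \<ge> r" and Rs: "\<And>n. n < N \<Longrightarrow> R \<ge> s n" by (auto intro!: R)
  show "\<exists>a b. a < b \<and> (\<forall>n. 1 - e < measure (\<mu> n) {a<..b})"
  proof (intro exI conjI allI)
    show "- R < R" using \<open>R \<ge> 1\<close> by simp
    fix n
    interpret real_distribution "\<mu> n" by fact
    have "prob {x. \<bar>x\<bar> \<ge> R} < e"
    proof (cases "n < N")
      case True
      have "prob {x. \<bar>x\<bar> \<ge> R} \<le> prob {x. \<bar>x\<bar> \<ge> s n}"
        using Rs[OF True] by (intro finite_measure_mono) auto
      then show ?thesis using s[of n] by simp
    next
      case False
      have "prob {x. \<bar>x\<bar> \<ge> R} \<le> prob {x. \<bar>x\<bar> \<ge> r}"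
        using \<open>R \<ge> r\<close> by (intro finite_measure_mono) auto
      then show ?thesis using N[of n] False by simp
    qed
    moreover have "prob (UNIV - {x. \<bar>x\<bar> \<ge> R}) \<le> prob {- R<..R}"
      by (intro finite_measure_mono) auto
    moreover have "prob (space (\<mu> n) - {x. \<bar>x\<bar> \<ge> R}) = 1 - prob {x. \<bar>x\<bar> \<ge> R}"
      by (intro prob_compl) auto
    ultimately show "1 - e < prob {- R<..R}" by simp
  qed
qed

context heavy_tail
begin

text \<open>The ratio limit in the form of a relative error for each term, trivial at u = 0, so that
  it can be summed over all coefficients at once.\<close>

lemma weight_ratio_uniform:
  assumes "r > 0" "e > 0"
  obtains u\<^sub>0 where "u\<^sub>0 > 0"
    "\<And>u. 0 \<le> u \<Longrightarrow> u < u\<^sub>0 \<Longrightarrow> \<bar>weight (r * u) - r powr \<alpha> * weight u\<bar> \<le> e * weight u"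
proof -
  have "eventually (\<lambda>u. dist (weight (r * u) / weight u) (r powr \<alpha>) < e) (at_right 0)"
    using weight_ratio[OF assms(1)] assms(2) by (rule tendstoD)
  then obtain u\<^sub>0 where u0: "u\<^sub>0 > 0"
    "\<And>u. 0 < u \<Longrightarrow> u < u\<^sub>0 \<Longrightarrow> dist (weight (r * u) / weight u) (r powr \<alpha>) < e"
    by (auto simp: eventually_at_right_field)
  show ?thesis
  proof (rule that[OF u0(1)])
    fix u assume u: "0 \<le> u" "u < u\<^sub>0"
    show "\<bar>weight (r * u) - r powr \<alpha> * weight u\<bar> \<le> e * weight u"
    proof (cases "u = 0")
      case False
      then have w: "weight u > 0" using u by (intro weight_pos) auto
      have "weight (r * u) - r powr \<alpha> * weight u = (weight (r * u) / weight u - r powr \<alpha>) * weight u"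
        using w by (simp add: field_simps)
      also have "\<bar>\<dots>\<bar> = \<bar>weight (r * u) / weight u - r powr \<alpha>\<bar> * weight u"
        using w by (simp add: abs_mult)
      also have "\<dots> \<le> e * weight u"
        using u0(2)[of u] u False w by (intro mult_right_mono) (auto simp: dist_real_def)
      finally show ?thesis .
    qed simp
  qed
qed

end

section \<open>Limits of characteristic functions and existence of the stable law\<close>

context innovations
begin

text \<open>For uniformly small coefficients h(|t a|) is |t|^\<alpha> h(|a|) up to a small relative
  error, and the error of the sums is that fraction of the total weight. The factor
  \<open>\<kappa>\<close> stays inside the assumption on the signed sums, so that
  \<open>\<kappa> = 0\<close> makes no demand on them.\<close>

lemma char_series_tendsto:
  assumes summ: "eventually (\<lambda>n. (\<lambda>i. weight \<bar>a n i\<bar>) summable_on UNIV) sequentially"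
    and small: "\<And>e. e > 0 \<Longrightarrow> eventually (\<lambda>n. \<forall>i. \<bar>a n i\<bar> < e) sequentially"
    and W: "(\<lambda>n. \<Sum>\<^sub>\<infinity>i. weight \<bar>a n i\<bar>) \<longlonglongrightarrow> 1"
    and G: "(\<lambda>n. \<kappa> * (\<Sum>\<^sub>\<infinity>i. weight \<bar>a n i\<bar> * sgn (a n i))) \<longlonglongrightarrow> \<theta>"
  shows "(\<lambda>n. char (distr M borel (series (a n))) t) \<longlonglongrightarrow> stable_char c \<alpha> \<theta> t"
proof (cases "t = 0")
  case True
  have "char (distr M borel (series (a n))) 0 = 1" for n
    by (intro real_distribution.char_zero real_distribution_distr) measurable
  then show ?thesis using True \<alpha> by (simp add: stable_char_def)
next
  case False
  define r where "r = \<bar>t\<bar>"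
  have r: "r > 0" using False by (simp add: r_def)
  define w where "w n i = weight \<bar>a n i\<bar>" for n i
  define g where "g n i = weight \<bar>a n i\<bar> * sgn (a n i)" for n i
  define w' where "w' n i = weight \<bar>t * a n i\<bar>" for n i
  define g' where "g' n i = weight \<bar>t * a n i\<bar> * sgn (a n i)" for n i
  have W_w: "(\<lambda>n. infsum (w n) UNIV) \<longlonglongrightarrow> 1" using W by (simp add: w_def[abs_def])
  have G_g: "(\<lambda>n. \<kappa> * infsum (g n) UNIV) \<longlonglongrightarrow> \<theta>" using G by (simp add: g_def[abs_def])
  have w'_eq: "w' n i = weight (r * \<bar>a n i\<bar>)" for n i by (simp add: w'_def r_def abs_mult)
  have key: "eventually (\<lambda>n. w' n summable_on UNIV
      \<and> \<bar>infsum (w' n) UNIV - r powr \<alpha> * infsum (w n) UNIV\<bar> \<le> e * infsum (w n) UNIV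
      \<and> \<bar>infsum (g' n) UNIV - r powr \<alpha> * infsum (g n) UNIV\<bar> \<le> e * infsum (w n) UNIV) sequentially"
    if "e > 0" for e
  proof -
    obtain u\<^sub>0 where u0: "u\<^sub>0 > 0"
      "\<And>u. 0 \<le> u \<Longrightarrow> u < u\<^sub>0 \<Longrightarrow> \<bar>weight (r * u) - r powr \<alpha> * weight u\<bar> \<le> e * weight u"
      using weight_ratio_uniform[OF r \<open>e > 0\<close>] by blast
    show ?thesis
      using summ small[OF u0(1)]
    proof eventually_elim
      case (elim n)
      have w: "w n summable_on UNIV" using elim by (simp add: w_def[abs_def])
      have d: "\<bar>w' n i - r powr \<alpha> * w n i\<bar> \<le> e * w n i" for i
        using u0(2)[of "\<bar>a n i\<bar>"] elim by (simp add: w'_eq w_def)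
      have w0: "w n i \<ge> 0" "w' n i \<ge> 0" for i by (simp_all add: w_def w'_def weight_nonneg)
      have w': "w' n summable_on UNIV"
      proof (rule summable_on_real_comparison)
        show "(\<lambda>i. (r powr \<alpha> + e) * w n i) summable_on UNIV" by (rule summable_on_cmult_right[OF w])
        show "\<bar>w' n i\<bar> \<le> (r powr \<alpha> + e) * w n i" for i
          using d[of i] w0[of i] by (simp add: algebra_simps)
      qed
      have g: "g n summable_on UNIV" "g' n summable_on UNIV"
        by (rule summable_on_real_comparison[OF w],
            simp add: g_def w_def abs_mult sgn_if weight_nonneg,
            rule summable_on_real_comparison[OF w'],
            simp add: g'_def w'_def abs_mult sgn_if weight_nonneg)
      have ew: "(\<lambda>i. e * w n i) summable_on UNIV" by (rule summable_on_cmult_right[OF w])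
      have "infsum (w' n) UNIV - r powr \<alpha> * infsum (w n) UNIV
          = (\<Sum>\<^sub>\<infinity>i. w' n i - r powr \<alpha> * w n i)"
        by (rule infsum_diff_scaled[OF w' w])
      also have "\<bar>\<dots>\<bar> \<le> (\<Sum>\<^sub>\<infinity>i. e * w n i)" using d by (intro abs_infsum_le ew)
      finally have 1: "\<bar>infsum (w' n) UNIV - r powr \<alpha> * infsum (w n) UNIV\<bar> \<le> e * infsum (w n) UNIV"
        by (simp add: infsum_cmult_right')
      have "infsum (g' n) UNIV - r powr \<alpha> * infsum (g n) UNIV
          = (\<Sum>\<^sub>\<infinity>i. g' n i - r powr \<alpha> * g n i)"
        by (rule infsum_diff_scaled[OF g(2,1)])
      also have "\<bar>\<dots>\<bar> \<le> (\<Sum>\<^sub>\<infinity>i. e * w n i)"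
      proof (intro abs_infsum_le ew)
        fix i
        have "g' n i - r powr \<alpha> * g n i = (w' n i - r powr \<alpha> * w n i) * sgn (a n i)"
          by (simp add: g_def g'_def w_def w'_def algebra_simps)
        also have "\<bar>\<dots>\<bar> \<le> \<bar>w' n i - r powr \<alpha> * w n i\<bar>" by (auto simp: abs_mult sgn_if)
        finally show "\<bar>g' n i - r powr \<alpha> * g n i\<bar> \<le> e * w n i" using d[of i] by linarith
      qed
      finally show ?case using 1 w' by (simp add: infsum_cmult_right')
    qed
  qed
  \<comment> \<open>The total weight tends to 1 and is eventually below 2, which turns relative
    errors into absolute ones.\<close>
  have lim: "(\<lambda>n. X n) \<longlonglongrightarrow> 0"
    if "\<And>e. e > 0 \<Longrightarrow> eventually (\<lambda>n. \<bar>X n\<bar> \<le> e * infsum (w n) UNIV) sequentially" for X :: "nat \<Rightarrow> real"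
  proof (rule tendstoI)
    fix e :: real assume "e > 0"
    have "eventually (\<lambda>n. infsum (w n) UNIV < 2) sequentially"
      by (intro order_tendstoD(2)[OF W_w]) simp
    moreover have "eventually (\<lambda>n. \<bar>X n\<bar> \<le> e / 2 * infsum (w n) UNIV) sequentially"
      using that[of "e / 2"] \<open>e > 0\<close> by simp
    ultimately show "eventually (\<lambda>n. dist (X n) 0 < e) sequentially"
    proof eventually_elim
      case (elim n)
      have "e / 2 * infsum (w n) UNIV < e / 2 * 2"
        using elim(1) \<open>e > 0\<close> by (intro mult_strict_left_mono) auto
      with elim(2) show ?case by (simp add: dist_real_def)
    qed
  qed
  have "(\<lambda>n. infsum (w' n) UNIV - r powr \<alpha> * infsum (w n) UNIV) \<longlonglongrightarrow> 0"
    by (rule lim, rule eventually_mono[OF key]) auto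
  then have "(\<lambda>n. (infsum (w' n) UNIV - r powr \<alpha> * infsum (w n) UNIV) + r powr \<alpha> * infsum (w n) UNIV)
      \<longlonglongrightarrow> 0 + r powr \<alpha> * 1"
    by (intro tendsto_intros W_w)
  then have W': "(\<lambda>n. infsum (w' n) UNIV) \<longlonglongrightarrow> r powr \<alpha>" by simp
  have "(\<lambda>n. infsum (g' n) UNIV - r powr \<alpha> * infsum (g n) UNIV) \<longlonglongrightarrow> 0"
    by (rule lim, rule eventually_mono[OF key]) auto
  then have "(\<lambda>n. \<kappa> * (infsum (g' n) UNIV - r powr \<alpha> * infsum (g n) UNIV)
      + r powr \<alpha> * (\<kappa> * infsum (g n) UNIV)) \<longlonglongrightarrow> \<kappa> * 0 + r powr \<alpha> * \<theta>"
    by (intro tendsto_intros G_g)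
  then have G': "(\<lambda>n. \<kappa> * infsum (g' n) UNIV) \<longlonglongrightarrow> r powr \<alpha> * \<theta>" by (simp add: algebra_simps)
  obtain \<delta> where \<delta>: "\<delta> > 0" "\<And>t. \<bar>t\<bar> < \<delta> \<Longrightarrow> char (distr M borel X) t
      = exp (- complex_of_real (c * weight \<bar>t\<bar>) * (1 - \<i> * complex_of_real (\<kappa> * sgn t)))"
    using char_near_0 by (auto simp: eventually_nhds_metric dist_real_def)
  \<comment> \<open>Coefficients below \<delta> / |t| put every product with t into the
    neighbourhood where the form of the characteristic function is known.\<close>
  have "\<delta> / r > 0" using \<delta> r by simp
  have "eventually (\<lambda>n. exp (- complex_of_real (c * infsum (w' n) UNIV)
      + \<i> * complex_of_real (c * sgn t * (\<kappa> * infsum (g' n) UNIV)))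
      = char (distr M borel (series (a n))) t) sequentially"
    using summ small[OF \<open>\<delta> / r > 0\<close>] key[OF zero_less_one]
  proof eventually_elim
    case (elim n)
    have s: "\<bar>t * a n i\<bar> < \<delta>" for i
      using elim r by (simp add: abs_mult r_def field_simps)
    have "char (distr M borel (series (a n))) t = exp (- complex_of_real (c * infsum (w' n) UNIV)
      + \<i> * complex_of_real (c * \<kappa> * sgn t * infsum (g' n) UNIV))"
      unfolding w'_def g'_def using elim \<delta>(2)[OF s]
      by (intro char_series) (auto simp: w'_def[abs_def])
    then show ?case by (simp add: mult_ac)
  qed
  moreover have "(\<lambda>n. exp (- complex_of_real (c * infsum (w' n) UNIV)
      + \<i> * complex_of_real (c * sgn t * (\<kappa> * infsum (g' n) UNIV))))
      \<longlonglongrightarrow> exp (- complex_of_real (c * r powr \<alpha>) + \<i> * complex_of_real (c * sgn t * (r powr \<alpha> * \<theta>)))"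
    by (intro W' G' tendsto_intros)
  ultimately have "(\<lambda>n. char (distr M borel (series (a n))) t)
      \<longlonglongrightarrow> exp (- complex_of_real (c * r powr \<alpha>) + \<i> * complex_of_real (c * sgn t * (r powr \<alpha> * \<theta>)))"
    by (rule Lim_transform_eventually[rotated])
  then show ?thesis by (simp add: stable_char_def r_def algebra_simps)
qed

lemma series_finite_support:
  assumes "finite J" "\<And>i. i \<notin> J \<Longrightarrow> a i = 0"
  shows "series a \<omega> = (\<Sum>i\<in>J. a i * \<xi> i \<omega>)"
proof -
  have "eventually (\<lambda>K. finite K \<and> J \<subseteq> K) (finite_subsets_at_top (UNIV :: 'i set))"
    using assms(1) unfolding eventually_finite_subsets_at_top by auto
  then have "eventually (\<lambda>k. finite (F k) \<and> J \<subseteq> F k) sequentially"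
    using F_tendsto by (rule eventually_compose_filterlim)
  then have "eventually (\<lambda>k. (\<Sum>i\<in>F k. a i * \<xi> i \<omega>) = (\<Sum>i\<in>J. a i * \<xi> i \<omega>)) sequentially"
    by eventually_elim (use assms(2) in \<open>auto intro!: sum.mono_neutral_right\<close>)
  then show ?thesis
    unfolding series_sum_def by (intro limI tendsto_eventually)
qed

text \<open>About 1 / h(u) innovations with the common coefficient u have total weight close to 1,
  and the same signed weight since all signs are positive; as u tends to 0 the characteristic
  functions of their sums have the desired limit. An infinite index set supplies enough independent
  copies.\<close>

lemma stable_distribution_exists:
  assumes "infinite (UNIV :: 'i set)"
  shows "\<exists>\<mu>. real_distribution \<mu> \<and> (\<forall>t. char \<mu> t = stable_char c \<alpha> \<kappa> t)"
proof -
  define u where "u k = 1 / real (Suc k)" for k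
  define m where "m k = nat \<lfloor>1 / weight (u k)\<rfloor>" for k
  have u_pos: "u k > 0" for k by (simp add: u_def)
  have u0: "u \<longlonglongrightarrow> 0" unfolding u_def by (intro LIMSEQ_Suc lim_1_over_n)
  have u_right: "filterlim u (at_right 0) sequentially"
    using u0 u_pos less_imp_neq[OF u_pos] by (simp add: filterlim_at)
  have wu: "(\<lambda>k. weight (u k)) \<longlonglongrightarrow> 0"
    by (rule filterlim_compose[OF weight_tendsto_0 u_right])
  have m: "real (m k) * weight (u k) \<le> 1" "1 - weight (u k) \<le> real (m k) * weight (u k)" for k
  proof -
    have w: "weight (u k) > 0" using u_pos by (rule weight_pos)
    have "real (m k) \<le> 1 / weight (u k)" "1 / weight (u k) - 1 \<le> real (m k)"
      using w by (auto simp: m_def) 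
    then show "real (m k) * weight (u k) \<le> 1" "1 - weight (u k) \<le> real (m k) * weight (u k)"
      using w by (auto simp: field_simps)
  qed
  have mw: "(\<lambda>k. real (m k) * weight (u k)) \<longlonglongrightarrow> 1"
  proof (rule tendsto_sandwich)
    show "(\<lambda>k. 1 - weight (u k)) \<longlonglongrightarrow> 1" using tendsto_diff[OF tendsto_const wu, of 1] by simp
  qed (use m in auto)
  have "\<forall>k. \<exists>J :: 'i set. finite J \<and> card J = m k"
    using infinite_arbitrarily_large[OF assms] by auto
  then obtain J :: "nat \<Rightarrow> 'i set" where J: "\<And>k. finite (J k)" "\<And>k. card (J k) = m k" by metis
  define a where "a k i = (if i \<in> J k then u k else 0)" for k i
  have sum_J: "infsum f UNIV = sum f (J k)" "f summable_on UNIV"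
    if "\<And>i. i \<notin> J k \<Longrightarrow> f i = 0" for f :: "'i \<Rightarrow> real" and k
  proof -
    show "infsum f UNIV = sum f (J k)"
    proof -
      have "infsum f UNIV = infsum f (J k)" using that by (intro infsum_cong_neutral) auto
      then show ?thesis using J by simp
    qed
    show "f summable_on UNIV"
      using summable_on_cong_neutral[of UNIV "J k" f f] that J by simp
  qed
  define \<mu> where "\<mu> k = distr M borel (series (a k))" for k
  have \<mu>: "real_distribution (\<mu> k)" for k
    unfolding \<mu>_def by (intro real_distribution_distr) measurable
  have ch: "(\<lambda>k. char (\<mu> k) t) \<longlonglongrightarrow> stable_char c \<alpha> \<kappa> t" for t
    unfolding \<mu>_def
  proof (rule char_series_tendsto)
    show "eventually (\<lambda>k. (\<lambda>i. weight \<bar>a k i\<bar>) summable_on UNIV) sequentially"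
    proof (intro always_eventually allI)
      show "(\<lambda>i. weight \<bar>a k i\<bar>) summable_on UNIV" for k
        by (rule sum_J(2)[of k]) (simp add: a_def)
    qed
    show "eventually (\<lambda>k. \<forall>i. \<bar>a k i\<bar> < e) sequentially" if "e > 0" for e
      using order_tendstoD(2)[OF u0 that]
      by eventually_elim (use u_pos that in \<open>auto simp: a_def less_imp_le abs_of_pos\<close>)
    have "(\<Sum>\<^sub>\<infinity>i. weight \<bar>a k i\<bar>) = real (m k) * weight (u k)" for k
      by (subst sum_J(1)[of k]) (auto simp: a_def J u_pos less_imp_le)
    then show "(\<lambda>k. \<Sum>\<^sub>\<infinity>i. weight \<bar>a k i\<bar>) \<longlonglongrightarrow> 1" using mw by simp
    have "(\<Sum>\<^sub>\<infinity>i. weight \<bar>a k i\<bar> * sgn (a k i)) = real (m k) * weight (u k)" for k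
      using u_pos by (subst sum_J(1)[of k]) (auto simp: a_def J less_imp_le)
    then show "(\<lambda>k. \<kappa> * (\<Sum>\<^sub>\<infinity>i. weight \<bar>a k i\<bar> * sgn (a k i))) \<longlonglongrightarrow> \<kappa>"
      using tendsto_mult_left[OF mw, of \<kappa>] by simp
  qed
  have "tight \<mu>"
  proof (rule tightI_eventually[OF \<mu>])
    fix e :: real assume "e > 0"
    obtain C u\<^sub>0 where C: "C > 0" "u\<^sub>0 > 0"
      and le: "\<And>a J r. finite J \<Longrightarrow> (\<And>i. i \<in> J \<Longrightarrow> \<bar>a i\<bar> < u\<^sub>0) \<Longrightarrow> r > 0 \<Longrightarrow>
        prob {\<omega> \<in> space M. \<bar>\<Sum>i\<in>J. a i * \<xi> i \<omega>\<bar> \<ge> r}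
          \<le> C * (\<Sum>i\<in>J. weight \<bar>a i\<bar>)
            + (C * (\<Sum>i\<in>J. weight \<bar>a i\<bar>) + (C * (\<Sum>i\<in>J. weight \<bar>a i\<bar>))\<^sup>2) / r\<^sup>2"
      using prob_abs_weighted_sum_ge by blast
    \<comment> \<open>Bounds the probability of exceeding level 1. Level r is brought to 1 by
      dividing the coefficients by r, whereupon the total weight drops to about r^(-\<alpha>); at
      level r itself the first term of the bound would not shrink as r grows.\<close>
    let ?\<phi> = "\<lambda>s. C * s + (C * s + (C * s)\<^sup>2) / 1\<^sup>2"
    have "((\<lambda>r. r powr (- \<alpha>)) \<longlongrightarrow> 0) at_top"
      using \<alpha> by (intro tendsto_neg_powr filterlim_ident) auto
    then have "((\<lambda>r. ?\<phi> (r powr (- \<alpha>))) \<longlongrightarrow> ?\<phi> 0) at_top" by (intro tendsto_intros) auto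
    then have "eventually (\<lambda>r. ?\<phi> (r powr (- \<alpha>)) < e) at_top"
      using \<open>e > 0\<close> by (intro order_tendstoD) auto
    then have "eventually (\<lambda>r. ?\<phi> (r powr (- \<alpha>)) < e \<and> r > 0) at_top"
      by (intro eventually_conj eventually_gt_at_top)
    then obtain r where r: "?\<phi> (r powr (- \<alpha>)) < e" "r > 0"
      using eventually_happens[of _ "at_top :: real filter"] by auto
    define s where "s k = real (m k) * weight (u k / r)" for k
    have "(\<lambda>k. real (m k) * weight (u k) * (weight (1 / r * u k) / weight (u k)))
        \<longlonglongrightarrow> 1 * (1 / r) powr \<alpha>"
      using r by (intro tendsto_mult mw filterlim_compose[OF weight_ratio u_right]) auto
    moreover have "real (m k) * weight (u k) * (weight (1 / r * u k) / weight (u k)) = s k" for k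
      using weight_pos[OF u_pos[of k]] by (simp add: s_def)
    ultimately have "s \<longlonglongrightarrow> r powr (- \<alpha>)"
      using r by (simp add: powr_divide powr_minus divide_inverse inverse_powr)
    then have "(\<lambda>k. ?\<phi> (s k)) \<longlonglongrightarrow> ?\<phi> (r powr (- \<alpha>))" by (intro tendsto_intros) auto
    then have "eventually (\<lambda>k. ?\<phi> (s k) < e) sequentially" using r by (intro order_tendstoD)
    moreover have "(\<lambda>k. u k / r) \<longlonglongrightarrow> 0 / r" using u0 r by (intro tendsto_intros) auto
    then have "eventually (\<lambda>k. u k / r < u\<^sub>0) sequentially" using C by (intro order_tendstoD) auto
    ultimately have "eventually (\<lambda>k. measure (\<mu> k) {x. \<bar>x\<bar> \<ge> r} < e) sequentially"
    proof eventually_elim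
      case (elim k)
      have "measure (\<mu> k) {x. \<bar>x\<bar> \<ge> r} = prob {\<omega> \<in> space M. \<bar>series (a k) \<omega>\<bar> \<ge> r}"
        unfolding \<mu>_def by (subst measure_distr) (auto intro: arg_cong[where f=prob])
      also have "{\<omega> \<in> space M. \<bar>series (a k) \<omega>\<bar> \<ge> r}
          = {\<omega> \<in> space M. \<bar>\<Sum>i\<in>J k. (u k / r) * \<xi> i \<omega>\<bar> \<ge> 1}"
      proof -
        have "series (a k) \<omega> = r * (\<Sum>i\<in>J k. (u k / r) * \<xi> i \<omega>)" for \<omega>
          using J r by (subst series_finite_support[of "J k"]) (auto simp: a_def sum_distrib_left)
        then show ?thesis using r by (simp add: abs_mult)
      qed
      also have "prob \<dots> \<le> ?\<phi> (\<Sum>i\<in>J k. weight \<bar>u k / r\<bar>)"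
        using elim J r u_pos[of k] by (intro le) auto
      also have "(\<Sum>i\<in>J k. weight \<bar>u k / r\<bar>) = s k"
        using r u_pos[of k] by (simp add: J s_def less_imp_le)
      finally show ?case using elim by simp
    qed
    then show "\<exists>r. eventually (\<lambda>n. measure (\<mu> n) {x. \<bar>x\<bar> \<ge> r} < e) sequentially" ..
  qed
  \<comment> \<open>The characteristic functions converge along the whole sequence, so the limit of
    any weakly convergent subsequence has the desired one.\<close>
  from tight_imp_convergent_subsubsequence[OF this, of id]
  obtain s \<nu> where s: "strict_mono s" "real_distribution \<nu>" "weak_conv_m (\<mu> \<circ> id \<circ> s) \<nu>"
    by (auto simp: strict_mono_def)
  have "char \<nu> t = stable_char c \<alpha> \<kappa> t" for t
  proof (rule LIMSEQ_unique)
    have "(\<lambda>k. char ((\<mu> \<circ> id \<circ> s) k) t) \<longlonglongrightarrow> char \<nu> t"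
      by (rule levy_continuity1[OF _ s(2,3)]) (simp add: \<mu>)
    then show "(\<lambda>k. char (\<mu> (s k)) t) \<longlonglongrightarrow> char \<nu> t" by simp
    show "(\<lambda>k. char (\<mu> (s k)) t) \<longlonglongrightarrow> stable_char c \<alpha> \<kappa> t"
      using LIMSEQ_subseq_LIMSEQ[OF ch s(1)] by (simp add: o_def)
  qed
  with s(2) show ?thesis by blast
qed

end

section \<open>The norming constants\<close>

lemma increment_divide: "increment (\<lambda>i. f i / B) = (\<lambda>i. increment f i / B)"
proof -
  obtain ks :: "'a list" where ks: "distinct ks" "set ks = UNIV"
    using finite_distinct_list[of "UNIV :: 'a set"] by auto
  have "foldr increment_in ks (\<lambda>i. f i / B) = (\<lambda>i. foldr increment_in ks f i / B)"
    by (induction ks) (auto simp: increment_in_def fun_eq_iff diff_divide_distrib)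
  then show ?thesis by (simp add: increment_eq_foldr[OF ks])
qed

text \<open>Serves to show that the increments of a bounded field are bounded, without which their
  real supremum is meaningless. Unit increments are box increments of side 1.\<close>

lemma abs_increment_le:
  fixes f :: "int ^ 'd::finite \<Rightarrow> real"
  assumes "\<And>i. \<bar>f i\<bar> \<le> D"
  shows "\<bar>increment f i\<bar> \<le> 2 ^ CARD('d) * D"
proof -
  obtain ks :: "'d list" where ks: "distinct ks" "set ks = UNIV"
    using finite_distinct_list[of "UNIV :: 'd set"] by auto
  have len: "length ks = CARD('d)" using ks distinct_card by metis
  have "(increment_in :: 'd \<Rightarrow> _) = box_increment_in 1"
    by (simp add: increment_in_def box_increment_in_def fun_eq_iff)
  then have "increment f i = foldr (box_increment_in 1) ks f i"
    by (simp only: increment_eq_foldr[OF ks])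
  also have "\<bar>\<dots>\<bar> \<le> 2 ^ length ks * D"
    by (rule abs_foldr_box_le_corners[OF ks(1)]) (rule assms)
  finally show ?thesis by (simp add: len)
qed

section \<open>Normed coefficients: total weight one and uniform smallness\<close>

context heavy_tail
begin

abbreviation norming_set :: "('i \<Rightarrow> real) \<Rightarrow> real set" where
  "norming_set b \<equiv> {x. x \<ge> 1 \<and> (\<lambda>i. weight (\<bar>b i\<bar> / x)) summable_on UNIV
    \<and> (\<Sum>\<^sub>\<infinity>i. weight (\<bar>b i\<bar> / x)) \<le> 1}"

lemma norming_eq: "norming \<alpha> L b = Inf (norming_set b)"
  by (simp add: norming_def weight_def)

text \<open>Points of the set just above \<open>B\<close> bound the sum at \<open>B\<close> by r^2
  for every r > 1. If the sum were below 1, slightly smaller x >= 1 would still belong to the set;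
  such x exist because \<open>B > 1\<close>.\<close>

lemma norming_sum:
  fixes b :: "'i \<Rightarrow> real"
  defines "B \<equiv> norming \<alpha> L b"
  assumes "B > 1" and ne: "norming_set b \<noteq> {}"
  shows "(\<lambda>i. weight (\<bar>b i\<bar> / B)) summable_on UNIV" and "(\<Sum>\<^sub>\<infinity>i. weight (\<bar>b i\<bar> / B)) = 1"
proof -
  have bdd: "bdd_below (norming_set b)" by (rule bdd_belowI[of _ 1]) auto
  have lower: "B \<le> x" if "x \<in> norming_set b" for x
    unfolding B_def norming_eq using that by (rule cInf_lower[OF _ bdd])
  have scale: "(\<lambda>i. weight (\<bar>b i\<bar> / (x / r))) summable_on UNIV"
      "(\<Sum>\<^sub>\<infinity>i. weight (\<bar>b i\<bar> / (x / r))) \<le> r\<^sup>2 * (\<Sum>\<^sub>\<infinity>i. weight (\<bar>b i\<bar> / x))"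
    if summ: "(\<lambda>i. weight (\<bar>b i\<bar> / x)) summable_on UNIV" and "r \<ge> 1" "x > 0" for x r
  proof -
    have le: "weight (\<bar>b i\<bar> / (x / r)) \<le> r\<^sup>2 * weight (\<bar>b i\<bar> / x)" for i
    proof -
      have "\<bar>b i\<bar> / (x / r) = r * (\<bar>b i\<bar> / x)" by simp
      then show ?thesis using weight_mult_le[of r "\<bar>b i\<bar> / x"] that by (simp only:) simp
    qed
    have s: "(\<lambda>i. r\<^sup>2 * weight (\<bar>b i\<bar> / x)) summable_on UNIV"
      by (rule summable_on_cmult_right[OF summ])
    show s': "(\<lambda>i. weight (\<bar>b i\<bar> / (x / r))) summable_on UNIV"
      by (rule summable_on_comparison_test[OF s le weight_nonneg])
    show "(\<Sum>\<^sub>\<infinity>i. weight (\<bar>b i\<bar> / (x / r))) \<le> r\<^sup>2 * (\<Sum>\<^sub>\<infinity>i. weight (\<bar>b i\<bar> / x))"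
      using infsum_mono[OF s' s le] by (simp add: infsum_cmult_right')
  qed
  have upper: "(\<lambda>i. weight (\<bar>b i\<bar> / B)) summable_on UNIV \<and> (\<Sum>\<^sub>\<infinity>i. weight (\<bar>b i\<bar> / B)) \<le> r\<^sup>2"
    if "r > 1" for r
  proof -
    have "Inf (norming_set b) < r * B"
      using that \<open>B > 1\<close> unfolding B_def norming_eq by simp
    then obtain x where x: "x \<in> norming_set b" "x < r * B" using cInf_lessD[OF ne] by blast
    define q where "q = x / B"
    have q: "1 \<le> q" "q \<le> r" "B = x / q" "x > 0"
      using lower[OF x(1)] x(2) \<open>B > 1\<close> by (auto simp: q_def field_simps)
    have "(\<Sum>\<^sub>\<infinity>i. weight (\<bar>b i\<bar> / B)) \<le> q\<^sup>2 * (\<Sum>\<^sub>\<infinity>i. weight (\<bar>b i\<bar> / x))"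
      unfolding q(3) using x q by (intro scale) auto
    also have "\<dots> \<le> r\<^sup>2 * 1"
      using x q weight_nonneg by (intro mult_mono power_mono infsum_nonneg) auto
    finally show ?thesis unfolding q(3) using scale(1)[of x q] x q by simp
  qed
  show summ: "(\<lambda>i. weight (\<bar>b i\<bar> / B)) summable_on UNIV" using upper[of 2] by simp
  let ?s = "\<Sum>\<^sub>\<infinity>i. weight (\<bar>b i\<bar> / B)"
  have "?s \<ge> 0" using weight_nonneg by (intro infsum_nonneg) auto
  show "?s = 1"
  proof (rule antisym)
    show "?s \<le> 1"
    proof (rule ccontr)
      assume "\<not> ?s \<le> 1"
      \<comment> \<open>For a sum s > 1, the number (1 + s) / 2 lies strictly between 1 and
        s.\<close>
      then have "?s \<le> (sqrt ((1 + ?s) / 2))\<^sup>2" using upper[of "sqrt ((1 + ?s) / 2)"] by simp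
      also have "(sqrt ((1 + ?s) / 2))\<^sup>2 = (1 + ?s) / 2" using \<open>?s \<ge> 0\<close> by simp
      finally show False using \<open>\<not> ?s \<le> 1\<close> by simp
    qed
    show "1 \<le> ?s"
    proof (rule ccontr)
      assume "\<not> 1 \<le> ?s"
      \<comment> \<open>Capping r by \<open>B\<close> keeps B / r >= 1, and r^2 <= 2 / (1 + s) keeps
        r^2 s below 1, where s is the sum.\<close>
      define r where "r = min B (sqrt (2 / (1 + ?s)))"
      have r: "r > 1" "r \<le> B" "r \<le> sqrt (2 / (1 + ?s))"
        using \<open>B > 1\<close> \<open>?s \<ge> 0\<close> \<open>\<not> 1 \<le> ?s\<close> by (auto simp: r_def)
      have "B / r < B" "1 \<le> B / r" using r \<open>B > 1\<close> by (auto simp: field_simps)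
      then have "B / r \<notin> norming_set b" using lower[of "B / r"] by auto
      then have "(\<Sum>\<^sub>\<infinity>i. weight (\<bar>b i\<bar> / (B / r))) > 1"
        using scale(1)[OF summ, of r] r \<open>B > 1\<close> \<open>1 \<le> B / r\<close> by auto
      also have "(\<Sum>\<^sub>\<infinity>i. weight (\<bar>b i\<bar> / (B / r))) \<le> r\<^sup>2 * ?s"
        using r \<open>B > 1\<close> by (intro scale summ) auto
      also have "\<dots> \<le> (sqrt (2 / (1 + ?s)))\<^sup>2 * ?s"
        using r \<open>?s \<ge> 0\<close> by (intro mult_right_mono power_mono) auto
      also have "\<dots> = 2 * ?s / (1 + ?s)" using \<open>?s \<ge> 0\<close> by simp
      also have "\<dots> < 1" using \<open>?s \<ge> 0\<close> \<open>\<not> 1 \<le> ?s\<close> by (simp add: field_simps)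
      finally show False .
    qed
  qed
qed

lemma eventually_norming_sum:
  fixes b :: "nat \<Rightarrow> 'i \<Rightarrow> real"
  defines "B \<equiv> \<lambda>n. norming \<alpha> L (b n)"
  assumes B: "filterlim B at_top sequentially"
  shows "eventually (\<lambda>n. B n > 1 \<and> (\<lambda>i. weight \<bar>b n i / B n\<bar>) summable_on UNIV
    \<and> (\<Sum>\<^sub>\<infinity>i. weight \<bar>b n i / B n\<bar>) = 1) sequentially"
proof -
  \<comment> \<open>If no x qualified, the norming constant would be the fixed default
    \<open>Inf {}\<close>; a sequence tending to infinity eventually exceeds it, so the set is
    nonempty.\<close>
  have "eventually (\<lambda>n. B n > max 1 (Inf {})) sequentially"
    using B unfolding filterlim_at_top_dense by blast
  then show ?thesis
  proof eventually_elim
    case (elim n)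
    have "norming_set (b n) \<noteq> {}"
    proof
      assume "norming_set (b n) = {}"
      then have "B n = Inf {}" by (simp only: B_def norming_eq)
      with elim show False by simp
    qed
    with norming_sum[of "b n"] elim show ?case by (simp add: B_def)
  qed
qed

lemma small_of_increment:
  fixes e :: real
  assumes "e > 0"
  obtains \<eta> where "\<eta> > 0"
    "\<And>(b :: int ^ 'd::finite \<Rightarrow> real) B i. B > 0 \<Longrightarrow> (\<lambda>i. weight \<bar>b i / B\<bar>) summable_on UNIV \<Longrightarrow>
      (\<Sum>\<^sub>\<infinity>i. weight \<bar>b i / B\<bar>) \<le> 1 \<Longrightarrow> (SUP i. \<bar>increment b i\<bar>) \<le> \<eta> * B \<Longrightarrow> \<bar>b i / B\<bar> < e"
proof -
  \<comment> \<open>The corners contribute e / 2 through \<open>e'\<close>, the unit increments e /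
    4 through \<open>\<eta>\<close>. \<open>K\<close> bounds the number of coefficients of size at
    least \<open>e'\<close>, each of weight at least \<open>m\<close> out of a total of at most
    1.\<close>
  define e' where "e' = e / (2 * 2 ^ CARD('d))"
  have "e' > 0" using assms by (simp add: e'_def)
  then obtain m where m: "m > 0" "\<And>u. u \<ge> e' \<Longrightarrow> weight u \<ge> m" using weight_lower by blast
  define K where "K = nat \<lceil>1 / m\<rceil>"
  define \<eta> where "\<eta> = e / (4 * real (K + 1) ^ CARD('d))"
  show ?thesis
  proof (rule that)
    show "\<eta> > 0" using assms by (simp add: \<eta>_def del: of_nat_add)
    fix b :: "int ^ 'd \<Rightarrow> real" and B i
    define a where "a i = b i / B" for i
    assume "B > 0" and "(\<lambda>i. weight \<bar>b i / B\<bar>) summable_on UNIV" "(\<Sum>\<^sub>\<infinity>i. weight \<bar>b i / B\<bar>) \<le> 1"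
      and sup: "(SUP i. \<bar>increment b i\<bar>) \<le> \<eta> * B"
    then have a: "(\<lambda>i. weight \<bar>a i\<bar>) summable_on UNIV" "(\<Sum>\<^sub>\<infinity>i. weight \<bar>a i\<bar>) \<le> 1"
      by (simp_all add: a_def)
    let ?A = "{i. \<bar>a i\<bar> \<ge> e'}"
    have A: "finite ?A \<and> card ?A \<le> K"
    proof (rule finite_if_finite_subsets_card_bdd)
      fix T assume T: "T \<subseteq> ?A" "finite T"
      have "real (card T) * m = (\<Sum>i\<in>T. m)" by simp
      also have "\<dots> \<le> (\<Sum>i\<in>T. weight \<bar>a i\<bar>)" using T m by (intro sum_mono) auto
      also have "\<dots> \<le> (\<Sum>\<^sub>\<infinity>i. weight \<bar>a i\<bar>)"
        using a(1) T weight_nonneg by (intro finite_sum_le_infsum) auto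
      finally have "real (card T) \<le> 1 / m" using a(2) m(1) by (simp add: field_simps)
      then show "card T \<le> K" unfolding K_def by linarith
    qed
    \<comment> \<open>The real \<open>SUP\<close> of an unbounded set would be a default value
      carrying no information. Only finitely many coefficients reach \<open>e'\<close>, so the field
      is bounded, and its increments with it.\<close>
    have bound: "\<bar>a j\<bar> \<le> e' + (\<Sum>i\<in>?A. \<bar>a i\<bar>)" for j
    proof (cases "j \<in> ?A")
      case True
      then show ?thesis using A \<open>e' > 0\<close> member_le_sum[of j ?A "\<lambda>i. \<bar>a i\<bar>"] by simp
    next
      case False
      then have "\<bar>a j\<bar> < e'" by simp
      moreover have "0 \<le> (\<Sum>i\<in>?A. \<bar>a i\<bar>)" by (intro sum_nonneg) auto
      ultimately show ?thesis by linarith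
    qed
    have "\<bar>b j\<bar> \<le> (e' + (\<Sum>i\<in>?A. \<bar>a i\<bar>)) * B" for j
      using bound[of j] \<open>B > 0\<close> by (simp add: a_def[of j] pos_divide_le_eq)
    then have "\<bar>increment b j\<bar> \<le> 2 ^ CARD('d) * ((e' + (\<Sum>i\<in>?A. \<bar>a i\<bar>)) * B)" for j
      by (rule abs_increment_le)
    then have "bdd_above (range (\<lambda>i. \<bar>increment b i\<bar>))" by (intro bdd_aboveI2)
    then have "\<bar>increment b j\<bar> \<le> \<eta> * B" for j
      using sup by (meson cSUP_upper UNIV_I order_trans)
    then have "\<bar>increment a j\<bar> \<le> \<eta>" for j
      using \<open>B > 0\<close> by (simp add: a_def[abs_def] increment_divide pos_divide_le_eq)
    with A have "\<bar>a i\<bar> \<le> 2 ^ CARD('d) * e' + real (K + 1) ^ CARD('d) * \<eta>"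
      using \<open>e' > 0\<close> by (intro abs_le_of_increment) auto
    also have "2 ^ CARD('d) * e' = e / 2" by (simp add: e'_def)
    also have "real (K + 1) ^ CARD('d) * \<eta> = e / 4" by (simp add: \<eta>_def del: of_nat_add)
    finally have "\<bar>a i\<bar> < e" using assms by linarith
    then show "\<bar>b i / B\<bar> < e" unfolding a_def .
  qed
qed

text \<open>If the limsup is finite, the coefficients are bounded by a constant for large n and
  division by \<open>B n\<close> suffices; otherwise the increments provide the smallness.\<close>

lemma eventually_small:
  fixes b :: "nat \<Rightarrow> int ^ 'd::finite \<Rightarrow> real"
  defines "B \<equiv> \<lambda>n. norming \<alpha> L (b n)"
  assumes B: "filterlim B at_top sequentially"
    and inc: "limsup (\<lambda>n. SUP i. ereal \<bar>b n i\<bar>) = \<infinity> \<Longrightarrow> (\<lambda>n. SUP i. \<bar>increment (b n) i\<bar>) \<in> o(B)"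
    and "e > 0"
  shows "eventually (\<lambda>n. \<forall>i. \<bar>b n i / B n\<bar> < e) sequentially"
proof (cases "limsup (\<lambda>n. SUP i. ereal \<bar>b n i\<bar>) = \<infinity>")
  case True
  obtain \<eta> where \<eta>: "\<eta> > 0"
    "\<And>(b :: int ^ 'd::finite \<Rightarrow> real) B i. B > 0 \<Longrightarrow> (\<lambda>i. weight \<bar>b i / B\<bar>) summable_on UNIV \<Longrightarrow>
      (\<Sum>\<^sub>\<infinity>i. weight \<bar>b i / B\<bar>) \<le> 1 \<Longrightarrow> (SUP i. \<bar>increment b i\<bar>) \<le> \<eta> * B \<Longrightarrow> \<bar>b i / B\<bar> < e"
    using small_of_increment[OF \<open>e > 0\<close>] by blast
  have sum: "eventually (\<lambda>n. B n > 1 \<and> (\<lambda>i. weight \<bar>b n i / B n\<bar>) summable_on UNIV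
      \<and> (\<Sum>\<^sub>\<infinity>i. weight \<bar>b n i / B n\<bar>) \<le> 1) sequentially"
    using eventually_norming_sum[OF B[unfolded B_def]] unfolding B_def
    by eventually_elim linarith
  have "eventually (\<lambda>n. norm (SUP i. \<bar>increment (b n) i\<bar>) \<le> \<eta> * norm (B n)) sequentially"
    using inc[OF True] \<eta>(1) by (rule landau_o.smallD)
  then show ?thesis
    using sum
  proof eventually_elim
    case (elim n)
    show ?case
    proof
      fix i
      show "\<bar>b n i / B n\<bar> < e"
      proof (rule \<eta>(2))
        show "(SUP i. \<bar>increment (b n) i\<bar>) \<le> \<eta> * B n" using elim by simp
      qed (use elim in \<open>linarith | blast\<close>)+
    qed
  qed
next
  case False
  then obtain C where C: "limsup (\<lambda>n. SUP i. ereal \<bar>b n i\<bar>) < ereal (real C)"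
    using less_PInf_Ex_of_nat by auto
  have "eventually (\<lambda>n. (SUP i. ereal \<bar>b n i\<bar>) < ereal (real C)) sequentially"
    using C by (rule Limsup_lessD)
  moreover have "eventually (\<lambda>n. B n > max 0 (real C / e)) sequentially"
    using B unfolding filterlim_at_top_dense by blast
  ultimately show ?thesis
  proof eventually_elim
    case (elim n)
    show ?case
    proof
      fix i
      have "ereal \<bar>b n i\<bar> \<le> (SUP i. ereal \<bar>b n i\<bar>)" by (rule SUP_upper) simp
      also note elim(1)
      finally have "\<bar>b n i\<bar> < real C" by simp
      also have "real C < e * B n" using elim(2) \<open>e > 0\<close> by (simp add: field_simps)
      finally show "\<bar>b n i / B n\<bar> < e" using elim(2) by (simp add: abs_divide field_simps)
    qed
  qed
qed

end

text \<open>Dividing the tail asymptotics at r x by those at x leaves r^(-\<alpha>) times a quotient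
  of values of \<open>L\<^sub>1\<close>, which tends to 1.\<close>

lemma (in prob_space) tail_ratio_of_domain:
  assumes "in_domain_of_attraction M X \<alpha> c\<^sub>p c\<^sub>m" "r > 0"
  shows "((\<lambda>x. tail X (r * x) / tail X x) \<longlongrightarrow> r powr (- \<alpha>)) at_top"
proof -
  obtain L\<^sub>1 where L: "slowly_varying L\<^sub>1"
    "((\<lambda>x. tail X x / (x powr (- \<alpha>) * L\<^sub>1 x)) \<longlongrightarrow> 1) at_top"
    using assms(1) unfolding in_domain_of_attraction_def by blast
  have ratio: "((\<lambda>x. L\<^sub>1 (r * x) / L\<^sub>1 x) \<longlongrightarrow> 1) at_top"
    using L(1) assms(2) unfolding slowly_varying_def by blast
  obtain x\<^sub>0 where x0: "\<And>x. x \<ge> x\<^sub>0 \<Longrightarrow> L\<^sub>1 x > 0" using L(1) unfolding slowly_varying_def by blast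
  have pos: "eventually (\<lambda>x. L\<^sub>1 x > 0) at_top"
    using eventually_ge_at_top[of x\<^sub>0] by eventually_elim (rule x0)
  define f where "f x = x powr (- \<alpha>) * L\<^sub>1 x" for x
  have top: "filterlim (\<lambda>x. r * x) at_top at_top"
    using assms(2) by (intro filterlim_tendsto_pos_mult_at_top[OF tendsto_const]) (auto simp: filterlim_ident)
  have Lf: "((\<lambda>x. tail X x / f x) \<longlongrightarrow> 1) at_top" using L(2) by (simp add: f_def)
  have "((\<lambda>x. tail X (r * x) / f (r * x) * (r powr (- \<alpha>) * (L\<^sub>1 (r * x) / L\<^sub>1 x)) / (tail X x / f x))
      \<longlongrightarrow> 1 * (r powr (- \<alpha>) * 1) / 1) at_top"
    by (intro tendsto_intros ratio Lf filterlim_compose[OF Lf top]) auto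
  moreover have "eventually (\<lambda>x. tail X (r * x) / f (r * x) * (r powr (- \<alpha>) * (L\<^sub>1 (r * x) / L\<^sub>1 x))
      / (tail X x / f x) = tail X (r * x) / tail X x) at_top"
    using pos eventually_compose_filterlim[OF pos top] eventually_gt_at_top[of 0]
  proof eventually_elim
    case (elim x)
    have cancel: "u / (k * F) * k / (v / F) = u / v" if "k > 0" "F > 0" for u v k F :: real
      using that by simp
    have eq: "f (r * x) = r powr (- \<alpha>) * (L\<^sub>1 (r * x) / L\<^sub>1 x) * f x"
      using elim assms(2) by (simp add: f_def powr_mult)
    show ?case unfolding eq
      using elim assms(2) by (intro cancel mult_pos_pos divide_pos_pos) (auto simp: f_def)
  qed
  ultimately show ?thesis by (simp add: tendsto_cong)
qed

text \<open>Yields beta = 0 for symmetric innovations, hence a limit without skewness. At \<alpha> =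
  2 the balance constants are unconstrained, hence the restriction.\<close>

lemma (in prob_space) balance_eq_of_symmetric:
  assumes [measurable]: "random_variable borel X" and sym: "symmetric_rv M X"
    and dom: "in_domain_of_attraction M X \<alpha> c\<^sub>p c\<^sub>m" and "\<alpha> < 2"
  shows "c\<^sub>p = c\<^sub>m"
proof -
  have eq: "prob {\<omega> \<in> space M. X \<omega> < - x} = prob {\<omega> \<in> space M. X \<omega> > x}" for x
  proof -
    have "prob {\<omega> \<in> space M. X \<omega> < - x} = measure (distr M borel (\<lambda>\<omega>. - X \<omega>)) {x<..}"
      by (subst measure_distr) (auto intro!: arg_cong[where f=prob])
    also have "\<dots> = measure (distr M borel X) {x<..}" using sym by (simp add: symmetric_rv_def)
    also have "\<dots> = prob {\<omega> \<in> space M. X \<omega> > x}"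
      by (subst measure_distr) (auto intro!: arg_cong[where f=prob])
    finally show ?thesis .
  qed
  have lim: "((\<lambda>x. prob {\<omega> \<in> space M. X \<omega> > x} / tail X x) \<longlongrightarrow> c\<^sub>p) at_top"
    "((\<lambda>x. prob {\<omega> \<in> space M. X \<omega> < - x} / tail X x) \<longlongrightarrow> c\<^sub>m) at_top"
    using dom \<open>\<alpha> < 2\<close> unfolding in_domain_of_attraction_def by blast+
  show ?thesis using tendsto_unique[OF _ lim(1) lim(2)[unfolded eq]] by simp
qed

section \<open>Weak convergence of the normed series\<close>

context innovations
begin

text \<open>Almost sure convergence for the coefficients b_i / B transfers to the b_i on
  multiplication by \<open>B\<close>. Outside that event both sides rest on defaults of
  \<open>lim\<close>, so the equality is claimed only almost surely.\<close>

lemma distr_normed_series: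
  assumes "(\<lambda>i. weight \<bar>b i / B\<bar>) summable_on UNIV" "B \<noteq> 0"
  shows "distr M borel (\<lambda>\<omega>. series b \<omega> / B) = distr M borel (series (\<lambda>i. b i / B))"
proof (rule distr_cong_AE)
  show "AE \<omega> in M. series b \<omega> / B = series (\<lambda>i. b i / B) \<omega>"
    using AE_series[OF assms(1)]
  proof eventually_elim
    case (elim \<omega>)
    then have "(\<lambda>k. B * (\<Sum>i\<in>F k. b i / B * \<xi> i \<omega>)) \<longlonglongrightarrow> B * series (\<lambda>i. b i / B) \<omega>"
      by (intro tendsto_intros)
    moreover have "B * (\<Sum>i\<in>F k. b i / B * \<xi> i \<omega>) = (\<Sum>i\<in>F k. b i * \<xi> i \<omega>)" for k
      using assms(2) by (simp add: sum_distrib_left)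
    ultimately have "series b \<omega> = B * series (\<lambda>i. b i / B) \<omega>"
      unfolding series_sum_def[of F "\<lambda>i \<omega>. b i * \<xi> i \<omega>"] by (simp add: limI)
    then show ?case using assms(2) by simp
  qed
  show "random_variable borel (\<lambda>\<omega>. series b \<omega> / B)"
    by (intro borel_measurable_divide series_measurable borel_measurable_const)
qed (rule refl series_measurable)+

lemma weak_conv_normed_series:
  fixes b :: "nat \<Rightarrow> 'i \<Rightarrow> real" and B :: "nat \<Rightarrow> real"
  assumes sum: "eventually (\<lambda>n. B n > 1 \<and> (\<lambda>i. weight \<bar>b n i / B n\<bar>) summable_on UNIV
      \<and> (\<Sum>\<^sub>\<infinity>i. weight \<bar>b n i / B n\<bar>) = 1) sequentially"
    and small: "\<And>e. e > 0 \<Longrightarrow> eventually (\<lambda>n. \<forall>i. \<bar>b n i / B n\<bar> < e) sequentially"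
    and G: "(\<lambda>n. \<kappa> * (\<Sum>\<^sub>\<infinity>i. weight \<bar>b n i / B n\<bar> * sgn (b n i / B n))) \<longlonglongrightarrow> \<theta>"
    and Z: "real_distribution Z" "\<And>t. char Z t = stable_char c \<alpha> \<theta> t"
  shows "weak_conv_m (\<lambda>n. distr M borel (\<lambda>\<omega>. series (b n) \<omega> / B n)) Z"
proof (rule levy_continuity[OF _ Z(1)])
  show "real_distribution (distr M borel (\<lambda>\<omega>. series (b n) \<omega> / B n))" for n
    by (intro real_distribution_distr) measurable
  fix t
  have "(\<lambda>n. char (distr M borel (series (\<lambda>i. b n i / B n))) t) \<longlonglongrightarrow> stable_char c \<alpha> \<theta> t"
  proof (rule char_series_tendsto[OF _ small _ G])
    show "eventually (\<lambda>n. (\<lambda>i. weight \<bar>b n i / B n\<bar>) summable_on UNIV) sequentially"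
      using sum by eventually_elim blast
    show "(\<lambda>n. \<Sum>\<^sub>\<infinity>i. weight \<bar>b n i / B n\<bar>) \<longlonglongrightarrow> 1"
    proof (rule tendsto_eventually)
      show "eventually (\<lambda>n. (\<Sum>\<^sub>\<infinity>i. weight \<bar>b n i / B n\<bar>) = 1) sequentially"
        using sum by eventually_elim blast
    qed
  qed
  moreover have "eventually (\<lambda>n. char (distr M borel (series (\<lambda>i. b n i / B n))) t
      = char (distr M borel (\<lambda>\<omega>. series (b n) \<omega> / B n)) t) sequentially"
    using sum
  proof eventually_elim
    case (elim n)
    then have "distr M borel (\<lambda>\<omega>. series (b n) \<omega> / B n) = distr M borel (series (\<lambda>i. b n i / B n))"
      by (intro distr_normed_series) (blast, linarith)
    then show ?case by (simp only:)
  qed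
  ultimately show "(\<lambda>n. char (distr M borel (\<lambda>\<omega>. series (b n) \<omega> / B n)) t) \<longlonglongrightarrow> char Z t"
    unfolding Z(2) by (rule Lim_transform_eventually)
qed

end

lemma infsum_split_sign:
  fixes w a :: "'i \<Rightarrow> real"
  assumes "w summable_on UNIV" "\<And>i. a i = 0 \<Longrightarrow> w i = 0"
  shows "infsum w UNIV = infsum w {i. a i > 0} + infsum w {i. a i < 0}"
    and "(\<Sum>\<^sub>\<infinity>i. w i * sgn (a i)) = infsum w {i. a i > 0} - infsum w {i. a i < 0}"
proof -
  have sub: "w summable_on A" for A by (rule summable_on_subset_banach[OF assms(1)]) simp
  have disj: "{i. a i > 0} \<inter> {i. a i < 0} = {}" by auto
  have "infsum w UNIV = infsum w ({i. a i > 0} \<union> {i. a i < 0})"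
    using assms(2) by (intro infsum_cong_neutral) (auto simp: not_less antisym)
  also have "\<dots> = infsum w {i. a i > 0} + infsum w {i. a i < 0}"
    by (rule infsum_Un_disjoint[OF sub sub disj])
  finally show "infsum w UNIV = infsum w {i. a i > 0} + infsum w {i. a i < 0}" .
  let ?g = "\<lambda>i. w i * sgn (a i)"
  have pos: "infsum ?g {i. a i > 0} = infsum w {i. a i > 0}" by (intro infsum_cong) auto
  have neg: "infsum ?g {i. a i < 0} = - infsum w {i. a i < 0}"
    unfolding infsum_uminus[symmetric] by (intro infsum_cong) auto
  have g: "?g summable_on {i. a i > 0}" "?g summable_on {i. a i < 0}"
    using summable_on_cong[of "{i. a i > 0}" ?g w] summable_on_cong[of "{i. a i < 0}" ?g "\<lambda>i. - w i"] sub
    by (auto simp: summable_on_uminus)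
  have "infsum ?g UNIV = infsum ?g ({i. a i > 0} \<union> {i. a i < 0})"
    by (intro infsum_cong_neutral) (auto simp: sgn_if)
  also have "\<dots> = infsum ?g {i. a i > 0} + infsum ?g {i. a i < 0}"
    by (rule infsum_Un_disjoint[OF g disj])
  finally show "(\<Sum>\<^sub>\<infinity>i. w i * sgn (a i)) = infsum w {i. a i > 0} - infsum w {i. a i < 0}"
    using pos neg by simp
qed

lemma infinite_UNIV_int_vec: "infinite (UNIV :: (int ^ 'd::finite) set)"
proof
  assume "finite (UNIV :: (int ^ 'd) set)"
  then have "finite (range (\<lambda>k::int. (\<chi> j. k) :: int ^ 'd))" by (rule finite_subset[rotated]) simp
  moreover have "inj (\<lambda>k::int. (\<chi> j. k) :: int ^ 'd)" by (auto simp: inj_def vec_eq_iff)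
  ultimately show False using infinite_UNIV_int finite_imageD by blast
qed

theorem theorem3p2:
  fixes M :: "'a measure"
    and \<xi> :: "int ^ 'd::finite \<Rightarrow> 'a \<Rightarrow> real"
    and b :: "nat \<Rightarrow> int ^ 'd \<Rightarrow> real"
    and F :: "nat \<Rightarrow> (int ^ 'd) set"
    and \<alpha> c\<^sub>p c\<^sub>m c\<^sub>\<alpha> :: real
  assumes "prob_space M"
    and "0 < \<alpha>" "\<alpha> \<le> 2"
    and "prob_space.indep_vars M (\<lambda>_. borel) \<xi> UNIV"
    and "\<And>i. distr M borel (\<xi> i) = distr M borel (\<xi> 0)"
    and "(\<integral>\<^sup>+\<omega>. ennreal ((\<xi> 0 \<omega>)\<^sup>2) \<partial>M) = \<infinity>"
    and "in_domain_of_attraction M (\<xi> 0) \<alpha> c\<^sub>p c\<^sub>m"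
    and "condition_A M (\<xi> 0) \<alpha>"
    and "c\<^sub>\<alpha> > 0"
    and "\<forall>\<^sub>F t in nhds 0. char (distr M borel (\<xi> 0)) t =
           exp (- complex_of_real (c\<^sub>\<alpha> * \<bar>t\<bar> powr \<alpha> * L_fun M (\<xi> 0) \<alpha> (1 / \<bar>t\<bar>)) *
                (1 - \<i> * complex_of_real ((c\<^sub>p - c\<^sub>m) * stable_tau \<alpha> t)))"
    and "\<And>n. n \<ge> 1 \<Longrightarrow>
           (\<lambda>i. \<bar>b n i\<bar> powr \<alpha> * L_fun M (\<xi> 0) \<alpha> (1 / \<bar>b n i\<bar>)) summable_on UNIV"
    and "incseq F" "\<And>k. finite (F k)" "(\<Union>k. F k) = UNIV"
    and "filterlim (\<lambda>n. norming \<alpha> (L_fun M (\<xi> 0) \<alpha>) (b n)) at_top sequentially"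
    and "limsup (\<lambda>n. SUP i. ereal \<bar>b n i\<bar>) = \<infinity> \<Longrightarrow>
           (\<lambda>n. SUP i. \<bar>increment (b n) i\<bar>) \<in> o(\<lambda>n. norming \<alpha> (L_fun M (\<xi> 0) \<alpha>) (b n))"
  shows "let L = L_fun M (\<xi> 0) \<alpha>;
             B = (\<lambda>n. norming \<alpha> L (b n));
             c' = (\<lambda>n i. b n i / B n);
             S = (\<lambda>n. series_sum F (\<lambda>i \<omega>. b n i * \<xi> i \<omega>));
             G = stable_law \<alpha> c\<^sub>\<alpha> (c\<^sub>p - c\<^sub>m)
         in
           (\<forall>c. 0 \<le> c \<and> c \<le> 1 \<and>
              (\<lambda>n. \<Sum>\<^sub>\<infinity>i | c' n i > 0. \<bar>c' n i\<bar> powr \<alpha> * L (1 / \<bar>c' n i\<bar>)) \<longlonglongrightarrow> c \<and>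
              (\<lambda>n. \<Sum>\<^sub>\<infinity>i | c' n i < 0. \<bar>c' n i\<bar> powr \<alpha> * L (1 / \<bar>c' n i\<bar>)) \<longlonglongrightarrow> 1 - c \<longrightarrow>
              (let Z = distr (G \<Otimes>\<^sub>M G) borel
                         (\<lambda>(s', s''). c powr (1 / \<alpha>) * s' - (1 - c) powr (1 / \<alpha>) * s'')
               in alpha_stable \<alpha> G \<and> alpha_stable \<alpha> Z \<and>
                  weak_conv_m (\<lambda>n. distr M borel (\<lambda>\<omega>. S n \<omega> / B n)) Z)) \<and>
           (symmetric_rv M (\<xi> 0) \<or> (\<forall>n\<ge>1. \<forall>i. b n i \<ge> 0) \<longrightarrow>
              alpha_stable \<alpha> G \<and>
              weak_conv_m (\<lambda>n. distr M borel (\<lambda>\<omega>. S n \<omega> / B n)) G)"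
proof -
  \<comment> \<open>Everything in beta times tau except the sign of t. At \<alpha> = 2 it is 0
    whatever the balance constants are, as tan \<pi> = 0.\<close>
  define \<kappa> where "\<kappa> = (c\<^sub>p - c\<^sub>m) * (if \<alpha> = 1 then 0 else tan (pi * \<alpha> / 2))"
  have tau: "(c\<^sub>p - c\<^sub>m) * stable_tau \<alpha> t = \<kappa> * sgn t" for t
    by (simp add: stable_tau_def \<kappa>_def)
  interpret prob_space M by fact
  have rv: "random_variable borel (\<xi> 0)" using assms(4) by (simp add: indep_vars_def)
  interpret heavy_tail M "\<xi> 0" \<alpha>
    using rv assms(2,3,6) tail_ratio_of_domain[OF assms(7)] by unfold_locales auto
  interpret innovations M "\<xi> 0" \<alpha> c\<^sub>\<alpha> \<kappa> \<xi> F
  proof unfold_locales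
    show "eventually (\<lambda>t. char (distr M borel (\<xi> 0)) t
      = exp (- complex_of_real (c\<^sub>\<alpha> * weight \<bar>t\<bar>) * (1 - \<i> * complex_of_real (\<kappa> * sgn t)))) (nhds 0)"
      using assms(10) by (simp add: tau weight_def mult.assoc)
  qed (use assms in auto)
  define G where "G = stable_law \<alpha> c\<^sub>\<alpha> (c\<^sub>p - c\<^sub>m)"
  define B where "B n = norming \<alpha> L (b n)" for n
  define c' where "c' n i = b n i / B n" for n i
  \<comment> \<open>For the definite description, existence comes from the limit of normed sums and
    uniqueness from the characteristic function.\<close>
  have "real_distribution G \<and> (\<forall>t. char G t = stable_char c\<^sub>\<alpha> \<alpha> \<kappa> t)"
  proof -
    obtain \<mu> where \<mu>: "real_distribution \<mu>" "\<And>t. char \<mu> t = stable_char c\<^sub>\<alpha> \<alpha> \<kappa> t"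
      using stable_distribution_exists[OF infinite_UNIV_int_vec] by blast
    have "G = (THE G. real_distribution G \<and> (\<forall>t. char G t = stable_char c\<^sub>\<alpha> \<alpha> \<kappa> t))"
      by (simp add: G_def stable_law_def stable_char_def tau)
    also have "\<dots> = \<mu>"
      using \<mu> by (intro the_equality) (auto intro!: Levy_uniqueness simp: fun_eq_iff)
    finally show ?thesis using \<mu> by simp
  qed
  then have G: "real_distribution G" "\<And>t. char G t = stable_char c\<^sub>\<alpha> \<alpha> \<kappa> t" by auto
  interpret G: real_distribution G by fact
  interpret GG: pair_prob_space G G ..
  have stable_G: "alpha_stable \<alpha> G"
    using G c_pos \<alpha> by (intro alpha_stable_of_char) auto
  have Btop: "filterlim B at_top sequentially" using assms(15) by (simp add: B_def[abs_def])
  have sum: "eventually (\<lambda>n. B n > 1 \<and> (\<lambda>i. weight \<bar>b n i / B n\<bar>) summable_on UNIV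
      \<and> (\<Sum>\<^sub>\<infinity>i. weight \<bar>b n i / B n\<bar>) = 1) sequentially"
    unfolding B_def by (rule eventually_norming_sum) (rule assms(15))
  have small: "eventually (\<lambda>n. \<forall>i. \<bar>b n i / B n\<bar> < e) sequentially" if "e > 0" for e
    unfolding B_def using that by (intro eventually_small assms(15,16))
  define p where "p n = (\<Sum>\<^sub>\<infinity>i | c' n i > 0. \<bar>c' n i\<bar> powr \<alpha> * L (1 / \<bar>c' n i\<bar>))" for n
  define q where "q n = (\<Sum>\<^sub>\<infinity>i | c' n i < 0. \<bar>c' n i\<bar> powr \<alpha> * L (1 / \<bar>c' n i\<bar>))" for n
  \<comment> \<open>The two sums of the theorem determine the skewness p - q of the exponent; their
    total is 1 as soon as the norming is exact.\<close>
  have sum_sgn: "eventually (\<lambda>n. (\<Sum>\<^sub>\<infinity>i. weight \<bar>b n i / B n\<bar> * sgn (b n i / B n)) = p n - q n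
      \<and> p n + q n = 1) sequentially"
    using sum
  proof eventually_elim
    case (elim n)
    then have w: "(\<lambda>i. weight \<bar>c' n i\<bar>) summable_on UNIV" "(\<Sum>\<^sub>\<infinity>i. weight \<bar>c' n i\<bar>) = 1"
      unfolding c'_def by blast+
    have pq: "p n = (\<Sum>\<^sub>\<infinity>i | c' n i > 0. weight \<bar>c' n i\<bar>)" "q n = (\<Sum>\<^sub>\<infinity>i | c' n i < 0. weight \<bar>c' n i\<bar>)"
      by (simp_all only: p_def q_def weight_def)
    have "(\<Sum>\<^sub>\<infinity>i. weight \<bar>c' n i\<bar> * sgn (c' n i)) = p n - q n" "p n + q n = 1"
      unfolding pq using infsum_split_sign[OF w(1), of "c' n"] w(2) by simp_all
    then show ?case unfolding c'_def by blast
  qed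
  have conv: "weak_conv_m (\<lambda>n. distr M borel (\<lambda>\<omega>. series (b n) \<omega> / B n)) Z"
    if "(\<lambda>n. \<kappa> * (p n - q n)) \<longlonglongrightarrow> \<theta>" "real_distribution Z" "\<And>t. char Z t = stable_char c\<^sub>\<alpha> \<alpha> \<theta> t"
    for \<theta> Z
  proof (rule weak_conv_normed_series[OF sum small _ that(2,3)])
    have "eventually (\<lambda>n. \<kappa> * (p n - q n)
        = \<kappa> * (\<Sum>\<^sub>\<infinity>i. weight \<bar>b n i / B n\<bar> * sgn (b n i / B n))) sequentially"
      using sum_sgn by eventually_elim simp
    with that(1) show "(\<lambda>n. \<kappa> * (\<Sum>\<^sub>\<infinity>i. weight \<bar>b n i / B n\<bar> * sgn (b n i / B n))) \<longlonglongrightarrow> \<theta>"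
      by (rule Lim_transform_eventually)
  qed
  have part1: "alpha_stable \<alpha> Z \<and> weak_conv_m (\<lambda>n. distr M borel (\<lambda>\<omega>. series (b n) \<omega> / B n)) Z"
    if c: "0 \<le> c" "c \<le> 1" "p \<longlonglongrightarrow> c" "q \<longlonglongrightarrow> 1 - c"
      and Z: "Z = distr (G \<Otimes>\<^sub>M G) borel
        (\<lambda>(s', s''). c powr (1 / \<alpha>) * s' - (1 - c) powr (1 / \<alpha>) * s'')" for c Z
  proof -
    \<comment> \<open>A negative second coefficient brings the difference into the scope of the
      formula for linear combinations of independent variables.\<close>
    have Z': "Z = distr (G \<Otimes>\<^sub>M G) borel
        (\<lambda>(s', s''). c powr (1 / \<alpha>) * s' + (- ((1 - c) powr (1 / \<alpha>))) * s'')"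
      by (simp add: Z)
    have dZ: "real_distribution Z"
      unfolding Z by (intro GG.P.real_distribution_distr) auto
    have pw: "(x powr (1 / \<alpha>)) powr \<alpha> = x" if "x \<ge> 0" for x
      using that \<alpha> by (simp add: powr_powr)
    have chZ: "char Z t = stable_char c\<^sub>\<alpha> \<alpha> (\<kappa> * (c - (1 - c))) t" for t
    proof -
      have abs: "\<bar>c powr (1 / \<alpha>) * t\<bar> powr \<alpha> = c * \<bar>t\<bar> powr \<alpha>"
        "\<bar>- ((1 - c) powr (1 / \<alpha>)) * t\<bar> powr \<alpha> = (1 - c) * \<bar>t\<bar> powr \<alpha>"
        using c pw[of c] pw[of "1 - c"] by (auto simp: abs_mult powr_mult)
      \<comment> \<open>The factors c and 1 - c are kept because at c = 0 the first sign is 0 rather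
        than sgn t, and likewise the second one at c = 1.\<close>
      have sg: "c * sgn (c powr (1 / \<alpha>) * t) = c * sgn t"
        "(1 - c) * sgn (- ((1 - c) powr (1 / \<alpha>)) * t) = - ((1 - c) * sgn t)"
        using c by (cases "c = 0"; simp add: sgn_mult) (cases "c = 1"; simp add: sgn_mult)
      have "char Z t = char G (c powr (1 / \<alpha>) * t) * char G (- ((1 - c) powr (1 / \<alpha>)) * t)"
        unfolding Z' by (rule char_affine_pair[OF G(1) G(1)])
      also have "\<dots> = exp (- complex_of_real (c\<^sub>\<alpha> * \<bar>t\<bar> powr \<alpha>) * complex_of_real (c + (1 - c))
          + \<i> * complex_of_real (c\<^sub>\<alpha> * \<bar>t\<bar> powr \<alpha> * \<kappa>)
            * complex_of_real (c * sgn (c powr (1 / \<alpha>) * t) + (1 - c) * sgn (- ((1 - c) powr (1 / \<alpha>)) * t)))"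
        unfolding G(2) stable_char_def exp_add[symmetric] abs
        by (rule arg_cong[where f=exp]) (simp only: of_real_mult of_real_add, algebra)
      also have "\<dots> = stable_char c\<^sub>\<alpha> \<alpha> (\<kappa> * (c - (1 - c))) t"
        unfolding sg stable_char_def
        by (rule arg_cong[where f=exp]) (simp add: algebra_simps)
      finally show ?thesis .
    qed
    \<comment> \<open>In the series and in \<open>Z\<close> alike, the skewness is
      \<open>\<kappa>\<close> times the positive minus the negative share.\<close>
    have "(\<lambda>n. \<kappa> * (p n - q n)) \<longlonglongrightarrow> \<kappa> * (c - (1 - c))" using c by (intro tendsto_intros)
    with conv dZ chZ alpha_stable_of_char[OF dZ chZ c_pos] \<alpha> show ?thesis by blast
  qed
  have part2: "weak_conv_m (\<lambda>n. distr M borel (\<lambda>\<omega>. series (b n) \<omega> / B n)) G"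
    if "symmetric_rv M (\<xi> 0) \<or> (\<forall>n\<ge>1. \<forall>i. b n i \<ge> 0)"
  proof (rule conv[OF _ G])
    from that show "(\<lambda>n. \<kappa> * (p n - q n)) \<longlonglongrightarrow> \<kappa>"
    proof
      assume sym: "symmetric_rv M (\<xi> 0)"
      \<comment> \<open>With vanishing skewness the shares p and q may oscillate without affecting
        the limit.\<close>
      have "\<kappa> = 0"
      proof (cases "\<alpha> < 2")
        case True
        then show ?thesis using balance_eq_of_symmetric[OF rv sym assms(7)] by (simp add: \<kappa>_def)
      next
        case False
        then have "\<alpha> = 2" using \<alpha> by simp
        then show ?thesis by (simp add: \<kappa>_def)
      qed
      then show ?thesis by simp
    next
      assume nonneg: "\<forall>n\<ge>1. \<forall>i. b n i \<ge> 0"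
      have "eventually (\<lambda>n. \<kappa> * (p n - q n) = \<kappa>) sequentially"
        using sum sum_sgn eventually_ge_at_top[of 1]
      proof eventually_elim
        case (elim n)
        \<comment> \<open>As \<open>B n\<close> is positive, no negative share is left, so q = 0 and
          p = 1 exactly.\<close>
        then have "{i. c' n i < 0} = {}" using nonneg by (auto simp: c'_def not_less)
        then have "q n = 0" by (simp add: q_def)
        then show ?case using elim by simp
      qed
      then show ?thesis by (rule tendsto_eventually)
    qed
  qed
  show ?thesis
    unfolding Let_def
    using part1 part2 stable_G unfolding p_def[abs_def] q_def[abs_def] c'_def B_def G_def
    by blast
qed

end
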